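(* There is a Monte Carlo algorithm (constant success probability) that, given an integer $d$ divisible by $4$ and two families $\mathcal{A},\mathcal{B}\subseteq\binom{[d]}{d/4}$ each of size at most $N$, decides whether there exist $A\in\mathcal{A}$ and $B\in\mathcal{B}$ with $A\cap B=\emptyset$, using $\widetilde{\mathcal{O}}\left(N\cdot 2^d/\binom{d}{d/4}\right)$ time and $\widetilde{\mathcal{O}}(N+2^d)$ space.
   Context: $\binom{[d]}{k}$ denotes the family of all $k$-element subsets of $[d]=\{1,\ldots,d\}$; such sets correspond to vectors in $\{0,1\}^d$ of Hamming weight $k$, and disjointness corresponds to orthogonality. $\widetilde{\mathcal{O}}$ hides factors polylogarithmic in the input size (equivalently, factors polynomial in $d$ and $\log N$). *)

theory Defs
  imports "HOL-Probability.Probability" "HOL-Library.Ramsey" "HOL-Library.Log_Nat"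
begin

text \<open>
  A randomised word RAM. Registers and memory cells hold words of w bits, and every arithmetic
  result is reduced modulo \<open>2 ^ w\<close>; only subtraction is truncated at 0. Division and remainder by 0
  are those of the type of natural numbers.
\<close>

datatype binop = Add | Sub | Mul | Div | Mod | And | Or | Xor | Shl | Shr | Less | Equal

datatype aexp = Const nat | Reg nat | Bin binop aexp aexp

datatype com =
    Skip
  | Assign nat aexp
  | Load nat aexp
  | Store aexp aexp
  | Flip nat
  | Seq com com
  | Cond aexp com com
  | While aexp com

fun binop_val :: "binop \<Rightarrow> nat \<Rightarrow> nat \<Rightarrow> nat" where
  "binop_val Add x y = x + y"
| "binop_val Sub x y = x - y"
| "binop_val Mul x y = x * y"
| "binop_val Div x y = x div y"
| "binop_val Mod x y = x mod y"
| "binop_val And x y = semiring_bit_operations_class.and x y"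
| "binop_val Or x y = semiring_bit_operations_class.or x y"
| "binop_val Xor x y = semiring_bit_operations_class.xor x y"
| "binop_val Shl x y = push_bit y x"
| "binop_val Shr x y = drop_bit y x"
| "binop_val Less x y = of_bool (x < y)"
| "binop_val Equal x y = of_bool (x = y)"

fun aval :: "nat \<Rightarrow> (nat \<Rightarrow> nat) \<Rightarrow> aexp \<Rightarrow> nat" where
  "aval w r (Const n) = n mod 2 ^ w"
| "aval w r (Reg x) = r x"
| "aval w r (Bin f a b) = binop_val f (aval w r a) (aval w r b) mod 2 ^ w"

text \<open>Evaluating an expression costs one time unit per node.\<close>

fun acost :: "aexp \<Rightarrow> nat" where
  "acost (Bin f a b) = 1 + acost a + acost b"
| "acost _ = 1"

text \<open>A state consists of the registers, the memory and the coin tosses not yet consumed.\<close>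

type_synonym state = "(nat \<Rightarrow> nat) \<times> (nat \<Rightarrow> nat) \<times> bool list"

text \<open>
  \<open>exec w M c s t s'\<close>: with word size w and the memory cells \<open>0, \<dots>, M - 1\<close>, the program c started in s
  halts in s' after t time units. Accessing an address outside these cells, or tossing a coin when
  none is left, gets stuck: there is then no final state. A condition is true iff it is nonzero.
\<close>

inductive exec :: "nat \<Rightarrow> nat \<Rightarrow> com \<Rightarrow> state \<Rightarrow> nat \<Rightarrow> state \<Rightarrow> bool"
  for w M :: nat where
  Skip: "exec w M Skip s 1 s"
| Assign: "exec w M (Assign x a) (r, m, cs) (1 + acost a) (r(x := aval w r a), m, cs)"
| Load: "aval w r a < M \<Longrightarrow>
    exec w M (Load x a) (r, m, cs) (1 + acost a) (r(x := m (aval w r a)), m, cs)"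
| Store: "aval w r a < M \<Longrightarrow>
    exec w M (Store a b) (r, m, cs) (1 + acost a + acost b) (r, m(aval w r a := aval w r b), cs)"
| Flip: "exec w M (Flip x) (r, m, c # cs) 1 (r(x := of_bool c mod 2 ^ w), m, cs)"
| Seq: "exec w M c1 s1 t1 s2 \<Longrightarrow> exec w M c2 s2 t2 s3 \<Longrightarrow> exec w M (Seq c1 c2) s1 (t1 + t2) s3"
| CondTrue: "aval w (fst s) a \<noteq> 0 \<Longrightarrow> exec w M c1 s t s' \<Longrightarrow>
    exec w M (Cond a c1 c2) s (1 + acost a + t) s'"
| CondFalse: "aval w (fst s) a = 0 \<Longrightarrow> exec w M c2 s t s' \<Longrightarrow>
    exec w M (Cond a c1 c2) s (1 + acost a + t) s'"
| WhileFalse: "aval w (fst s) a = 0 \<Longrightarrow> exec w M (While a c) s (1 + acost a) s"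
| WhileTrue: "aval w (fst s1) a \<noteq> 0 \<Longrightarrow> exec w M c s1 t1 s2 \<Longrightarrow>
    exec w M (While a c) s2 t2 s3 \<Longrightarrow> exec w M (While a c) s1 (1 + acost a + t1 + t2) s3"

inductive_cases SkipE: "exec w M Skip s t s'"
inductive_cases AssignE: "exec w M (Assign x a) s t s'"
inductive_cases LoadE: "exec w M (Load x a) s t s'"
inductive_cases StoreE: "exec w M (Store a b) s t s'"
inductive_cases FlipE: "exec w M (Flip x) s t s'"
inductive_cases SeqE: "exec w M (Seq c1 c2) s t s'"
inductive_cases CondE: "exec w M (Cond a c1 c2) s t s'"
inductive_cases WhileE: "exec w M (While a c) s t s'"

lemma exec_deterministic:
  "exec w M c s t s' \<Longrightarrow> exec w M c s u s'' \<Longrightarrow> u = t \<and> s'' = s'"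
proof (induction arbitrary: u s'' rule: exec.induct)
  case (Skip s)
  then show ?case by (rule SkipE) simp
next
  case (Assign x a r m cs)
  then show ?case by (rule AssignE) simp
next
  case (Load r a x m cs)
  from Load.prems show ?case by (rule LoadE) simp
next
  case (Store r a b m cs)
  from Store.prems show ?case by (rule StoreE) simp
next
  case (Flip x r m c cs)
  then show ?case by (rule FlipE) simp
next
  case (Seq c1 s1 t1 s2 c2 t2 s3)
  from Seq.prems obtain v1 v2 z where
    "u = v1 + v2" "exec w M c1 s1 v1 z" "exec w M c2 z v2 s''"
    by (rule SeqE)
  with Seq.IH show ?case by metis
next
  case (CondTrue s a c1 t s' c2)
  from CondTrue.prems obtain v where v: "u = 1 + acost a + v" "exec w M c1 s v s''"
    by (rule CondE) (use CondTrue.hyps(1) in simp_all)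
  from CondTrue.IH[OF v(2)] v(1) show ?case by simp
next
  case (CondFalse s a c2 t s' c1)
  from CondFalse.prems obtain v where v: "u = 1 + acost a + v" "exec w M c2 s v s''"
    by (rule CondE) (use CondFalse.hyps(1) in simp_all)
  from CondFalse.IH[OF v(2)] v(1) show ?case by simp
next
  case (WhileFalse s a c)
  from WhileFalse.prems show ?case
    by (rule WhileE) (use WhileFalse.hyps in simp_all)
next
  case (WhileTrue s1 a c t1 s2 t2 s3)
  from WhileTrue.prems obtain v1 v2 z where
    v: "u = 1 + acost a + v1 + v2" "exec w M c s1 v1 z" "exec w M (While a c) z v2 s''"
    by (rule WhileE) (use WhileTrue.hyps(1) in simp_all)
  from WhileTrue.IH(1)[OF v(2)] WhileTrue.IH(2)[of v2 s''] v(1,3) show ?case by simp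
qed

text \<open>
  Initially all registers are 0, and so are all memory cells beyond the input ws. The answer is left
  in register 0.
\<close>

definition init_state :: "nat list \<Rightarrow> bool list \<Rightarrow> state" where
  "init_state ws cs = ((\<lambda>_. 0), (\<lambda>i. if i < length ws then ws ! i else 0), cs)"

definition answers :: "nat \<Rightarrow> nat \<Rightarrow> nat \<Rightarrow> com \<Rightarrow> nat list \<Rightarrow> bool \<Rightarrow> bool list \<Rightarrow> bool" where
  "answers w M T P ws q cs \<longleftrightarrow>
     (\<exists>t r m cs'. t \<le> T \<and> exec w M P (init_state ws cs) t (r, m, cs') \<and> r 0 = of_bool q)"

text \<open>
  Every sequence of coin tosses leads to an answer within time T and M words of memory, and the
  answer is q with probability at least p over fair independent tosses. The number n of tosses
  supplied is immaterial: by the first condition the program never runs out of them, and it has no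
  means of detecting how many are left.
\<close>

definition monte_carlo :: "real \<Rightarrow> nat \<Rightarrow> nat \<Rightarrow> nat \<Rightarrow> com \<Rightarrow> nat list \<Rightarrow> bool \<Rightarrow> bool" where
  "monte_carlo p w M T P ws q \<longleftrightarrow>
     (\<exists>n. (\<forall>cs. length cs = n \<longrightarrow> (\<exists>a. answers w M T P ws a cs)) \<and>
          measure_pmf.prob (replicate_pmf n (bernoulli_pmf (1/2))) {cs. answers w M T P ws q cs} \<ge> p)"

text \<open>The characteristic vector in \<open>{0,1}\<^sup>d\<close> of a subset of \<open>{1..d}\<close>, packed into one word.\<close>

definition set_word :: "nat set \<Rightarrow> nat" where
  "set_word A = (\<Sum>i\<in>A. 2 ^ (i - 1))"

definition instance_words :: "nat \<Rightarrow> nat set list \<Rightarrow> nat set list \<Rightarrow> nat list" where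
  "instance_words d As Bs = [d, length As, length Bs] @ map set_word As @ map set_word Bs"

end

(*
  Cut the universe into 8 blocks of n bits, n = d div 8 + 1, and let a_i and b_i be the number of
  elements of A and B in block i of a disjoint pair (A, B). For the right guess of these numbers,
  take in every block i a random family of words of weight a_i + h_i div 2, where
  h_i = n - a_i - b_i, each word being kept with probability 2^-h_i. Then C(h_i, h_i div 2) >=
  2^h_i / (h_i + 1) words of that weight separate A from B inside the block, so all blocks contain a
  separating word with probability at least (n + 2)^-8. A separator S of the pair is a choice of one
  word per block. By C(N, k) <= 2^k (3/2)^N the expected number of choices that contain A, or avoid
  B, is at most 26 (27/16)^(d/4), and (27/16)^(d/4) <= 2^d / C(d, d/4). Hence listing, for every
  input set, at most polynomially many times (27/16)^(d/4) choices, and skipping the sets that have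
  more, loses only a constant factor in the success probability (Markov). The choices containing
  some A are marked in a table of size 2^(8n), the choices avoiding some B are looked up there, and a
  marked entry that is hit certifies a disjoint pair; the error is therefore one-sided. Trying the
  polynomially many guesses, each with polynomially many independent repetitions, gives success
  probability 2/3. Scanning a whole block costs only 2^n <= 2 (27/16)^(d/4).
*)

theory Submission
  imports Defs
begin

section \<open>Execution of word RAM programs\<close>

text \<open>The rate 27/16 is forced: for d = 4m the target 2^d / C(d, m) grows like (27/16)^m up to
  polynomial factors, and so does C(3m, m) / 4^m, the expected number of surviving words of weight
  2m that contain A if each survives with probability 4^-m. The obstacle is that a single random
  family over the whole universe would have to be scanned in full for each input set. A family that
  is a product over blocks can be listed from the eight lists of its factors. Eight blocks are
  enough, since 2^(d/8) is about sqrt(2)^m, and a fixed number of blocks keeps the guesses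
  polynomial. A pair may be spread unevenly over the blocks. This is why C(N, k) is bounded by a
  product of powers: multiplied over the blocks, the bound depends only on the totals of N and k. To
  survive with probability 2^-h means that h fair coins attached to the word are all set. These
  coins are indexed by repetition, block, word and position, never by the input set, so A and B meet
  the same family.\<close>

definition runs :: "nat \<Rightarrow> nat \<Rightarrow> com \<Rightarrow> state \<Rightarrow> nat \<Rightarrow> (state \<Rightarrow> bool) \<Rightarrow> bool" where
  "runs w M c s T Q \<longleftrightarrow> (\<exists>t s'. exec w M c s t s' \<and> t \<le> T \<and> Q s')"

fun pval :: "(nat \<Rightarrow> nat) \<Rightarrow> aexp \<Rightarrow> nat" where
  "pval r (Const n) = n"
| "pval r (Reg x) = r x"
| "pval r (Bin f a b) = binop_val f (pval r a) (pval r b)"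

text \<open>The operations outside the list never exceed their left operand, also for division and
  remainder by 0, so they cannot overflow once the operands fit. Comparisons are listed because the
  truth value 1 does not fit into a word of length 0.\<close>

fun no_overflow :: "nat \<Rightarrow> (nat \<Rightarrow> nat) \<Rightarrow> aexp \<Rightarrow> bool" where
  "no_overflow w r (Const n) \<longleftrightarrow> n < 2 ^ w"
| "no_overflow w r (Reg x) \<longleftrightarrow> r x < 2 ^ w"
| "no_overflow w r (Bin f a b) \<longleftrightarrow> no_overflow w r a \<and> no_overflow w r b \<and>
     (f \<in> {Add, Mul, Or, Xor, Shl, Less, Equal} \<longrightarrow> binop_val f (pval r a) (pval r b) < 2 ^ w)"

lemma aval_no_overflow:
  "no_overflow w r e \<Longrightarrow> aval w r e = pval r e \<and> pval r e < 2 ^ w"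
proof (induction e)
  case (Bin f a b)
  then have ab: "aval w r a = pval r a" "pval r a < 2 ^ w" "aval w r b = pval r b" "pval r b < 2 ^ w"
    by auto
  have "binop_val f (pval r a) (pval r b) < 2 ^ w"
  proof (cases "f \<in> {Add, Mul, Or, Xor, Shl, Less, Equal}")
    case True
    with Bin.prems show ?thesis by auto
  next
    case False
    then have "binop_val f (pval r a) (pval r b) \<le> pval r a"
      by (cases f) (auto simp: drop_bit_eq_div and_nat_def and_less_eq zless_nat_conj nat_le_iff)
    with ab show ?thesis by linarith
  qed
  with ab show ?case by simp
qed simp_all

fun mod_regs :: "com \<Rightarrow> nat set" where
  "mod_regs Skip = {}"
| "mod_regs (Assign x a) = {x}"
| "mod_regs (Load x a) = {x}"
| "mod_regs (Store a b) = {}"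
| "mod_regs (Flip x) = {x}"
| "mod_regs (Seq c1 c2) = mod_regs c1 \<union> mod_regs c2"
| "mod_regs (Cond a c1 c2) = mod_regs c1 \<union> mod_regs c2"
| "mod_regs (While a c) = mod_regs c"

lemma exec_frame:
  "exec w M c s t s' \<Longrightarrow> x \<notin> mod_regs c \<Longrightarrow> fst s' x = fst s x"
  by (induction rule: exec.induct) auto

lemma runs_frame:
  assumes "runs w M c (r, m, cs) T Q"
  shows "runs w M c (r, m, cs) T
    (\<lambda>(r', m', cs'). Q (r', m', cs') \<and> (\<forall>x. x \<notin> mod_regs c \<longrightarrow> r' x = r x))"
  using assms exec_frame[of w M c "(r, m, cs)"] unfolding runs_def by fastforce

lemma runs_weaken:
  assumes "runs w M c s T Q" "T \<le> T'" "\<And>s'. Q s' \<Longrightarrow> Q' s'"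
  shows "runs w M c s T' Q'"
  using assms unfolding runs_def by (meson order_trans)

lemma runs_Skip: "Q s \<Longrightarrow> 1 \<le> T \<Longrightarrow> runs w M Skip s T Q"
  unfolding runs_def by (blast intro: exec.intros)

lemma runs_Assign:
  assumes "no_overflow w r a" "1 + acost a \<le> T" "Q (r(x := pval r a), m, cs)"
  shows "runs w M (Assign x a) (r, m, cs) T Q"
  unfolding runs_def using assms aval_no_overflow[of w r a] exec.Assign[of w M x a r m cs] by metis

lemma runs_Load:
  assumes "no_overflow w r a" "1 + acost a \<le> T" "pval r a < M"
    "Q (r(x := m (pval r a)), m, cs)"
  shows "runs w M (Load x a) (r, m, cs) T Q"
  unfolding runs_def using assms aval_no_overflow[of w r a] exec.Load[of w r a M x m cs] by metis

lemma runs_Store: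
  assumes "no_overflow w r a" "no_overflow w r b" "1 + acost a + acost b \<le> T" "pval r a < M"
    "Q (r, m(pval r a := pval r b), cs)"
  shows "runs w M (Store a b) (r, m, cs) T Q"
  unfolding runs_def
  using assms aval_no_overflow[of w r a] aval_no_overflow[of w r b] exec.Store[of w r a M b m cs]
  by metis

lemma runs_Flip:
  assumes "w \<ge> 1" "1 \<le> T" "Q (r(x := of_bool c), m, cs)"
  shows "runs w M (Flip x) (r, m, c # cs) T Q"
proof -
  have "(1::nat) < 2 ^ w" using assms(1) by (intro one_less_power) auto
  then have "of_bool c mod 2 ^ w = (of_bool c :: nat)" using assms(1) by (cases c) auto
  then show ?thesis
    unfolding runs_def using assms exec.Flip[of w M x r m c cs] by metis
qed

lemma runs_Seq:
  assumes "runs w M c1 s T1 Q1" "\<And>s'. Q1 s' \<Longrightarrow> runs w M c2 s' T2 Q" "T1 + T2 \<le> T"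
  shows "runs w M (Seq c1 c2) s T Q"
proof -
  obtain t1 s1 where 1: "exec w M c1 s t1 s1" "t1 \<le> T1" "Q1 s1"
    using assms(1) unfolding runs_def by blast
  obtain t2 s2 where 2: "exec w M c2 s1 t2 s2" "t2 \<le> T2" "Q s2"
    using assms(2)[OF 1(3)] unfolding runs_def by blast
  have "t1 + t2 \<le> T" using 1 2 assms(3) by linarith
  with 1 2 show ?thesis unfolding runs_def using exec.Seq by blast
qed

lemma runs_Cond:
  assumes "no_overflow w r a"
    "pval r a \<noteq> 0 \<Longrightarrow> runs w M c1 (r, m, cs) T Q"
    "pval r a = 0 \<Longrightarrow> runs w M c2 (r, m, cs) T Q"
    "1 + acost a + T \<le> T'"
  shows "runs w M (Cond a c1 c2) (r, m, cs) T' Q"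
proof (cases "pval r a = 0")
  case True
  then obtain t s' where "exec w M c2 (r, m, cs) t s'" "t \<le> T" "Q s'"
    using assms(3) unfolding runs_def by blast
  moreover have "aval w (fst (r, m, cs)) a = 0"
    using True aval_no_overflow[OF assms(1)] by simp
  ultimately show ?thesis
    unfolding runs_def using exec.CondFalse assms(4)
    by (intro exI[of _ "1 + acost a + t"] exI[of _ s']) auto
next
  case False
  then obtain t s' where "exec w M c1 (r, m, cs) t s'" "t \<le> T" "Q s'"
    using assms(2) unfolding runs_def by blast
  moreover have "aval w (fst (r, m, cs)) a \<noteq> 0"
    using False aval_no_overflow[OF assms(1)] by simp
  ultimately show ?thesis
    unfolding runs_def using exec.CondTrue assms(4)
    by (intro exI[of _ "1 + acost a + t"] exI[of _ s']) auto
qed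

lemma runs_Seq_Assign:
  assumes "no_overflow w r a" "runs w M c (r(x := pval r a), m, cs) T Q" "1 + acost a + T \<le> T'"
  shows "runs w M (Seq (Assign x a) c) (r, m, cs) T' Q"
  by (rule runs_Seq[OF runs_Assign[OF assms(1) order_refl, where Q = "\<lambda>s. s = (r(x := pval r a), m, cs)"]])
    (use assms in auto)

lemma runs_Seq_Load:
  assumes "no_overflow w r a" "pval r a < M" "runs w M c (r(x := m (pval r a)), m, cs) T Q"
    "1 + acost a + T \<le> T'"
  shows "runs w M (Seq (Load x a) c) (r, m, cs) T' Q"
  by (rule runs_Seq[OF runs_Load[OF assms(1) order_refl assms(2), where Q = "\<lambda>s. s = (r(x := m (pval r a)), m, cs)"]])
    (use assms in auto)

lemma runs_Seq_Store:
  assumes "no_overflow w r a" "no_overflow w r b" "pval r a < M"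
    "runs w M c (r, m(pval r a := pval r b), cs) T Q" "1 + acost a + acost b + T \<le> T'"
  shows "runs w M (Seq (Store a b) c) (r, m, cs) T' Q"
  by (rule runs_Seq[OF runs_Store[OF assms(1,2) order_refl assms(3), where Q = "\<lambda>s. s = (r, m(pval r a := pval r b), cs)"]])
    (use assms in auto)

definition For :: "nat \<Rightarrow> aexp \<Rightarrow> com \<Rightarrow> com" where
  "For x e c = Seq (Assign x (Const 0))
     (While (Bin Less (Reg x) e) (Seq c (Assign x (Bin Add (Reg x) (Const 1)))))"

lemma mod_regs_For [simp]: "mod_regs (For x e c) = insert x (mod_regs c)"
  by (auto simp: For_def)

fun exp_regs :: "aexp \<Rightarrow> nat set" where
  "exp_regs (Const n) = {}"
| "exp_regs (Reg x) = {x}"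
| "exp_regs (Bin f a b) = exp_regs a \<union> exp_regs b"

lemma aval_cong: "(\<And>x. x \<in> exp_regs e \<Longrightarrow> r x = r' x) \<Longrightarrow> aval w r e = aval w r' e"
  by (induction e) auto

text \<open>The limit \<open>e\<close> is evaluated anew in every round; tying the registers that
  the loop leaves alone to \<open>r0\<close> keeps its value at \<open>N\<close>. The invariant is
  stated for the state after the increment, so that \<open>step\<close> speaks of the body alone.
  Per round, test and increment cost 4 units each; the last 4 units pay for the failing
  test.\<close>

lemma runs_While_up:
  fixes Inv :: "nat \<Rightarrow> (nat \<Rightarrow> nat) \<Rightarrow> (nat \<Rightarrow> nat) \<Rightarrow> bool list \<Rightarrow> bool"
  assumes N: "N < 2 ^ w"
    and e: "\<And>r'. (\<forall>y. y \<notin> insert x (mod_regs c) \<longrightarrow> r' y = r0 y) \<Longrightarrow> aval w r' e = N" "acost e = 1"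
    and x: "x \<notin> mod_regs c"
    and step: "\<And>k r m cs. \<lbrakk>k < N; Inv k r m cs; r x = k;
         \<forall>y. y \<notin> insert x (mod_regs c) \<longrightarrow> r y = r0 y\<rbrakk> \<Longrightarrow>
       runs w M c (r, m, cs) T (\<lambda>(r', m', cs'). Inv (Suc k) (r'(x := Suc k)) m' cs')"
    and k: "k \<le> N" "Inv k r m cs" "r x = k"
       "\<forall>y. y \<notin> insert x (mod_regs c) \<longrightarrow> r y = r0 y"
  shows "runs w M (While (Bin Less (Reg x) e) (Seq c (Assign x (Bin Add (Reg x) (Const 1)))))
     (r, m, cs) ((N - k) * (T + 8) + 4)
     (\<lambda>(r', m', cs'). Inv N r' m' cs' \<and> r' x = N \<and> (\<forall>y. y \<notin> insert x (mod_regs c) \<longrightarrow> r' y = r0 y))"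
  using k
proof (induction "N - k" arbitrary: k r m cs)
  case 0
  then have "k = N" by simp
  with 0 e(1)[of r] have "aval w r (Bin Less (Reg x) e) = 0" by simp
  then have
    "exec w M (While (Bin Less (Reg x) e) (Seq c (Assign x (Bin Add (Reg x) (Const 1)))))
       (r, m, cs) (1 + acost (Bin Less (Reg x) e)) (r, m, cs)"
    by (intro exec.WhileFalse) simp
  with 0 \<open>k = N\<close> e(2) show ?case unfolding runs_def by fastforce
next
  case (Suc j)
  let ?W = "While (Bin Less (Reg x) e) (Seq c (Assign x (Bin Add (Reg x) (Const 1))))"
  from Suc have kN: "k < N" by simp
  then have one: "(1::nat) < 2 ^ w" and Sk: "Suc k < 2 ^ w" using N by linarith+
  have "w \<noteq> 0" using one by (rule contrapos_pn) simp
  with Suc.prems kN e(1)[of r] have cond: "aval w r (Bin Less (Reg x) e) \<noteq> 0" by simp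
  from runs_frame[OF step[OF kN Suc.prems(2-4)]] obtain t1 r1 m1 cs1 where
    1: "exec w M c (r, m, cs) t1 (r1, m1, cs1)" "t1 \<le> T" "Inv (Suc k) (r1(x := Suc k)) m1 cs1"
      "\<forall>y. y \<notin> mod_regs c \<longrightarrow> r1 y = r y"
    unfolding runs_def by auto
  have "r1 x = k" using 1(4) x Suc.prems(3) by simp
  then have "aval w r1 (Bin Add (Reg x) (Const 1)) = Suc k" using Sk \<open>w \<noteq> 0\<close> by simp
  with exec.Assign[of w M x "Bin Add (Reg x) (Const 1)" r1 m1 cs1]
  have 2: "exec w M (Assign x (Bin Add (Reg x) (Const 1))) (r1, m1, cs1) 4 (r1(x := Suc k), m1, cs1)"
    by (simp add: eval_nat_numeral)
  have "runs w M ?W (r1(x := Suc k), m1, cs1) ((N - Suc k) * (T + 8) + 4)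
     (\<lambda>(r', m', cs'). Inv N r' m' cs' \<and> r' x = N \<and> (\<forall>y. y \<notin> insert x (mod_regs c) \<longrightarrow> r' y = r0 y))"
    by (rule Suc.hyps(1)) (use Suc 1 kN in auto)
  then obtain t3 s3 where
    3: "exec w M ?W (r1(x := Suc k), m1, cs1) t3 s3" "t3 \<le> (N - Suc k) * (T + 8) + 4"
     "case s3 of (r', m', cs') \<Rightarrow> Inv N r' m' cs' \<and> r' x = N \<and> (\<forall>y. y \<notin> insert x (mod_regs c) \<longrightarrow> r' y = r0 y)"
    unfolding runs_def by auto
  have "exec w M ?W (r, m, cs) (1 + acost (Bin Less (Reg x) e) + (t1 + 4) + t3) s3"
    using exec.WhileTrue[of w "(r, m, cs)" "Bin Less (Reg x) e", OF _ exec.Seq[OF 1(1) 2] 3(1)] cond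
    by simp
  moreover have "1 + acost (Bin Less (Reg x) e) + (t1 + 4) + t3 \<le> (N - k) * (T + 8) + 4"
  proof -
    have "N - k = Suc (N - Suc k)" using kN by simp
    then have "(N - k) * (T + 8) = (N - Suc k) * (T + 8) + T + 8" by simp
    then show ?thesis using 1(2) 3(2) e(2) by simp
  qed
  ultimately show ?case using 3(3) unfolding runs_def by blast
qed

lemma runs_For:
  fixes Inv :: "nat \<Rightarrow> (nat \<Rightarrow> nat) \<Rightarrow> (nat \<Rightarrow> nat) \<Rightarrow> bool list \<Rightarrow> bool"
  assumes N: "N < 2 ^ w" "aval w r e = N"
    and e: "acost e = 1" "exp_regs e \<inter> insert x (mod_regs c) = {}"
    and x: "x \<notin> mod_regs c"
    and init: "Inv 0 (r(x := 0)) m cs"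
    and step: "\<And>k r' m' cs'. \<lbrakk>k < N; Inv k r' m' cs'; r' x = k;
         \<forall>y. y \<notin> insert x (mod_regs c) \<longrightarrow> r' y = r y\<rbrakk> \<Longrightarrow>
       runs w M c (r', m', cs') T (\<lambda>(r'', m'', cs''). Inv (Suc k) (r''(x := Suc k)) m'' cs'')"
    and T: "N * (T + 8) + 6 \<le> T'"
    and post: "\<And>r' m' cs'. \<lbrakk>Inv N r' m' cs'; r' x = N;
         \<forall>y. y \<notin> insert x (mod_regs c) \<longrightarrow> r' y = r y\<rbrakk> \<Longrightarrow> Q (r', m', cs')"
  shows "runs w M (For x e c) (r, m, cs) T' Q"
proof -
  have "0 mod 2 ^ w = (0::nat)" by simp
  have *: "runs w M (While (Bin Less (Reg x) e) (Seq c (Assign x (Bin Add (Reg x) (Const 1)))))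
     (r(x := 0), m, cs) ((N - 0) * (T + 8) + 4)
     (\<lambda>(r', m', cs'). Inv N r' m' cs' \<and> r' x = N \<and> (\<forall>y. y \<notin> insert x (mod_regs c) \<longrightarrow> r' y = r y))"
  proof (rule runs_While_up[where ?r0.0 = r and Inv = Inv])
    show "aval w r' e = N" if "\<forall>y. y \<notin> insert x (mod_regs c) \<longrightarrow> r' y = r y" for r'
      using aval_cong[of e r' r w] that e(2) N(2) by blast
  qed (use assms in auto)
  show ?thesis
    unfolding For_def
  proof (rule runs_Seq_Assign)
    show "runs w M (While (Bin Less (Reg x) e) (Seq c (Assign x (Bin Add (Reg x) (Const 1)))))
       (r(x := pval r (Const 0)), m, cs) ((N - 0) * (T + 8) + 4) Q"
      unfolding pval.simps by (rule runs_weaken[OF * order_refl]) (use post in auto)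
  qed (use T in auto)
qed

lemma runs_le: "runs w M c s T Q \<Longrightarrow> T \<le> T' \<Longrightarrow> runs w M c s T' Q"
  by (rule runs_weaken)

text \<open>Taking the bound to be the exact cost leaves it schematic, so it is accumulated while
  the program is executed symbolically. An initial \<open>runs_le\<close> postpones the comparison
  with the intended bound to the very end.\<close>

lemmas runs_Assign' = runs_Assign[OF _ order_refl]
  and runs_Seq_Assign' = runs_Seq_Assign[OF _ _ order_refl]
  and runs_Seq_Load' = runs_Seq_Load[OF _ _ _ order_refl]
  and runs_Store' = runs_Store[OF _ _ order_refl]
  and runs_Seq_Store' = runs_Seq_Store[OF _ _ _ _ order_refl]
  and runs_Seq' = runs_Seq[OF _ _ order_refl]

text \<open>Replaces a tower of register updates by a named state before a loop is entered; the
  equality becomes a goal of its own.\<close>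

lemma runs_eq_state: "runs w M c s T Q \<Longrightarrow> s' = s \<Longrightarrow> runs w M c s' T Q"
  by simp

lemma pval_cong: "(\<And>x. x \<in> exp_regs e \<Longrightarrow> r x = r' x) \<Longrightarrow> pval r e = pval r' e"
  by (induction e) auto

lemma no_overflow_cong:
  "(\<And>x. x \<in> exp_regs e \<Longrightarrow> r x = r' x) \<Longrightarrow> no_overflow w r e = no_overflow w r' e"
proof (induction e)
  case (Bin f a b)
  then have "no_overflow w r a = no_overflow w r' a" "no_overflow w r b = no_overflow w r' b"
    "pval r a = pval r' a" "pval r b = pval r' b"
    by (auto intro!: pval_cong)
  then show ?case by simp
qed simp_all

section \<open>The program\<close>

abbreviation Seq_syntax (infixr ";;" 60) where "c1 ;; c2 \<equiv> Seq c1 c2"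
abbreviation Assign_syntax ("_ ::= _" [70, 65] 65) where "x ::= a \<equiv> Assign x a"
abbreviation Add_syntax (infixl "+\<^sub>e" 75) where "a +\<^sub>e b \<equiv> Bin Add a b"
abbreviation Mul_syntax (infixl "*\<^sub>e" 80) where "a *\<^sub>e b \<equiv> Bin Mul a b"
abbreviation Div_syntax (infixl "div\<^sub>e" 80) where "a div\<^sub>e b \<equiv> Bin Div a b"
abbreviation Mod_syntax (infixl "mod\<^sub>e" 80) where "a mod\<^sub>e b \<equiv> Bin Mod a b"

abbreviation (input) "rans \<equiv> 0 :: nat"
abbreviation (input) "rd \<equiv> 1 :: nat"
abbreviation (input) "rnA \<equiv> 2 :: nat"
abbreviation (input) "rnn \<equiv> 3 :: nat"
abbreviation (input) "rn \<equiv> 4 :: nat"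
abbreviation (input) "rm \<equiv> 5 :: nat"
abbreviation (input) "rP \<equiv> 6 :: nat"
abbreviation (input) "rX \<equiv> 7 :: nat"
abbreviation (input) "rR \<equiv> 8 :: nat"
abbreviation (input) "rIT \<equiv> 9 :: nat"
abbreviation (input) "rb0 \<equiv> 10 :: nat"
abbreviation (input) "rb1 \<equiv> 11 :: nat"
abbreviation (input) "rb2 \<equiv> 12 :: nat"
abbreviation (input) "rb3 \<equiv> 13 :: nat"
abbreviation (input) "rit \<equiv> 14 :: nat"
abbreviation (input) "rrep \<equiv> 15 :: nat"
abbreviation (input) "rgg \<equiv> 16 :: nat"
abbreviation (input) "rY \<equiv> 17 :: nat"
abbreviation (input) "rfl \<equiv> 18 :: nat"
abbreviation (input) "rtot \<equiv> 19 :: nat"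
abbreviation (input) "ri \<equiv> 20 :: nat"
abbreviation (input) "rs \<equiv> 21 :: nat"
abbreviation (input) "rt \<equiv> 22 :: nat"
abbreviation (input) "rk \<equiv> 23 :: nat"
abbreviation (input) "rcnt \<equiv> 24 :: nat"
abbreviation (input) "rq \<equiv> 25 :: nat"
abbreviation (input) "rz \<equiv> 26 :: nat"
abbreviation (input) "rkb \<equiv> 27 :: nat"
abbreviation (input) "rpc \<equiv> 28 :: nat"
abbreviation (input) "rbad \<equiv> 29 :: nat"
abbreviation (input) "rv \<equiv> 30 :: nat"
abbreviation (input) "ru \<equiv> 31 :: nat"
abbreviation (input) "rS \<equiv> 32 :: nat"
abbreviation (input) "rc \<equiv> 33 :: nat"
abbreviation (input) "rNB \<equiv> 34 :: nat"
abbreviation (input) "rj \<equiv> 35 :: nat"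

text \<open>There is no branching: \<open>rbad\<close> adds up violations. The nested comparison is
  1 exactly when the coin is 0 and the position is among the first \<open>rt\<close>. The product is
  1 exactly when the input set has the element and the bit of the word equals \<open>rfl\<close>,
  that is, when the word misses an element of a member of the first family or hits one of the
  second.\<close>

definition bit_step :: com where
  "bit_step =
    Load rz (Reg rb0 +\<^sub>e (((Reg rrep *\<^sub>e Const 8 +\<^sub>e Reg ri) *\<^sub>e Reg rP +\<^sub>e Reg rk) *\<^sub>e Reg rn +\<^sub>e Reg rq)) ;;
    rkb ::= Bin Shr (Reg rk) (Reg rq) mod\<^sub>e Const 2 ;;
    rpc ::= Reg rpc +\<^sub>e Reg rkb ;;
    rbad ::= Reg rbad +\<^sub>e (Bin Less (Reg rz) (Bin Less (Reg rq) (Reg rt)) +\<^sub>e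
      (Bin Shr (Reg rY) (Reg ri *\<^sub>e Reg rn +\<^sub>e Reg rq) mod\<^sub>e Const 2) *\<^sub>e Bin Equal (Reg rkb) (Reg rfl))"

definition cand_step :: com where
  "cand_step =
    rpc ::= Const 0 ;;
    rbad ::= Const 0 ;;
    For rq (Reg rn) bit_step ;;
    Cond (Bin Equal (Reg rbad) (Const 0) *\<^sub>e Bin Equal (Reg rpc) (Reg rs))
      (Store (Reg rb1 +\<^sub>e (Reg ri *\<^sub>e Reg rP +\<^sub>e Reg rcnt)) (Reg rk) ;;
       rcnt ::= Reg rcnt +\<^sub>e Const 1)
      Skip"

text \<open>Each block consumes two digits of the guess from its low end: the weight
  \<open>rs\<close> and the number \<open>rt\<close> of coins that must be set.\<close>

definition block_step :: com where
  "block_step =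
    rs ::= Reg rgg mod\<^sub>e (Reg rn +\<^sub>e Const 1) ;;
    rgg ::= Reg rgg div\<^sub>e (Reg rn +\<^sub>e Const 1) ;;
    rt ::= Reg rgg mod\<^sub>e (Reg rn +\<^sub>e Const 1) ;;
    rgg ::= Reg rgg div\<^sub>e (Reg rn +\<^sub>e Const 1) ;;
    rcnt ::= Const 0 ;;
    For rk (Reg rP) cand_step ;;
    Store (Reg rb2 +\<^sub>e Reg ri) (Reg rcnt) ;;
    rtot ::= Reg rtot *\<^sub>e Reg rcnt"

text \<open>\<open>ru\<close> is an index in mixed radix. Quotient and remainder by the list length
  pick the next word, so that all tuples are enumerated by a single counter.\<close>

definition decode_step :: com where
  "decode_step =
    Load rc (Reg rb2 +\<^sub>e Reg ri) ;;
    Load rz (Reg rb1 +\<^sub>e (Reg ri *\<^sub>e Reg rP +\<^sub>e Reg ru mod\<^sub>e Reg rc)) ;;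
    rS ::= Reg rS +\<^sub>e Bin Shl (Reg rz) (Reg ri *\<^sub>e Reg rn) ;;
    ru ::= Reg ru div\<^sub>e Reg rc"

definition enum_step :: com where
  "enum_step =
    ru ::= Reg rv ;;
    rS ::= Const 0 ;;
    For ri (Const 8) decode_step ;;
    Cond (Reg rfl)
      (Load rz (Reg rb3 +\<^sub>e Reg rS) ;;
       rans ::= Bin Less (Const 0) (Reg rans +\<^sub>e Reg rz))
      (Store (Reg rb3 +\<^sub>e Reg rS) (Const 1))"

text \<open>One counter runs over the triples of guess, repetition and input set. The set is the
  lowest digit: for each guess and repetition, all members of the first family are marked before any
  member of the second one is looked up. Comparing a truth value with 0 is negation.\<close>

definition main_step :: com where
  "main_step =
    rj ::= Reg rit mod\<^sub>e Reg rnn ;;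
    rrep ::= (Reg rit div\<^sub>e Reg rnn) mod\<^sub>e Reg rR ;;
    rgg ::= Reg rit div\<^sub>e (Reg rnn *\<^sub>e Reg rR) ;;
    Load rY (Const 3 +\<^sub>e Reg rj) ;;
    rfl ::= Bin Equal (Bin Less (Reg rj) (Reg rnA)) (Const 0) ;;
    rtot ::= Const 1 ;;
    For ri (Const 8) block_step ;;
    Cond (Bin Equal (Bin Less (Reg rX) (Reg rtot)) (Const 0))
      (For rv (Reg rtot) enum_step)
      Skip"

text \<open>
  \<open>selected n V Y fl s t i k\<close>: the word k of weight s belongs to the random family of block i, in
  which a word survives with probability \<open>2 ^ - t\<close>, and it contains block i of the input word Y
  (fl false, a member of the first family) or avoids it (fl true, a member of the second one).
\<close>

definition selected :: "nat \<Rightarrow> (nat \<Rightarrow> bool) \<Rightarrow> nat \<Rightarrow> bool \<Rightarrow> nat \<Rightarrow> nat \<Rightarrow> nat \<Rightarrow> nat \<Rightarrow> bool" where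
  "selected n V Y fl s t i k \<longleftrightarrow> card {q. q < n \<and> bit k q} = s \<and>
     (\<forall>q<n. (q < t \<longrightarrow> V ((i * 2 ^ n + k) * n + q)) \<and> \<not> (bit Y (i * n + q) \<and> bit k q = fl))"

definition digit :: "nat \<Rightarrow> nat \<Rightarrow> nat \<Rightarrow> nat" where
  "digit b g e = g div b ^ e mod b"

text \<open>The digits of g in base \<open>n + 1\<close> are the guesses of s and t for the blocks in turn.\<close>

definition cand :: "nat \<Rightarrow> (nat \<Rightarrow> bool) \<Rightarrow> nat \<Rightarrow> bool \<Rightarrow> nat \<Rightarrow> nat \<Rightarrow> nat list" where
  "cand n V Y fl g i =
     filter (selected n V Y fl (digit (n + 1) g (2 * i)) (digit (n + 1) g (2 * i + 1)) i) [0..<2 ^ n]"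

section \<open>Correctness and running time of the loops\<close>

lemma card_less_Suc_Collect:
  "card {q. q < Suc n \<and> Q q} = card {q. q < n \<and> Q q} + of_bool (Q n)"
proof -
  have "{q. q < Suc n \<and> Q q} = (if Q n then insert n {q. q < n \<and> Q q} else {q. q < n \<and> Q q})"
    by (auto simp: less_Suc_eq)
  then show ?thesis by simp
qed

lemma drop_bit_mod_2_nat: "drop_bit q x mod 2 = (of_bool (bit x q) :: nat)"
  by (simp add: bit_iff_odd_drop_bit mod_2_eq_odd)

text \<open>\<open>inp\<close> are the packed sets and \<open>W\<close> the stored coins. The cells
  hold, in this order, three header words, the input, the coins, one row of \<open>P\<close> cells
  per block for its list of words, the eight list lengths, and the table. By \<open>Mw\<close> all
  addresses fit into a word.\<close>

locale layout =
  fixes w M n P nA nn X R NB b0 b1 b2 b3 :: nat and inp :: "nat \<Rightarrow> nat" and W :: "nat \<Rightarrow> bool"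
  assumes P: "P = 2 ^ n" and n: "n \<ge> 1" and NB: "NB = R * (8 * P * n)"
    and b0: "b0 = 3 + nn" and b1: "b1 = b0 + NB" and b2: "b2 = b1 + 8 * P" and b3: "b3 = b2 + 8"
    and M: "M = b3 + 2 ^ (8 * n)" and Mw: "M < 2 ^ w" and Xw: "X < 2 ^ w"
    and inp: "\<And>j. j < nn \<Longrightarrow> inp j < 2 ^ w"
    and nA: "nA \<le> nn"
begin

definition env :: "(nat \<Rightarrow> nat) \<Rightarrow> bool" where
  "env r \<longleftrightarrow> r rnA = nA \<and> r rnn = nn \<and> r rn = n \<and> r rP = P \<and> r rX = X \<and> r rR = R \<and>
     r rb0 = b0 \<and> r rb1 = b1 \<and> r rb2 = b2 \<and> r rb3 = b3"

definition fixed_mem :: "(nat \<Rightarrow> nat) \<Rightarrow> bool" where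
  "fixed_mem m \<longleftrightarrow> (\<forall>j<nn. m (3 + j) = inp j) \<and> (\<forall>x<NB. m (b0 + x) = of_bool (W x))"

lemma n_bound: "8 * n < 2 ^ (8 * n)" by simp

lemma M_bounds: "8 * n + 11 < M" "8 * P + 11 < M" "nn + 11 < M" "M < 2 ^ w" "11 < M" "R < M \<or> R = 0" "b3 < M"
proof -
  show "8 * n + 11 < M" using n_bound b0 b1 b2 b3 M by linarith
  have "P \<ge> 1" "(1::nat) \<le> 2 ^ (8 * n)" using P by simp_all
  then have PX: "8 * P + 11 + nn < M" using b0 b1 b2 b3 M by linarith
  then show "8 * P + 11 < M" "nn + 11 < M" "M < 2 ^ w" "11 < M" using Mw by linarith+
  have "R \<le> R * (8 * P * n)" using P n by simp
  then show "R < M \<or> R = 0" using NB b0 b1 b2 b3 M by linarith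
  show "b3 < M" using M by simp
qed

text \<open>The evaluation of the index must not overflow on the way: each partial result is at most
  the next one, and the last one is below \<open>NB\<close>.\<close>

lemma index_bounds:
  assumes "rep < R" "i < 8" "k < P" "q < n"
  shows "((rep * 8 + i) * P + k) * n + q < NB"
    "((rep * 8 + i) * P + k) * n \<le> ((rep * 8 + i) * P + k) * n + q"
    "(rep * 8 + i) * P + k \<le> ((rep * 8 + i) * P + k) * n"
    "(rep * 8 + i) * P \<le> (rep * 8 + i) * P + k"
    "rep * 8 + i \<le> (rep * 8 + i) * P"
proof -
  have "rep * 8 + i + 1 \<le> R * 8" using assms by linarith
  then have "(rep * 8 + i + 1) * P \<le> R * 8 * P" by (rule mult_right_mono) simp
  then have "(rep * 8 + i) * P + k + 1 \<le> R * 8 * P" using assms by simp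
  then have "((rep * 8 + i) * P + k + 1) * n \<le> R * 8 * P * n" by (rule mult_right_mono) simp
  then show "((rep * 8 + i) * P + k) * n + q < NB" using assms NB by (simp add: mult.assoc)
qed (use n P in auto)

text \<open>One \<open>bit_step\<close> costs 48 units and the loop overhead 8. A position causes at
  most two violations, and this bound on \<open>rbad\<close> excludes an overflow.\<close>

lemma bit_loop:
  assumes "env r" "fixed_mem m" and rep: "r rrep = rep" "rep < R" and i: "r ri = i" "i < 8"
    and k: "r rk = k" "k < P" and z: "r rpc = 0" "r rbad = 0" and fl: "r rfl = of_bool fl"
    and Y: "r rY = Y" "Y < 2 ^ w" and t: "r rt = t" "t < 2 ^ w"
    and Q: "\<And>r'. \<lbrakk>\<forall>x. x \<notin> {rq, rz, rkb, rpc, rbad} \<longrightarrow> r' x = r x;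
        r' rpc = card {q. q < n \<and> bit k q}; r' rbad \<le> 2 * n;
        r' rbad = 0 \<longleftrightarrow> (\<forall>q<n. (q < t \<longrightarrow> W (((rep * 8 + i) * P + k) * n + q)) \<and>
          \<not> (bit Y (i * n + q) \<and> bit k q = fl))\<rbrakk> \<Longrightarrow> Q (r', m, cs)"
  shows "runs w M (For rq (Reg rn) bit_step) (r, m, cs) (56 * n + 6) Q"
proof -
  define ok where "ok = (\<lambda>q. (q < t \<longrightarrow> W (((rep * 8 + i) * P + k) * n + q)) \<and>
          \<not> (bit Y (i * n + q) \<and> bit k q = fl))"
  note env = \<open>env r\<close>[unfolded env_def]
  note MB = M_bounds
  show ?thesis
  proof (rule runs_For[where N = n and T = 48 and Inv = "\<lambda>q r' m' cs'. m' = m \<and> cs' = cs \<and>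
      r' rpc = card {q'. q' < q \<and> bit k q'} \<and> r' rbad \<le> 2 * q \<and> (r' rbad = 0 \<longleftrightarrow> (\<forall>q'<q. ok q'))"])
    show "n < 2 ^ w" using MB by linarith
    show "aval w r (Reg rn) = n" using env by simp
    show "exp_regs (Reg rn) \<inter> insert rq (mod_regs bit_step) = {}" "rq \<notin> mod_regs bit_step"
      by (auto simp: bit_step_def)
    fix q r' m' cs'
    assume q: "q < n" "r' rq = q" and inv: "m' = m \<and> cs' = cs \<and>
        r' rpc = card {q'. q' < q \<and> bit k q'} \<and> r' rbad \<le> 2 * q \<and> (r' rbad = 0 \<longleftrightarrow> (\<forall>q'<q. ok q'))"
      and fr: "\<forall>y. y \<notin> insert rq (mod_regs bit_step) \<longrightarrow> r' y = r y"
    have r': "r' rb0 = b0" "r' rrep = rep" "r' ri = i" "r' rP = P" "r' rk = k" "r' rn = n"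
       "r' rY = Y" "r' rt = t" "r' rfl = of_bool fl"
      using fr env rep i k Y t fl by (auto simp: bit_step_def)
    define a where "a = ((rep * 8 + i) * P + k) * n + q"
    note ib = index_bounds[OF rep(2) i(2) k(2) q(1)]
    have aNB: "a < NB" using ib(1) a_def by simp
    have ma: "m (b0 + a) = of_bool (W a)" using assms(2) aNB by (simp add: fixed_mem_def)
    have okq: "ok q \<longleftrightarrow> (q < t \<longrightarrow> W a) \<and> \<not> (bit Y (i * n + q) \<and> bit k q = fl)"
      by (simp add: ok_def a_def)
    have "b0 + a < M" using aNB b1 b2 b3 M by linarith
    then have bb: "b0 + a < 2 ^ w" "a < 2 ^ w" "((rep * 8 + i) * P + k) * n < 2 ^ w"
      "(rep * 8 + i) * P + k < 2 ^ w" "(rep * 8 + i) * P < 2 ^ w" "rep * 8 + i < 2 ^ w" "rep * 8 < 2 ^ w"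
      "rep < 2 ^ w" "b0 < 2 ^ w"
      using ib a_def Mw by linarith+
    have "card {q'. q' < q \<and> bit k q'} \<le> card {..<q}" by (rule card_mono) auto
    then have cq: "card {q'. q' < q \<and> bit k q'} \<le> q" by simp
    have iq: "i * n + q < 8 * n"
    proof -
      have "(i + 1) * n \<le> 8 * n" using i by (intro mult_right_mono) auto
      moreover have "(i + 1) * n = i * n + n" by simp
      ultimately show ?thesis using q(1) by linarith
    qed
    have bq: "i * n + q < 2 ^ w" "i * n < 2 ^ w" "k < 2 ^ w" "q < 2 ^ w" "P < 2 ^ w" "n < 2 ^ w"
        "i < 2 ^ w" "8 < (2::nat) ^ w" "2 < (2::nat) ^ w" "1 < (2::nat) ^ w" "0 < (2::nat) ^ w"
      using iq q k i MB by linarith+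
    show "runs w M bit_step (r', m', cs') 48 (\<lambda>(r'', m'', cs''). m'' = m \<and> cs'' = cs \<and>
       (r''(rq := Suc q)) rpc = card {q'. q' < Suc q \<and> bit k q'} \<and> (r''(rq := Suc q)) rbad \<le> 2 * Suc q \<and>
       ((r''(rq := Suc q)) rbad = 0 \<longleftrightarrow> (\<forall>q'<Suc q. ok q')))"
      unfolding bit_step_def
      apply (rule runs_le)
      apply (rule runs_Seq_Load')
      subgoal using bb bq r' q by (simp add: a_def)
      subgoal using r' q \<open>b0 + a < M\<close> by (simp add: a_def)
      apply (rule runs_Seq_Assign')
      subgoal using bb bq r' q by simp
      apply (rule runs_Seq_Assign')
      subgoal using bb bq r' q inv cq MB by (auto simp: drop_bit_mod_2_nat)
      apply (rule runs_Assign')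
      subgoal using bb bq r' q inv MB ma Y t by (auto simp: drop_bit_mod_2_nat a_def[symmetric])
      \<comment> \<open>The truth values are added as numbers in \<open>rbad\<close>, so all of them
        are split.\<close>
      subgoal using inv ma by (cases "W a"; cases "q < t"; cases fl; cases "bit k q"; cases "bit Y (i * n + q)"; simp add: r' q(2) drop_bit_mod_2_nat a_def[symmetric] card_less_Suc_Collect All_less_Suc okq)
      by simp
  next
    fix r' m' cs'
    assume "m' = m \<and> cs' = cs \<and>
        r' rpc = card {q'. q' < n \<and> bit k q'} \<and> r' rbad \<le> 2 * n \<and> (r' rbad = 0 \<longleftrightarrow> (\<forall>q'<n. ok q'))"
      and "\<forall>y. y \<notin> insert rq (mod_regs bit_step) \<longrightarrow> r' y = r y"
    then show "Q (r', m', cs')" using Q[of r'] by (simp add: ok_def bit_step_def)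
  qed (use z in auto)
qed


lemma fixed_mem_cong: "fixed_mem m \<Longrightarrow> (\<And>a. a < b1 \<Longrightarrow> m' a = m a) \<Longrightarrow> fixed_mem m'"
  unfolding fixed_mem_def using b0 b1 by auto

text \<open>Every repetition owns a contiguous chunk of coins. Distinct repetitions are therefore
  independent, and inside a chunk the index no longer depends on \<open>rep\<close>.\<close>

definition rep_bits :: "nat \<Rightarrow> nat \<Rightarrow> bool" where
  "rep_bits rep x = W (rep * (8 * P * n) + x)"

text \<open>After \<open>k\<close> rounds the stored list is the filtered \<open>[0..<k]\<close>. It
  has at most \<open>k\<close> entries, so writing never leaves the row of \<open>P\<close> cells of
  block \<open>i\<close>.\<close>

lemma cand_loop:
  assumes "env r" "fixed_mem m" and rep: "r rrep = rep" "rep < R" and i: "r ri = i" "i < 8"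
    and cnt: "r rcnt = 0" and fl: "r rfl = of_bool fl" and Y: "r rY = Y" "Y < 2 ^ w"
    and s: "r rs = s" "s < 2 ^ w" and t: "r rt = t" "t < 2 ^ w"
  defines "l \<equiv> filter (selected n (rep_bits rep) Y fl s t i) [0..<P]"
  assumes Q: "\<And>r' m'. \<lbrakk>\<forall>x. x \<notin> mod_regs (For rk (Reg rP) cand_step) \<longrightarrow> r' x = r x;
        r' rcnt = length l; \<forall>x<length l. m' (b1 + i * P + x) = l ! x;
        \<forall>a. a \<notin> {b1 + i * P..<b1 + i * P + P} \<longrightarrow> m' a = m a\<rbrakk> \<Longrightarrow> Q (r', m', cs)"
  shows "runs w M (For rk (Reg rP) cand_step) (r, m, cs) (P * (56 * n + 39) + 6) Q"
proof -
  define sel where "sel = selected n (rep_bits rep) Y fl s t i"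
  note env = \<open>env r\<close>[unfolded env_def]
  note MB = M_bounds
  have iP: "i * P + P \<le> 8 * P"
  proof -
    have "(i + 1) * P \<le> 8 * P" using i by (intro mult_right_mono) auto
    then show ?thesis by simp
  qed
  show ?thesis
  proof (rule runs_For[where N = P and T = "56 * n + 31" and Inv = "\<lambda>k r' m' cs'. cs' = cs \<and>
      r' rcnt = length (filter sel [0..<k]) \<and>
      (\<forall>x<length (filter sel [0..<k]). m' (b1 + i * P + x) = filter sel [0..<k] ! x) \<and>
      (\<forall>a. a \<notin> {b1 + i * P..<b1 + i * P + P} \<longrightarrow> m' a = m a)"])
    show "P < 2 ^ w" using MB by linarith
    show "aval w r (Reg rP) = P" using env by simp
    show "exp_regs (Reg rP) \<inter> insert rk (mod_regs cand_step) = {}" "rk \<notin> mod_regs cand_step"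
      by (auto simp: cand_step_def bit_step_def)
    fix k r' m' cs'
    assume k: "k < P" "r' rk = k"
      and inv: "cs' = cs \<and> r' rcnt = length (filter sel [0..<k]) \<and>
      (\<forall>x<length (filter sel [0..<k]). m' (b1 + i * P + x) = filter sel [0..<k] ! x) \<and>
      (\<forall>a. a \<notin> {b1 + i * P..<b1 + i * P + P} \<longrightarrow> m' a = m a)"
      and fr: "\<forall>y. y \<notin> insert rk (mod_regs cand_step) \<longrightarrow> r' y = r y"
    let ?L = "filter sel [0..<k]"
    have inv_cs: "cs' = cs" and inv_cnt: "r' rcnt = length ?L"
      and inv_m: "\<And>x. x < length ?L \<Longrightarrow> m' (b1 + i * P + x) = ?L ! x"
      and inv_fr: "\<And>a. a \<notin> {b1 + i * P..<b1 + i * P + P} \<Longrightarrow> m' a = m a"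
      using inv by auto
    have r': "r' rb1 = b1" "r' rrep = rep" "r' ri = i" "r' rP = P" "r' rn = n"
       "r' rY = Y" "r' rt = t" "r' rs = s" "r' rfl = of_bool fl"
      using fr env rep i k Y t s fl by (auto simp: cand_step_def bit_step_def)
    have "env (r'(rpc := 0, rbad := 0))"
      using fr env by (simp add: env_def cand_step_def bit_step_def)
    moreover have "fixed_mem m'"
      by (rule fixed_mem_cong[OF \<open>fixed_mem m\<close>]) (auto intro: inv_fr)
    ultimately have BL: "runs w M (For rq (Reg rn) bit_step) (r'(rpc := 0, rbad := 0), m', cs) (56 * n + 6)
       (\<lambda>s'. \<exists>r''. s' = (r'', m', cs) \<and> (\<forall>x. x \<notin> {rq, rz, rkb, rpc, rbad} \<longrightarrow> r'' x = r' x) \<and>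
         (r'' rbad = 0 \<and> r'' rpc = s \<longleftrightarrow> sel k) \<and> r'' rpc \<le> n \<and> r'' rbad \<le> 2 * n)"
    proof (rule bit_loop[where rep = rep and i = i and k = k and fl = fl and Y = Y and t = t])
      fix r''
      assume *: "\<forall>x. x \<notin> {rq, rz, rkb, rpc, rbad} \<longrightarrow> r'' x = (r'(rpc := 0, rbad := 0)) x"
        "r'' rpc = card {q. q < n \<and> bit k q}" "r'' rbad \<le> 2 * n"
        "(r'' rbad = 0) = (\<forall>q<n. (q < t \<longrightarrow> W (((rep * 8 + i) * P + k) * n + q)) \<and>
          \<not> (bit Y (i * n + q) \<and> bit k q = fl))"
      have "card {q. q < n \<and> bit k q} \<le> card {..<n}" by (rule card_mono) auto
      then have "r'' rpc \<le> n" using *(2) by simp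
      have idx: "rep * (8 * P * n) + ((i * P + k) * n + q) = ((rep * 8 + i) * P + k) * n + q" for q
        by (simp add: algebra_simps)
      have "r'' rbad = 0 \<and> r'' rpc = s \<longleftrightarrow> sel k"
        unfolding sel_def selected_def rep_bits_def P[symmetric] idx *(2) *(4) by (rule conj_commute)
      with \<open>r'' rpc \<le> n\<close> *(1,3) show "\<exists>ra. (r'', m', cs) = (ra, m', cs) \<and> (\<forall>x. x \<notin> {rq, rz, rkb, rpc, rbad} \<longrightarrow> ra x = r' x) \<and>
         (ra rbad = 0 \<and> ra rpc = s \<longleftrightarrow> sel k) \<and> ra rpc \<le> n \<and> ra rbad \<le> 2 * n"
        by (intro exI[of _ r''] conjI) simp_all
    qed (use r' rep i k Y t in auto)
    have lk: "length (filter sel [0..<k]) \<le> k"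
      using length_filter_le[of sel "[0..<k]"] by simp
    have addr: "b1 + (i * P + length (filter sel [0..<k])) < b2"
      using lk k iP b2 by linarith
    have b2M: "b2 < M" using b3 MB by linarith
    have bq: "P < 2 ^ w" "n < 2 ^ w" "k < 2 ^ w" "2 * n < 2 ^ w"
        "i < 2 ^ w" "1 < (2::nat) ^ w" "0 < (2::nat) ^ w"
      using k i MB by linarith+
    have bl: "length (filter sel [0..<k]) + 1 < 2 ^ w"
       "length (filter sel [0..<k]) < 2 ^ w"
       "b1 + (i * P + length (filter sel [0..<k])) < 2 ^ w"
       "i * P + length (filter sel [0..<k]) < 2 ^ w" "i * P < 2 ^ w" "b1 < 2 ^ w"
      using lk MB k addr b2M by linarith+
    show "runs w M cand_step (r', m', cs') (56 * n + 31)
        (\<lambda>(r'', m'', cs''). cs'' = cs \<and> (r''(rk := Suc k)) rcnt = length (filter sel [0..<Suc k]) \<and>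
      (\<forall>x<length (filter sel [0..<Suc k]). m'' (b1 + i * P + x) = filter sel [0..<Suc k] ! x) \<and>
      (\<forall>a. a \<notin> {b1 + i * P..<b1 + i * P + P} \<longrightarrow> m'' a = m a))"
      unfolding cand_step_def
      apply (rule runs_le)
       apply (rule runs_Seq_Assign')
      subgoal using bq by simp
       apply (rule runs_Seq_Assign')
      subgoal using bq by simp
       apply (unfold pval.simps)
       apply (rule runs_Seq'[where ?T1.0 = "56 * n + 6" and ?T2.0 = 21])
        apply (rule BL[folded inv_cs])
       apply (erule exE conjE)+
      subgoal for s' r''
        apply hypsubst
        apply (rule runs_Cond[where T = 13])
        subgoal using bq s(2) by (simp add: r' s(1))
        subgoal
          apply (rule runs_le)
           apply (rule runs_Seq_Store')
          subgoal using bl bq by (simp add: r' inv_cnt)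
          subgoal using bq by (simp add: k(2))
          subgoal using addr b2M by (simp add: r' inv_cnt)
           apply (rule runs_Assign')
          subgoal using bl bq by (simp add: r' inv_cnt)
          subgoal premises prems
          proof -
            have "sel k" using prems by (auto simp: r' split: if_splits)
            then have L: "filter sel [0..<Suc k] = ?L @ [k]" by simp
            have "length ?L < P" using lk k(1) by linarith
            then show ?thesis
              unfolding L using prems inv_cs inv_m inv_fr
              by (auto simp: r' k(2) inv_cnt nth_append less_Suc_eq add.assoc[symmetric])
          qed
          apply simp
          done
        subgoal premises prems
        proof -
          have "\<not> sel k" using prems by (auto simp: r' split: if_splits)
          then have L: "filter sel [0..<Suc k] = ?L" by simp
          show ?thesis
            unfolding L by (rule runs_Skip) (use prems inv_cs inv_m inv_fr in \<open>auto simp: inv_cnt\<close>)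
        qed
        apply simp
        done
      apply simp
      done
  next
    fix r' m' cs'
    assume "cs' = cs \<and> r' rcnt = length (filter sel [0..<P]) \<and>
      (\<forall>x<length (filter sel [0..<P]). m' (b1 + i * P + x) = filter sel [0..<P] ! x) \<and>
      (\<forall>a. a \<notin> {b1 + i * P..<b1 + i * P + P} \<longrightarrow> m' a = m a)"
      and "\<forall>y. y \<notin> insert rk (mod_regs cand_step) \<longrightarrow> r' y = r y"
    then show "Q (r', m', cs')" using Q[of r' m'] by (simp add: l_def sel_def)
  qed (use cnt in auto)
qed


lemma length_cand: "length (cand n V Y fl g i) \<le> P"
  unfolding cand_def using length_filter_le[of _ "[0..<2 ^ n]"] P by simp

text \<open>\<open>rtot\<close> is compared with \<open>X\<close> only after all eight factors have
  been multiplied, so the product must fit into a word even for a set that is going to be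
  skipped.\<close>

lemma prod_length_cand:
  assumes "i \<le> 8"
  shows "(\<Prod>i'<i. length (cand n V Y fl g i')) \<le> 2 ^ (8 * n)"
proof -
  have "(\<Prod>i'<i. length (cand n V Y fl g i')) \<le> (\<Prod>i'<i. P)"
    using length_cand by (intro prod_mono) auto
  also have "\<dots> = P ^ i" by simp
  also have "\<dots> \<le> P ^ 8" using assms P by (intro power_increasing) auto
  finally show ?thesis using P by (simp add: power_mult[symmetric] mult.commute)
qed

lemma block_loop:
  assumes "env r" "fixed_mem m" and rep: "r rrep = rep" "rep < R"
    and g: "r rgg = g" "g < 2 ^ w" and tot: "r rtot = 1"
    and fl: "r rfl = of_bool fl" and Y: "r rY = Y" "Y < 2 ^ w"
  defines "l \<equiv> cand n (rep_bits rep) Y fl g"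
  assumes Q: "\<And>r' m'. \<lbrakk>\<forall>x. x \<notin> mod_regs (For ri (Const 8) block_step) \<longrightarrow> r' x = r x;
        r' rtot = (\<Prod>i<8. length (l i));
        \<forall>i<8. m' (b2 + i) = length (l i) \<and> (\<forall>x<length (l i). m' (b1 + i * P + x) = l i ! x);
        \<forall>a. a \<notin> {b1..<b3} \<longrightarrow> m' a = m a\<rbrakk> \<Longrightarrow> Q (r', m', cs)"
  shows "runs w M (For ri (Const 8) block_step) (r, m, cs) (8 * (P * (56 * n + 39) + 49) + 6) Q"
proof -
  note env = \<open>env r\<close>[unfolded env_def]
  note MB = M_bounds
  show ?thesis
  proof (rule runs_For[where N = 8 and T = "P * (56 * n + 39) + 41" and Inv = "\<lambda>i r' m' cs'. cs' = cs \<and>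
      r' rgg = g div (n + 1) ^ (2 * i) \<and> r' rtot = (\<Prod>i'<i. length (l i')) \<and>
      (\<forall>i'<i. m' (b2 + i') = length (l i') \<and> (\<forall>x<length (l i'). m' (b1 + i' * P + x) = l i' ! x)) \<and>
      (\<forall>a. a \<notin> {b1..<b3} \<longrightarrow> m' a = m a)"])
    show "8 < (2::nat) ^ w" using MB by linarith
    then show "aval w r (Const 8) = 8" by simp
    show "exp_regs (Const 8) \<inter> insert ri (mod_regs block_step) = {}" "ri \<notin> mod_regs block_step"
      by (auto simp: block_step_def cand_step_def bit_step_def)
    fix i r' m' cs'
    assume i: "i < 8" "r' ri = i"
      and inv: "cs' = cs \<and>
      r' rgg = g div (n + 1) ^ (2 * i) \<and> r' rtot = (\<Prod>i'<i. length (l i')) \<and>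
      (\<forall>i'<i. m' (b2 + i') = length (l i') \<and> (\<forall>x<length (l i'). m' (b1 + i' * P + x) = l i' ! x)) \<and>
      (\<forall>a. a \<notin> {b1..<b3} \<longrightarrow> m' a = m a)"
      and fr: "\<forall>y. y \<notin> insert ri (mod_regs block_step) \<longrightarrow> r' y = r y"
    have inv_cs: "cs' = cs" and inv_g: "r' rgg = g div (n + 1) ^ (2 * i)"
      and inv_tot: "r' rtot = (\<Prod>i'<i. length (l i'))"
      and inv_m1: "\<And>i'. i' < i \<Longrightarrow> m' (b2 + i') = length (l i')"
      and inv_m2: "\<And>i' x. i' < i \<Longrightarrow> x < length (l i') \<Longrightarrow> m' (b1 + i' * P + x) = l i' ! x"
      and inv_fr: "\<And>a. a \<notin> {b1..<b3} \<Longrightarrow> m' a = m a"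
      using inv by auto
    have r': "r' rrep = rep" "r' rn = n" "r' rb2 = b2"
      using fr env rep by (auto simp: block_step_def cand_step_def bit_step_def)
    define s where "s = digit (n + 1) g (2 * i)"
    define t where "t = digit (n + 1) g (2 * i + 1)"
    have st: "s \<le> n" "t \<le> n" by (simp_all add: s_def t_def digit_def less_Suc_eq_le[symmetric])
    have gdiv: "g div (n + 1) ^ (2 * i) div (n + 1) = g div (n + 1) ^ (2 * i + 1)"
      "g div (n + 1) ^ (2 * i) div (n + 1) div (n + 1) = g div (n + 1) ^ (2 * i + 2)"
      by (simp_all add: div_mult2_eq[symmetric] mult.commute mult.assoc)
    define r1 where "r1 = r'(rs := s, rgg := g div (n + 1) ^ (2 * i + 2), rt := t, rcnt := 0)"
    \<comment> \<open>This form with iterated division is the one produced by symbolic execution;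
      the definition of \<open>r1\<close> uses the digits.\<close>
    have r1: "r1 = r'(rs := g div (n + 1) ^ (2 * i) mod (n + 1), rgg := g div (n + 1) ^ (2 * i) div (n + 1) div (n + 1),
        rt := g div (n + 1) ^ (2 * i) div (n + 1) mod (n + 1), rcnt := 0)"
      by (simp only: r1_def s_def t_def digit_def gdiv[symmetric])
    have l_i: "l i = filter (selected n (rep_bits rep) Y fl s t i) [0..<P]"
      by (simp add: l_def cand_def s_def t_def P)
    have CL: "runs w M (For rk (Reg rP) cand_step) (r1, m', cs) (P * (56 * n + 39) + 6)
      (\<lambda>s'. \<exists>r'' m''. s' = (r'', m'', cs) \<and>
        (\<forall>x. x \<notin> mod_regs (For rk (Reg rP) cand_step) \<longrightarrow> r'' x = r1 x) \<and>
        r'' rcnt = length (l i) \<and> (\<forall>x<length (l i). m'' (b1 + i * P + x) = l i ! x) \<and>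
        (\<forall>a. a \<notin> {b1 + i * P..<b1 + i * P + P} \<longrightarrow> m'' a = m' a))"
      unfolding l_i
    proof (rule cand_loop[where rep = rep and i = i and fl = fl and Y = Y and s = s and t = t])
      show "env r1"
        using fr env by (simp add: r1_def env_def block_step_def cand_step_def bit_step_def)
      show "fixed_mem m'" by (rule fixed_mem_cong[OF \<open>fixed_mem m\<close>]) (auto intro: inv_fr)
      show "s < 2 ^ w" "t < 2 ^ w" using st MB by linarith+
      show "r1 rfl = of_bool fl" "r1 rY = Y"
        using fr fl Y by (simp_all add: r1_def block_step_def cand_step_def bit_step_def)
    qed (use r' i Y rep in \<open>auto simp: r1_def\<close>)
    have iP: "i * P + P \<le> 8 * P"
    proof -
      have "(i + 1) * P \<le> 8 * P" using i by (intro mult_right_mono) auto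
      then show ?thesis by simp
    qed
    have li: "length (l i) \<le> P" unfolding l_def by (rule length_cand)
    have pr: "(\<Prod>i'<i. length (l i')) \<le> 2 ^ (8 * n)" "(\<Prod>i'<Suc i. length (l i')) \<le> 2 ^ (8 * n)"
      unfolding l_def by (rule prod_length_cand; use i in simp)+
    have Xw': "2 ^ (8 * n) < (2::nat) ^ w" using M MB by linarith
    have b2M: "b2 + i < M" using b3 i MB by linarith
    have bq: "P < 2 ^ w" "n < 2 ^ w" "n + 1 < 2 ^ w" "s < 2 ^ w" "t < 2 ^ w" "b2 + i < 2 ^ w" "b2 < 2 ^ w"
        "i < 2 ^ w" "1 < (2::nat) ^ w" "0 < (2::nat) ^ w" "length (l i) < 2 ^ w"
      using st i MB b2M li by linarith+
    have bp: "(\<Prod>i'<i. length (l i')) < 2 ^ w" "(\<Prod>i'<i. length (l i')) * length (l i) < 2 ^ w"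
      using le_less_trans[OF pr(1) Xw'] le_less_trans[OF pr(2) Xw'] by simp_all
    have bg: "g div (n + 1) ^ (2 * i) < 2 ^ w" "g div (n + 1) ^ (2 * i + 1) < 2 ^ w"
      using g(2) div_le_dividend le_less_trans by blast+
    show "runs w M block_step (r', m', cs') (P * (56 * n + 39) + 41)
      (\<lambda>(r'', m'', cs''). cs'' = cs \<and> (r''(ri := Suc i)) rgg = g div (n + 1) ^ (2 * Suc i) \<and>
      (r''(ri := Suc i)) rtot = (\<Prod>i'<Suc i. length (l i')) \<and>
      (\<forall>i'<Suc i. m'' (b2 + i') = length (l i') \<and> (\<forall>x<length (l i'). m'' (b1 + i' * P + x) = l i' ! x)) \<and>
      (\<forall>a. a \<notin> {b1..<b3} \<longrightarrow> m'' a = m a))"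
      unfolding block_step_def
      apply (rule runs_le)
       apply (rule runs_Seq_Assign')
      subgoal using bq bg by (simp add: r' inv_g)
       apply (rule runs_Seq_Assign')
      subgoal using bq bg by (simp add: r' inv_g)
       apply (rule runs_Seq_Assign')
      subgoal using bq bg(1) bg(2)[folded gdiv(1)] by (simp add: r' inv_g)
       apply (rule runs_Seq_Assign')
      subgoal using bq bg(1) bg(2)[folded gdiv(1)] by (simp add: r' inv_g)
       apply (rule runs_Seq_Assign')
      subgoal using bq bg by simp
       apply (rule runs_eq_state[where s = "(r1, m', cs')"])
        apply (rule runs_Seq'[where ?T1.0 = "P * (56 * n + 39) + 6" and ?T2.0 = 9])
         apply (rule CL[folded inv_cs])
       apply (erule exE conjE)+
      subgoal for s' r'' m''
        apply hypsubst
        apply (rule runs_le)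
         apply (rule runs_Seq_Store')
        subgoal using bq by (simp add: r1_def r' i(2) cand_step_def bit_step_def)
        subgoal using bq by simp
        subgoal using b2M by (simp add: r1_def r' i(2) cand_step_def bit_step_def)
         apply (rule runs_Assign')
        subgoal using bq bp by (simp add: r1_def inv_tot cand_step_def bit_step_def)
        subgoal premises prems
        proof -
          \<comment> \<open>\<open>x1\<close>, \<open>x2\<close> and \<open>x4\<close> say that
            filling row \<open>i\<close> spares the stored lengths, the earlier rows and the memory
            outside the scratch area; \<open>x3\<close> says that storing the new length spares the
            rows.\<close>
          have x1: "m'' (b2 + i') = length (l i')" if "i' < i" for i'
          proof -
            have "b2 + i' \<notin> {b1 + i * P..<b1 + i * P + P}"
              using iP b2 unfolding atLeastLessThan_iff by linarith
            then show ?thesis using prems(4) inv_m1[OF that] by simp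
          qed
          have x2: "m'' (b1 + i' * P + x) = l i' ! x" if "i' < i" "x < length (l i')" for i' x
          proof -
            have "length (l i') \<le> P" unfolding l_def by (rule length_cand)
            moreover have "(i' + 1) * P \<le> i * P" using that(1) by (intro mult_right_mono) auto
            moreover have "(i' + 1) * P = i' * P + P" by simp
            ultimately have "b1 + i' * P + x < b1 + i * P" using that(2) by linarith
            then have "b1 + i' * P + x \<notin> {b1 + i * P..<b1 + i * P + P}" by simp
            then show ?thesis using prems(4) inv_m2[OF that] by simp
          qed
          have x3: "b1 + i' * P + x \<noteq> b2 + i" if "i' < Suc i" "x < length (l i')" for i' x
          proof -
            have "length (l i') \<le> P" unfolding l_def by (rule length_cand)
            moreover have "(i' + 1) * P \<le> 8 * P" using that(1) i by (intro mult_right_mono) auto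
            moreover have "(i' + 1) * P = i' * P + P" by simp
            ultimately show ?thesis using that(2) b2 by linarith
          qed
          have x4: "m'' a = m a" if "a \<notin> {b1..<b3}" for a
          proof -
            have "a \<notin> {b1 + i * P..<b1 + i * P + P}"
              using that iP b2 b3 unfolding atLeastLessThan_iff by linarith
            then show ?thesis using prems(4) inv_fr[OF that] by simp
          qed
          have x5: "b2 + i \<in> {b1..<b3}" using i b2 b3 by auto
          have y: "r'' rtot = (\<Prod>i'<i. length (l i'))" "r'' rgg = g div (n + 1) ^ (2 * Suc i)"
              "r'' rb2 = b2" "r'' ri = i"
            using prems(1) by (auto simp: r1_def inv_tot cand_step_def bit_step_def r' i(2))
          show ?thesis
            using prems(2,3) x1 x2 x3 x4 x5 by (auto simp: y less_Suc_eq inv_cs)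
        qed
        apply simp
        done
      subgoal
        by (auto simp: fun_eq_iff r1 r' inv_g)
      apply simp
      done
  next
    fix r' m' cs'
    assume "cs' = cs \<and> r' rgg = g div (n + 1) ^ (2 * 8) \<and> r' rtot = (\<Prod>i'<8. length (l i')) \<and>
      (\<forall>i'<8. m' (b2 + i') = length (l i') \<and> (\<forall>x<length (l i'). m' (b1 + i' * P + x) = l i' ! x)) \<and>
      (\<forall>a. a \<notin> {b1..<b3} \<longrightarrow> m' a = m a)"
      and "\<forall>y. y \<notin> insert ri (mod_regs block_step) \<longrightarrow> r' y = r y"
    then show "Q (r', m', cs')" by (intro Q[of r' m', simplified l_def[symmetric]] | simp)+
  qed (use g tot in auto)
qed

end

text \<open>\<open>v\<close> is read in mixed radix with the list lengths as radices. Its digits are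
  positions in the lists, and the words found there are laid side by side, \<open>n\<close> bits
  each.\<close>

definition decode :: "nat \<Rightarrow> (nat \<Rightarrow> nat list) \<Rightarrow> nat \<Rightarrow> nat \<Rightarrow> nat" where
  "decode n l i v = (\<Sum>i'<i. l i' ! (v div (\<Prod>x<i'. length (l x)) mod length (l i')) * 2 ^ (i' * n))"

lemma concat_less:
  assumes "\<And>i'. i' < i \<Longrightarrow> \<kappa> i' < (2::nat) ^ n"
  shows "(\<Sum>i'<i. \<kappa> i' * 2 ^ (i' * n)) < 2 ^ (i * n)"
  using assms
proof (induction i)
  case (Suc i)
  then have "(\<Sum>i'<i. \<kappa> i' * 2 ^ (i' * n)) < 2 ^ (i * n)" "Suc (\<kappa> i) \<le> 2 ^ n"
    by (auto simp: Suc_leI)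
  then have "(\<Sum>i'<i. \<kappa> i' * 2 ^ (i' * n)) + \<kappa> i * 2 ^ (i * n) < Suc (\<kappa> i) * 2 ^ (i * n)" by simp
  also have "\<dots> \<le> 2 ^ n * 2 ^ (i * n)" by (rule mult_right_mono) (use \<open>Suc (\<kappa> i) \<le> 2 ^ n\<close> in auto)
  finally show ?case by (simp add: power_add)
qed simp

context layout
begin

definition lists_in :: "(nat \<Rightarrow> nat list) \<Rightarrow> (nat \<Rightarrow> nat) \<Rightarrow> bool" where
  "lists_in l m \<longleftrightarrow> (\<forall>i<8. m (b2 + i) = length (l i) \<and> (\<forall>x<length (l i). m (b1 + i * P + x) = l i ! x))"

lemma decode_loop:
  assumes "env r" "lists_in l m" and u: "r ru = v" "v < (\<Prod>i<8. length (l i))" and S: "r rS = 0"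
    and l: "\<And>i. length (l i) \<le> P" "\<And>i x. x \<in> set (l i) \<Longrightarrow> x < P" and v: "v < 2 ^ w"
    and Q: "\<And>r'. \<lbrakk>\<forall>x. x \<notin> mod_regs (For ri (Const 8) decode_step) \<longrightarrow> r' x = r x;
        r' rS = decode n l 8 v; r' rS < 2 ^ (8 * n)\<rbrakk> \<Longrightarrow> Q (r', m, cs)"
  shows "runs w M (For ri (Const 8) decode_step) (r, m, cs) 278 Q"
proof -
  note env = \<open>env r\<close>[unfolded env_def]
  note MB = M_bounds
  \<comment> \<open>As \<open>v\<close> is below the product, no factor is 0, and the program never
    divides by 0.\<close>
  have pos: "0 < length (l i)" if "i < 8" for i
  proof (rule ccontr)
    assume "\<not> 0 < length (l i)"
    then have "(\<Prod>i<8. length (l i)) = 0" using that by (intro prod_zero) auto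
    with u show False by simp
  qed
  define e where "e = (\<lambda>i. l i ! (v div (\<Prod>x<i. length (l x)) mod length (l i)))"
  have eP: "e i < 2 ^ n" if "i < 8" for i
    unfolding e_def using l(2)[of _ i] pos[OF that] P by auto
  have dec: "decode n l i v = (\<Sum>i'<i. e i' * 2 ^ (i' * n))" for i
    by (simp add: decode_def e_def)
  have dec_less: "decode n l i v < 2 ^ (i * n)" if "i \<le> 8" for i
    unfolding dec by (rule concat_less) (use that eP in auto)
  show ?thesis
  proof (rule runs_For[where N = 8 and T = 26 and Inv = "\<lambda>i r' m' cs'. m' = m \<and> cs' = cs \<and>
      r' ru = v div (\<Prod>x<i. length (l x)) \<and> r' rS = decode n l i v"])
    show "8 < (2::nat) ^ w" using MB by linarith
    then show "aval w r (Const 8) = 8" by simp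
    show "exp_regs (Const 8) \<inter> insert ri (mod_regs decode_step) = {}" "ri \<notin> mod_regs decode_step"
      by (auto simp: decode_step_def)
    fix i r' m' cs'
    assume i: "i < 8" "r' ri = i"
      and inv: "m' = m \<and> cs' = cs \<and> r' ru = v div (\<Prod>x<i. length (l x)) \<and> r' rS = decode n l i v"
      and fr: "\<forall>y. y \<notin> insert ri (mod_regs decode_step) \<longrightarrow> r' y = r y"
    have inv': "m' = m" "cs' = cs" "r' ru = v div (\<Prod>x<i. length (l x))" "r' rS = decode n l i v"
      using inv by auto
    have r': "r' rn = n" "r' rP = P" "r' rb2 = b2" "r' rb1 = b1"
      using fr env by (auto simp: decode_step_def)
    have m1: "m (b2 + i) = length (l i)" using assms(2) i by (simp add: lists_in_def)
    define x where "x = v div (\<Prod>x<i. length (l x)) mod length (l i)"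
    have x: "x < length (l i)" using pos[OF i(1)] by (simp add: x_def)
    have m2: "m (b1 + (i * P + x)) = e i"
      using assms(2) i x by (simp add: lists_in_def e_def x_def add.assoc)
    have iP: "i * P + P \<le> 8 * P"
    proof -
      have "(i + 1) * P \<le> 8 * P" using i by (intro mult_right_mono) auto
      then show ?thesis by simp
    qed
    have ad: "b1 + (i * P + x) < M" "b2 + i < M"
      using iP x l(1)[of i] i(1) b2 b3 MB by linarith+
    have iN: "i * n \<le> 8 * n" using i by (intro mult_right_mono) auto
    have lw: "length (l i) < 2 ^ w" "i * n < 2 ^ w" "n < 2 ^ w" "i < 2 ^ w"
      using l(1)[of i] MB i iN by linarith+
    have bq: "b1 + (i * P + x) < 2 ^ w" "i * P + x < 2 ^ w" "i * P < 2 ^ w" "b1 < 2 ^ w"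
       "b2 + i < 2 ^ w" "b2 < 2 ^ w" "P < 2 ^ w"
      using ad MB by linarith+
    have vd: "v div (\<Prod>x<i. length (l x)) < 2 ^ w" using v div_le_dividend le_less_trans by blast
    have D: "decode n l (Suc i) v = decode n l i v + e i * 2 ^ (i * n)"
      by (simp add: decode_def e_def)
    have "(2::nat) ^ (Suc i * n) \<le> 2 ^ (8 * n)"
      using i by (intro power_increasing mult_right_mono) auto
    then have D2: "decode n l i v + e i * 2 ^ (i * n) < 2 ^ w"
      using dec_less[of "Suc i"] i M MB D by linarith
    then have D3: "e i * 2 ^ (i * n) < 2 ^ w" "decode n l i v < 2 ^ w" by linarith+
    have "e i * 1 \<le> e i * 2 ^ (i * n)" by (rule mult_left_mono) auto
    then have D4: "e i < 2 ^ w" using D3 by linarith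
    show "runs w M decode_step (r', m', cs') 26 (\<lambda>(r'', m'', cs''). m'' = m \<and> cs'' = cs \<and>
      (r''(ri := Suc i)) ru = v div (\<Prod>x<Suc i. length (l x)) \<and> (r''(ri := Suc i)) rS = decode n l (Suc i) v)"
      unfolding decode_step_def
      apply (rule runs_le)
       apply (rule runs_Seq_Load')
      subgoal using bq lw by (simp add: r' i)
      subgoal using ad by (simp add: r' i)
       apply (rule runs_Seq_Load')
      subgoal using bq lw vd by (simp add: r' i(2) inv' m1 x_def[symmetric])
      subgoal using ad by (simp add: r' i(2) inv' m1 x_def[symmetric])
       apply (rule runs_Seq_Assign')
      subgoal using D2 D3 D4 lw by (simp add: r' i(2) inv' m1 x_def[symmetric] m2 push_bit_eq_mult)
       apply (rule runs_Assign')
      subgoal using lw vd by (simp add: r' i(2) inv' m1)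
      subgoal by (simp add: r' i(2) inv' m1 x_def[symmetric] m2 push_bit_eq_mult D div_mult2_eq)
      apply simp
      done
  next
    fix r' m' cs'
    assume "m' = m \<and> cs' = cs \<and> r' ru = v div (\<Prod>x<8. length (l x)) \<and> r' rS = decode n l 8 v"
      and "\<forall>y. y \<notin> insert ri (mod_regs decode_step) \<longrightarrow> r' y = r y"
    then show "Q (r', m', cs')" using Q[of r'] dec_less[of 8] by simp
  qed (use u S in \<open>auto simp: decode_def\<close>)
qed

definition table :: "nat set \<Rightarrow> (nat \<Rightarrow> nat) \<Rightarrow> bool" where
  "table A m \<longleftrightarrow> (\<forall>S<2 ^ (8 * n). m (b3 + S) = of_bool (S \<in> A))"

text \<open>For a member of the second family the table is only read, so the marks stay fixed during
  the loop; for a member of the first one the answer stays fixed. The time is bounded through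
  \<open>X\<close>, because a set with more choices never gets here.\<close>

lemma enum_loop:
  assumes "env r" "lists_in l m" "table A m" and tot: "r rtot = (\<Prod>i<8. length (l i))"
    and l: "\<And>i. length (l i) \<le> P" "\<And>i x. x \<in> set (l i) \<Longrightarrow> x < P" and tw: "(\<Prod>i<8. length (l i)) \<le> X"
    and fl: "r rfl = of_bool fl" and ans: "r rans = of_bool an"
    and Q: "\<And>r' m'. \<lbrakk>\<forall>x. x \<notin> mod_regs (For rv (Reg rtot) enum_step) \<longrightarrow> r' x = r x;
        r' rans = of_bool (an \<or> fl \<and> decode n l 8 ` {..<\<Prod>i<8. length (l i)} \<inter> A \<noteq> {});
        table (A \<union> (if fl then {} else decode n l 8 ` {..<\<Prod>i<8. length (l i)})) m';
        \<forall>a<b3. m' a = m a\<rbrakk> \<Longrightarrow> Q (r', m', cs)"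
  shows "runs w M (For rv (Reg rtot) enum_step) (r, m, cs) (X * 302 + 6) Q"
proof -
  note env = \<open>env r\<close>[unfolded env_def]
  note MB = M_bounds
  let ?D = "decode n l 8"
  let ?N = "\<Prod>i<8. length (l i)"
  show ?thesis
  proof (rule runs_For[where N = "?N" and T = 294 and Inv = "\<lambda>v r' m' cs'. cs' = cs \<and>
      r' rans = of_bool (an \<or> fl \<and> ?D ` {..<v} \<inter> A \<noteq> {}) \<and>
      table (A \<union> (if fl then {} else ?D ` {..<v})) m' \<and> (\<forall>a<b3. m' a = m a)"])
    show Nw: "?N < 2 ^ w" using tw Xw by linarith
    show "aval w r (Reg rtot) = ?N" using tot by simp
    show "exp_regs (Reg rtot) \<inter> insert rv (mod_regs enum_step) = {}" "rv \<notin> mod_regs enum_step"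
      by (auto simp: enum_step_def decode_step_def)
    fix v r' m' cs'
    assume v: "v < ?N" "r' rv = v"
      and inv: "cs' = cs \<and> r' rans = of_bool (an \<or> fl \<and> ?D ` {..<v} \<inter> A \<noteq> {}) \<and>
      table (A \<union> (if fl then {} else ?D ` {..<v})) m' \<and> (\<forall>a<b3. m' a = m a)"
      and fr: "\<forall>y. y \<notin> insert rv (mod_regs enum_step) \<longrightarrow> r' y = r y"
    have inv': "cs' = cs" "r' rans = of_bool (an \<or> fl \<and> ?D ` {..<v} \<inter> A \<noteq> {})"
      "table (A \<union> (if fl then {} else ?D ` {..<v})) m'" "\<And>a. a < b3 \<Longrightarrow> m' a = m a"
      using inv by auto
    have r': "r' rb3 = b3" "r' rfl = of_bool fl"
      using fr env fl by (auto simp: enum_step_def decode_step_def)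
    have vw: "v < 2 ^ w" using v Nw by linarith
    have w01: "1 < (2::nat) ^ w" "0 < (2::nat) ^ w" "2 < (2::nat) ^ w" using MB by linarith+
    have DL: "runs w M (For ri (Const 8) decode_step) (r'(ru := v, rS := 0), m', cs) 278
      (\<lambda>s'. \<exists>r''. s' = (r'', m', cs) \<and> r'' rS = ?D v \<and> r'' rS < 2 ^ (8 * n) \<and>
        (\<forall>x. x \<notin> mod_regs (For ri (Const 8) decode_step) \<longrightarrow> r'' x = (r'(ru := v, rS := 0)) x))"
    proof (rule decode_loop[where l = l and v = v])
      show "env (r'(ru := v, rS := 0))"
        using fr env by (simp add: env_def enum_step_def decode_step_def)
      show "lists_in l m'"
        unfolding lists_in_def
      proof (intro allI impI conjI)
        fix i assume i: "i < (8::nat)"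
        then have "b2 + i < b3" using b3 by simp
        then show "m' (b2 + i) = length (l i)" using inv'(4) assms(2) i by (simp add: lists_in_def)
        fix x assume x: "x < length (l i)"
        have "(i + 1) * P \<le> 8 * P" using i by (intro mult_right_mono) auto
        moreover have "(i + 1) * P = i * P + P" by simp
        ultimately have "b1 + i * P + x < b3" using x l(1)[of i] b2 b3 by linarith
        then show "m' (b1 + i * P + x) = l i ! x" using inv'(4) assms(2) i x by (simp add: lists_in_def)
      qed
    qed (use v l vw in auto)
    show "runs w M enum_step (r', m', cs') 294 (\<lambda>(r'', m'', cs''). cs'' = cs \<and>
      (r''(rv := Suc v)) rans = of_bool (an \<or> fl \<and> ?D ` {..<Suc v} \<inter> A \<noteq> {}) \<and>
      table (A \<union> (if fl then {} else ?D ` {..<Suc v})) m'' \<and> (\<forall>a<b3. m'' a = m a))"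
      unfolding enum_step_def
      apply (rule runs_le)
       apply (rule runs_Seq_Assign')
      subgoal using vw by (simp add: v(2))
       apply (rule runs_Seq_Assign')
      subgoal using w01 by simp
       apply (rule runs_eq_state[where s = "(r'(ru := v, rS := 0), m', cs')"])
        apply (rule runs_Seq'[where ?T1.0 = 278 and ?T2.0 = 12])
         apply (rule DL[folded inv'(1)])
       apply (erule exE conjE)+
      subgoal for s' r''
        apply hypsubst
        subgoal premises prems
        proof -
          have S: "b3 + ?D v < M" "b3 < 2 ^ w" "b3 + ?D v < 2 ^ w" "?D v < 2 ^ w"
            using prems(1,2) M MB by linarith+
          have R: "r'' rb3 = b3" "r'' rfl = of_bool fl" "r'' rS = ?D v"
             "r'' rans = of_bool (an \<or> fl \<and> ?D ` {..<v} \<inter> A \<noteq> {})"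
            using prems by (auto simp: decode_step_def r' inv'(2))
          show ?thesis
          proof (cases fl)
            case True
            then have mS: "m' (b3 + ?D v) = of_bool (?D v \<in> A)"
              using inv'(3) prems(1,2) by (simp add: table_def)
            show ?thesis
              apply (rule runs_Cond[where T = 10])
              subgoal using w01 True by (simp add: R)
              subgoal
                apply (rule runs_le)
                 apply (rule runs_Seq_Load')
                subgoal using S by (simp add: R)
                subgoal using S by (simp add: R)
                 apply (rule runs_Assign')
                subgoal using S w01 by (auto simp: R mS split: if_splits)
                subgoal using True inv'(1,3,4) by (auto simp: R mS lessThan_Suc)
                apply simp
                done
              subgoal using True by (simp add: R)
              apply simp
              done
          next
            case False
            show ?thesis
              apply (rule runs_Cond[where T = 10])
              subgoal using w01 False by (simp add: R)
              subgoal using False by (simp add: R)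
              subgoal
                apply (rule runs_le)
                 apply (rule runs_Store')
                subgoal using S by (simp add: R)
                subgoal using w01 by simp
                subgoal using S by (simp add: R)
                subgoal using False inv'(1,3,4) by (auto simp: R table_def lessThan_Suc)
                apply simp
                done
              apply simp
              done
          qed
        qed
        done
      subgoal by (simp add: v(2))
      apply simp
      done
  next
    fix r' m' cs'
    assume "cs' = cs \<and> r' rans = of_bool (an \<or> fl \<and> ?D ` {..<?N} \<inter> A \<noteq> {}) \<and>
      table (A \<union> (if fl then {} else ?D ` {..<?N})) m' \<and> (\<forall>a<b3. m' a = m a)"
      and "\<forall>y. y \<notin> insert rv (mod_regs enum_step) \<longrightarrow> r' y = r y"
    then have "cs' = cs" "Q (r', m', cs)" by (auto intro!: Q)
    then show "Q (r', m', cs')" by simp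
  next
    show "?N * (294 + 8) + 6 \<le> X * 302 + 6" using tw by simp
  qed (use assms(3) ans in auto)
qed

end

section \<open>Computing the parameters, tossing the coins and the whole program\<close>

definition mult_step :: "nat \<Rightarrow> aexp \<Rightarrow> com" where
  "mult_step x c = (x ::= Reg x *\<^sub>e c)"

text \<open>As \<open>a \<ge> 1\<close>, the powers increase, and the bound on the final product
  covers the intermediate ones.\<close>

lemma mult_loop:
  assumes x: "x \<noteq> y" "exp_regs c \<inter> {x, y} = {}" "acost c = 1" and c: "no_overflow w r c" "pval r c = a" "a \<ge> 1"
    and N: "N < 2 ^ w" "pval r e = N" "no_overflow w r e" "acost e = 1" "exp_regs e \<inter> {x, y} = {}"
    and b: "r x * a ^ N < 2 ^ w"
    and Q: "\<And>r'. \<lbrakk>\<forall>z. z \<notin> {x, y} \<longrightarrow> r' z = r z; r' x = r x * a ^ N\<rbrakk> \<Longrightarrow> Q (r', m, cs)"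
  shows "runs w M (For y e (mult_step x c)) (r, m, cs) (12 * N + 6) Q"
proof (rule runs_For[where N = N and T = 4 and
    Inv = "\<lambda>k r' m' cs'. m' = m \<and> cs' = cs \<and> r' x = r x * a ^ k"])
  show "aval w r e = N" using aval_no_overflow N by blast
  fix k r' m' cs'
  assume k: "k < N" and inv: "m' = m \<and> cs' = cs \<and> r' x = r x * a ^ k"
    and fr: "\<forall>z. z \<notin> insert y (mod_regs (mult_step x c)) \<longrightarrow> r' z = r z"
  have ks: "r x * a ^ Suc k \<le> r x * a ^ N"
    using k c(3) by (intro mult_left_mono power_increasing) auto
  have "r x * a ^ k \<le> r x * a ^ N"
    using k c(3) by (intro mult_left_mono power_increasing) auto
  moreover have "r x * a ^ Suc k = r x * a ^ k * a" by simp
  ultimately have bb: "r x * a ^ k < 2 ^ w" "r x * a ^ k * a < 2 ^ w" using ks b by linarith+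
  have "\<forall>z\<in>exp_regs c. r' z = r z" using fr x by (auto simp: mult_step_def)
  then have "pval r' c = pval r c \<and> no_overflow w r' c = no_overflow w r c"
    by (intro conjI pval_cong no_overflow_cong) auto
  then show "runs w M (mult_step x c) (r', m', cs') 4
     (\<lambda>(r'', m'', cs''). m'' = m \<and> cs'' = cs \<and> (r''(y := Suc k)) x = r x * a ^ Suc k)"
    unfolding mult_step_def
    by (intro runs_Assign) (use inv bb c x in auto)
qed (use assms in \<open>auto simp: mult_step_def\<close>)

definition coin_step :: com where
  "coin_step = Flip rz ;; Store (Reg rb0 +\<^sub>e Reg rit) (Reg rz)"

text \<open>All coins are tossed in advance and kept, because every input set has to be tested
  against the same random families. \<open>rX\<close> first holds 27^m; its quotient by 2^(4m),
  increased by 1, is an integer above (27/16)^m. The 16 factors multiplied into \<open>rIT\<close>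
  stand for the 16 digits of a guess, two per block.\<close>

definition prog :: com where
  "prog =
    Load rd (Const 0) ;;
    Load rnA (Const 1) ;;
    Load rnn (Const 2) ;;
    rnn ::= Reg rnA +\<^sub>e Reg rnn ;;
    rn ::= Reg rd div\<^sub>e Const 8 +\<^sub>e Const 1 ;;
    rm ::= Reg rd div\<^sub>e Const 4 ;;
    rP ::= Bin Shl (Const 1) (Reg rn) ;;
    rkb ::= Reg rn +\<^sub>e Const 2 ;;
    rR ::= Const 1 ;;
    For ri (Const 8) (mult_step rR (Reg rkb)) ;;
    rX ::= Const 1 ;;
    For ri (Reg rm) (mult_step rX (Const 27)) ;;
    rX ::= Const 128 *\<^sub>e Reg rR *\<^sub>e (Reg rX div\<^sub>e Bin Shl (Const 1) (Const 4 *\<^sub>e Reg rm) +\<^sub>e Const 1) ;;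
    rR ::= Const 4 *\<^sub>e Reg rR ;;
    rkb ::= Reg rn +\<^sub>e Const 1 ;;
    rIT ::= Reg rR *\<^sub>e Reg rnn ;;
    For ri (Const 16) (mult_step rIT (Reg rkb)) ;;
    rb0 ::= Const 3 +\<^sub>e Reg rnn ;;
    rNB ::= Reg rR *\<^sub>e (Const 8 *\<^sub>e Reg rP *\<^sub>e Reg rn) ;;
    rb1 ::= Reg rb0 +\<^sub>e Reg rNB ;;
    rb2 ::= Reg rb1 +\<^sub>e Const 8 *\<^sub>e Reg rP ;;
    rb3 ::= Reg rb2 +\<^sub>e Const 8 ;;
    For rit (Reg rNB) coin_step ;;
    For rit (Reg rIT) main_step"

context layout
begin

definition candidates :: "nat \<Rightarrow> nat \<Rightarrow> nat list" where
  "candidates it = cand n (rep_bits (it div nn mod R)) (inp (it mod nn)) (nA \<le> it mod nn) (it div (nn * R))"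

definition outs :: "nat \<Rightarrow> nat set" where
  "outs it = (if (\<Prod>i<8. length (candidates it i)) \<le> X
     then decode n (candidates it) 8 ` {..<\<Prod>i<8. length (candidates it i)} else {})"

text \<open>The table is never cleared, as a mark made for another guess is still a valid certificate.\<close>

definition marked :: "nat \<Rightarrow> nat set" where
  "marked it = \<Union> (outs ` {it'. it' < it \<and> it' mod nn < nA})"

definition found :: "nat \<Rightarrow> bool" where
  "found it \<longleftrightarrow> (\<exists>it'<it. nA \<le> it' mod nn \<and> outs it' \<inter> marked it' \<noteq> {})"

lemma set_cand_less: "x \<in> set (cand n V Y fl g i) \<Longrightarrow> x < P"
  by (simp add: cand_def P)

lemma marked_Suc: "marked (Suc it) = marked it \<union> (if nA \<le> it mod nn then {} else outs it)"
  by (auto simp: marked_def less_Suc_eq)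

lemma found_Suc: "found (Suc it) \<longleftrightarrow> found it \<or> nA \<le> it mod nn \<and> outs it \<inter> marked it \<noteq> {}"
  by (auto simp: found_def less_Suc_eq)

lemma main_step_runs:
  assumes "env r" "fixed_mem m" "table (marked it) m" and it: "r rit = it" "it < 2 ^ w"
    and nnR: "nn * R < 2 ^ w" "nn > 0" "R > 0"
    and ans: "r rans = of_bool (found it)"
    and Q: "\<And>r' m'. \<lbrakk>fixed_mem m'; table (marked (Suc it)) m'; r' rans = of_bool (found (Suc it))\<rbrakk>
      \<Longrightarrow> Q (r', m', cs)"
  shows "runs w M main_step (r, m, cs) (8 * (P * (56 * n + 39)) + 302 * X + 438) Q"
proof -
  define j where "j = it mod nn"
  define rep where "rep = it div nn mod R"
  define g where "g = it div (nn * R)"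
  define fl where "fl = (nA \<le> j)"
  have jn: "j < nn" and repR: "rep < R" using nnR by (simp_all add: j_def rep_def)
  have l: "candidates it = cand n (rep_bits rep) (inp j) fl g"
    by (auto simp: candidates_def j_def rep_def g_def fl_def)
  note env = \<open>env r\<close>[unfolded env_def]
  note MB = M_bounds
  have gw: "g < 2 ^ w" using it(2) unfolding g_def using div_le_dividend le_less_trans by blast
  have rw: "R < 2 ^ w" using MB by auto
  have bq: "j < 2 ^ w" "nn < 2 ^ w" "R < 2 ^ w" "nA < 2 ^ w" "it div nn < 2 ^ w" "3 + j < 2 ^ w" "3 + j < M"
     "3 < (2::nat) ^ w" "1 < (2::nat) ^ w" "0 < (2::nat) ^ w"
    using rw jn MB nA it div_le_dividend[of it nn] by linarith+
  have mY: "m (3 + j) = inp j" using assms(2) jn by (simp add: fixed_mem_def)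
  define r1 where "r1 = r(rj := j, rrep := rep, rgg := g, rY := inp j, rfl := of_bool fl, rtot := 1)"
  have flj: "of_bool fl = (of_bool (of_bool (j < nA) = (0::nat)) :: nat)" by (auto simp: fl_def)
  have BL: "runs w M (For ri (Const 8) block_step) (r1, m, cs) (8 * (P * (56 * n + 39) + 49) + 6)
    (\<lambda>s'. \<exists>r' m'. s' = (r', m', cs) \<and> (\<forall>x. x \<notin> mod_regs (For ri (Const 8) block_step) \<longrightarrow> r' x = r1 x) \<and>
        r' rtot = (\<Prod>i<8. length (candidates it i)) \<and> lists_in (candidates it) m' \<and>
        (\<forall>a. a \<notin> {b1..<b3} \<longrightarrow> m' a = m a))"
  proof (rule block_loop[where rep = rep and g = g and fl = fl and Y = "inp j"])
    show "env r1" using env by (simp add: env_def r1_def)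
    show "inp j < 2 ^ w" using inp jn by simp
  qed (use gw repR assms(2) in \<open>auto simp: r1_def l lists_in_def\<close>)
  show ?thesis
    unfolding main_step_def
    apply (rule runs_le)
     apply (rule runs_Seq_Assign')
    subgoal using bq it by (simp add: env)
     apply (rule runs_Seq_Assign')
    subgoal using bq it by (simp add: env)
     apply (rule runs_Seq_Assign')
    subgoal using bq it nnR by (simp add: env)
     apply (rule runs_Seq_Load')
    subgoal using bq it by (simp add: env j_def[symmetric])
    subgoal using bq it by (simp add: env j_def[symmetric])
     apply (rule runs_Seq_Assign')
    subgoal using bq it by (simp add: env j_def[symmetric])
     apply (rule runs_Seq_Assign')
    subgoal using bq by simp
     apply (rule runs_eq_state[where s = "(r1, m, cs)"])
      apply (rule runs_Seq'[where ?T1.0 = "8 * (P * (56 * n + 39) + 49) + 6" and ?T2.0 = "12 + 302 * X"])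
       apply (rule BL)
     apply (erule exE conjE)+
    subgoal for s' r' m'
      apply hypsubst
      subgoal premises prems
      proof -
        have fm: "fixed_mem m'" by (rule fixed_mem_cong[OF assms(2)]) (simp add: prems(4))
        have tb: "table (marked it) m'" using assms(3) by (simp add: table_def prems(4))
        have R: "r' rX = X" "r' rans = of_bool (found it)" "r' rfl = of_bool fl"
          and "env r'"
          using prems(1) env ans by (simp_all add: r1_def block_step_def cand_step_def bit_step_def env_def)
        have tw: "(\<Prod>i<8. length (candidates it i)) < 2 ^ w"
          unfolding l using prod_length_cand[of 8 "rep_bits rep" "inp j" fl g] M MB by linarith
        show ?thesis
          apply (rule runs_Cond[where T = "6 + 302 * X"])
          subgoal using tw bq Xw by (simp add: R prems(2))
          subgoal premises le
          proof -
            have le': "(\<Prod>i<8. length (candidates it i)) \<le> X" using le by (auto simp: R prems(2) split: if_splits)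
            have "runs w M (For rv (Reg rtot) enum_step) (r', m', cs) (X * 302 + 6) Q"
            proof (rule enum_loop[OF \<open>env r'\<close> prems(3) tb prems(2) _ _ le' R(3,2)])
              fix r'' m'' :: "nat \<Rightarrow> nat"
              assume *: "r'' rans = of_bool (found it \<or> fl \<and> decode n (candidates it) 8 `
                  {..<\<Prod>i<8. length (candidates it i)} \<inter> marked it \<noteq> {})"
                "table (marked it \<union> (if fl then {} else decode n (candidates it) 8 `
                  {..<\<Prod>i<8. length (candidates it i)})) m''" "\<forall>a<b3. m'' a = m' a"
              show "Q (r'', m'', cs)"
              proof (rule Q)
                show "fixed_mem m''"
                proof (rule fixed_mem_cong[OF fm])
                  show "m'' a = m' a" if "a < b1" for a
                    using that *(3) b2 b3 by simp
                qed
              qed (use * le' in \<open>auto simp: marked_Suc found_Suc outs_def fl_def j_def\<close>)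
            qed (simp_all add: l length_cand set_cand_less)
            then show ?thesis by (rule runs_le) simp
          qed
          subgoal premises gt
          proof (rule runs_Skip)
            \<comment> \<open>A skipped set has no outputs, so marks and answer obey the same
              recursion as for a set that is listed.\<close>
            have "outs it = {}" using gt by (auto simp: outs_def R prems(2) split: if_splits)
            then show "Q (r', m', cs)"
              by (intro Q fm) (use tb R in \<open>simp_all add: marked_Suc found_Suc\<close>)
          qed simp
          apply simp
          done
      qed
      done
    subgoal by (auto simp: fun_eq_iff r1_def it env j_def rep_def g_def flj mY[unfolded j_def])
    apply simp
    done
qed

end

text \<open>One repetition with the right guess succeeds with probability at least y = 1 / (2 (n +
  2)^8), and \<open>R\<close> is chosen such that R y = 2. In \<open>X\<close>, 128 is 4 times 32:
  the factor 32 exceeds the constant 26 of \<open>expected_bound\<close>, and 4 (n + 2)^8 pushes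
  each of the two Markov tails below a quarter of (n + 2)^-8.\<close>

locale instance_layout = layout +
  fixes d m IT :: nat
  assumes nd: "n = d div 8 + 1" and md: "m = d div 4"
    and R: "R = 4 * (n + 2) ^ 8" and X: "X = 128 * (n + 2) ^ 8 * (27 ^ m div 2 ^ (4 * m) + 1)"
    and IT: "IT = R * nn * (n + 1) ^ 16"
    and dw: "d < 2 ^ w" and mw: "27 ^ m < (2::nat) ^ w" and ITw: "IT < 2 ^ w"
    and big: "128 < (2::nat) ^ w"
begin

lemma coin_loop:
  assumes "length cs = NB" and W: "\<And>x. x < NB \<Longrightarrow> W x = cs ! x"
    and r: "r rb0 = b0" "r rNB = NB"
    and Q: "\<And>r' m'. \<lbrakk>\<forall>x. x \<notin> mod_regs (For rit (Reg rNB) coin_step) \<longrightarrow> r' x = r x;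
        \<forall>x<NB. m' (b0 + x) = of_bool (W x); \<forall>a. a \<notin> {b0..<b1} \<longrightarrow> m' a = mm a\<rbrakk> \<Longrightarrow> Q (r', m', [])"
  shows "runs w M (For rit (Reg rNB) coin_step) (r, mm, cs) (NB * 14 + 6) Q"
proof -
  have bM: "b0 + NB < M" using b1 b2 b3 M by simp
  show ?thesis
  proof (rule runs_For[where N = NB and T = 6 and Inv = "\<lambda>x r' m' cs'. cs' = drop x cs \<and>
      (\<forall>y<x. m' (b0 + y) = of_bool (W y)) \<and> (\<forall>a. a \<notin> {b0..<b1} \<longrightarrow> m' a = mm a)"])
    show "NB < 2 ^ w" using bM Mw by linarith
    show "aval w r (Reg rNB) = NB" using r by simp
    show "exp_regs (Reg rNB) \<inter> insert rit (mod_regs coin_step) = {}" "rit \<notin> mod_regs coin_step"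
      by (auto simp: coin_step_def)
    fix x r' m' cs'
    assume x: "x < NB" "r' rit = x"
      and inv: "cs' = drop x cs \<and> (\<forall>y<x. m' (b0 + y) = of_bool (W y)) \<and> (\<forall>a. a \<notin> {b0..<b1} \<longrightarrow> m' a = mm a)"
      and fr: "\<forall>y. y \<notin> insert rit (mod_regs coin_step) \<longrightarrow> r' y = r y"
    have cs': "cs' = cs ! x # drop (Suc x) cs"
      using inv x(1) assms(1) by (simp add: Cons_nth_drop_Suc)
    have r': "r' rb0 = b0" using fr r by (simp add: coin_step_def)
    have bq: "b0 + x < 2 ^ w" "b0 < 2 ^ w" "x < 2 ^ w" "1 < (2::nat) ^ w" "0 < (2::nat) ^ w"
      using x(1) bM M_bounds by linarith+
    have "w \<ge> 1" using bq(4) by (cases w) auto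
    show "runs w M coin_step (r', m', cs') 6 (\<lambda>(r'', m'', cs''). cs'' = drop (Suc x) cs \<and>
      (\<forall>y<Suc x. m'' (b0 + y) = of_bool (W y)) \<and> (\<forall>a. a \<notin> {b0..<b1} \<longrightarrow> m'' a = mm a))"
      unfolding coin_step_def cs'
      apply (rule runs_Seq[where ?T1.0 = 1 and ?T2.0 = 5 and
          ?Q1.0 = "\<lambda>s. s = (r'(rz := of_bool (cs ! x)), m', drop (Suc x) cs)"])
        apply (rule runs_Flip[OF \<open>w \<ge> 1\<close> order_refl refl])
       apply hypsubst
       apply (rule runs_Store)
           subgoal using bq by (simp add: r' x)
          subgoal using bq by simp
         subgoal by simp
        subgoal using bM x by (simp add: r')
       subgoal using inv x b1 by (auto simp: r' W less_Suc_eq)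
      apply simp
      done
  next
    fix r' m' cs'
    assume "cs' = drop NB cs \<and> (\<forall>y<NB. m' (b0 + y) = of_bool (W y)) \<and> (\<forall>a. a \<notin> {b0..<b1} \<longrightarrow> m' a = mm a)"
      and "\<forall>y. y \<notin> insert rit (mod_regs coin_step) \<longrightarrow> r' y = r y"
    then show "Q (r', m', cs')" using Q[of r' m'] assms(1) by simp
  qed auto
qed

lemma main_loop:
  assumes "env r" "fixed_mem mm" "\<forall>a\<ge>b3. mm a = 0" "r rans = 0" "r rIT = IT"
    and Q: "\<And>r' m' cs'. r' rans = of_bool (found IT) \<Longrightarrow> Q (r', m', cs')"
  shows "runs w M (For rit (Reg rIT) main_step) (r, mm, cs)
    (IT * (8 * (P * (56 * n + 39)) + 302 * X + 446) + 6) Q"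
proof -
  have R0: "R > 0" using R by simp
  show ?thesis
  proof (rule runs_For[where N = IT and T = "8 * (P * (56 * n + 39)) + 302 * X + 438" and
      Inv = "\<lambda>it r' m' cs'. fixed_mem m' \<and> table (marked it) m' \<and> r' rans = of_bool (found it)"])
    show "aval w r (Reg rIT) = IT" using assms by simp
    show "exp_regs (Reg rIT) \<inter> insert rit (mod_regs main_step) = {}" "rit \<notin> mod_regs main_step"
      by (auto simp: main_step_def block_step_def cand_step_def bit_step_def enum_step_def decode_step_def)
    show "fixed_mem mm \<and> table (marked 0) mm \<and> (r(rit := 0)) rans = of_bool (found 0)"
      using assms by (simp add: table_def marked_def found_def)
    fix it r' m' cs'
    assume it: "it < IT" "r' rit = it"
      and inv: "fixed_mem m' \<and> table (marked it) m' \<and> r' rans = of_bool (found it)"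
      and fr: "\<forall>y. y \<notin> insert rit (mod_regs main_step) \<longrightarrow> r' y = r y"
    have "nn > 0" using it IT by (cases nn) auto
    have "nn * R \<le> nn * R * (n + 1) ^ 16" by simp
    also have "\<dots> = IT" using IT by (simp add: ac_simps)
    finally have "nn * R < 2 ^ w" using ITw by linarith
    have "env r'"
      using fr assms(1)
      by (simp add: env_def main_step_def block_step_def cand_step_def bit_step_def enum_step_def decode_step_def)
    then show "runs w M main_step (r', m', cs') (8 * (P * (56 * n + 39)) + 302 * X + 438)
      (\<lambda>(r'', m'', cs''). fixed_mem m'' \<and> table (marked (Suc it)) m'' \<and>
         (r''(rit := Suc it)) rans = of_bool (found (Suc it)))"
      by (rule main_step_runs)
        (use inv it ITw \<open>nn > 0\<close> \<open>nn * R < 2 ^ w\<close> R0 in auto)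
  qed (use ITw Q in auto)
qed

text \<open>The states \<open>r1\<close>, \<open>r3\<close>, \<open>r5\<close> and \<open>r7\<close>
  cut the straight-line code before the first four loops. At each cut the remaining time is rounded
  up to a convenient number. The facts collected first exclude overflow of the intermediate values,
  in particular of those that lead to \<open>X\<close> and \<open>IT\<close>.\<close>

lemma prog_runs:
  assumes mem: "mm 0 = d" "mm 1 = nA" "mm 2 = nn - nA" "\<And>j. j < nn \<Longrightarrow> mm (3 + j) = inp j"
      "\<And>a. a \<ge> b0 \<Longrightarrow> mm a = 0"
    and cs: "length cs = NB" "\<And>x. x < NB \<Longrightarrow> W x = cs ! x"
  shows "runs w M prog ((\<lambda>_. 0), mm, cs)
    (IT * (8 * (P * (56 * n + 39)) + 302 * X + 446) + NB * 14 + 12 * m + 500) (\<lambda>(r, m', cs'). r rans = of_bool (found IT))"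
proof -
  note MB = M_bounds
  define Ra where "Ra = (n + 2) ^ 8"
  define XX where "XX = 27 ^ m div (2::nat) ^ (4 * m)"
  have RaX: "R = 4 * Ra" "X = 128 * Ra * (XX + 1)" using R X by (simp_all add: Ra_def XX_def)
  have Ra1: "Ra \<ge> 1" by (simp add: Ra_def)
  have "128 * Ra * 1 \<le> X" unfolding RaX by (rule mult_left_mono) auto
  then have bR: "128 * Ra < 2 ^ w" "Ra < 2 ^ w" "4 * Ra < 2 ^ w" using Xw by linarith+
  have "1 * (XX + 1) \<le> X" unfolding RaX using Ra1 by (intro mult_right_mono) auto
  then have "XX < X" by simp
  then have bXX: "XX + 1 < 2 ^ w" "XX < 2 ^ w" using Xw by (auto intro: le_less_trans less_trans)
  have "(2::nat) ^ (4 * m) = 16 ^ m" by (simp add: power_mult)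
  also have "\<dots> \<le> 27 ^ m" by (rule power_mono) auto
  finally have b16: "(2::nat) ^ (4 * m) < 2 ^ w" using mw by linarith
  have "m \<le> 2 ^ m" "(2::nat) ^ m \<le> 27 ^ m" by (simp_all add: power_mono less_imp_le)
  have "4 * m \<le> d" using md by simp
  then have bm: "4 * m < 2 ^ w" "m < 2 ^ w" using dw by linarith+
  have nb: "n + 2 < 2 ^ w" "n + 1 < 2 ^ w" "n < 2 ^ w" "d div 8 + 1 < 2 ^ w" "d div 8 < 2 ^ w" using MB nd by linarith+
  have cb: "(k::nat) < 2 ^ w" if "k \<le> 128" for k using that big by linarith
  have Rn: "R * nn * 1 \<le> IT" unfolding IT by (rule mult_left_mono) auto
  then have bRn: "R * nn < 2 ^ w" using ITw by linarith
  have Rw: "R < 2 ^ w" using bR RaX by simp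
  have bnn: "nn < 2 ^ w" "nA < 2 ^ w" "nn - nA < 2 ^ w" using MB nA by linarith+
  have "8 * P * n \<le> NB" unfolding NB using RaX Ra1 by simp
  then have bP: "8 * P * n < 2 ^ w" "8 * P < 2 ^ w" "P < 2 ^ w" "NB < 2 ^ w" "b0 < 2 ^ w" "b1 < 2 ^ w" "b2 < 2 ^ w" "b3 < 2 ^ w"
    using M b0 b1 b2 b3 MB by linarith+
  have P2: "2 * 2 ^ (d div 8) = P" by (simp add: P nd)
  define r1 where "r1 = (\<lambda>_. 0::nat)(rd := d, rnA := nA, rnn := nn, rn := n, rm := m, rP := P, rkb := n + 2, rR := 1)"
  show ?thesis
    unfolding prog_def
    apply (rule runs_le)
     apply (rule runs_Seq_Load')
    subgoal using cb[of 0] by simp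
    subgoal using MB by simp
     apply (rule runs_Seq_Load')
    subgoal using cb[of 1] by simp
    subgoal using MB by simp
     apply (rule runs_Seq_Load')
    subgoal using cb[of 2] by simp
    subgoal using MB by simp
     apply (rule runs_Seq_Assign')
    subgoal using bnn nA mem by simp
     apply (rule runs_Seq_Assign')
    subgoal using dw cb[of 8] cb[of 1] nb mem by simp
     apply (rule runs_Seq_Assign')
    subgoal using dw cb[of 4] mem by simp
     apply (rule runs_Seq_Assign')
    subgoal using cb[of 1] nb(4) bP(3) by (simp add: mem(1) push_bit_eq_mult P2)
     apply (rule runs_Seq_Assign')
    subgoal using cb[of 2] nb(1,4) by (simp add: mem(1) nd)
     apply (rule runs_Seq_Assign')
    subgoal using cb[of 1] by simp
     apply (rule runs_eq_state[where s = "(r1, mm, cs)"])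
      apply (rule runs_Seq'[where ?T1.0 = "12 * 8 + 6" and ?T2.0 = "IT * (8 * (P * (56 * n + 39)) + 302 * X + 446) + NB * 14 + 12 * m + 340"])
       apply (rule mult_loop[where a = "n + 2" and N = 8 and Q = "\<lambda>s. \<exists>r'. s = (r', mm, cs) \<and>
          (\<forall>z. z \<notin> {rR, ri} \<longrightarrow> r' z = r1 z) \<and> r' rR = Ra"])
    subgoal by simp
    subgoal by simp
    subgoal by simp
    subgoal using nb by (simp add: r1_def)
    subgoal by (simp add: r1_def)
    subgoal by simp
    subgoal using cb by simp
    subgoal by simp
    subgoal using cb by simp
    subgoal by simp
    subgoal by simp
    subgoal using bR by (simp add: r1_def Ra_def)
    subgoal by (simp add: r1_def Ra_def)
     apply (erule exE conjE)+
    subgoal for s' r2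
      apply hypsubst
      subgoal premises p2
      proof -
        define r3 where "r3 = r2(rX := 1)"
        have r2: "r2 rm = m" "r2 rn = n" "r2 rnn = nn" "r2 rP = P" "r2 rnA = nA" "r2 rans = 0"
          using p2(1) by (simp_all add: r1_def)
        show ?thesis
          apply (rule runs_le)
           apply (rule runs_Seq_Assign')
          subgoal using cb by simp
           apply (rule runs_eq_state[where s = "(r3, mm, cs)"])
            apply (rule runs_Seq'[where ?T1.0 = "12 * m + 6" and ?T2.0 = "IT * (8 * (P * (56 * n + 39)) + 302 * X + 446) + NB * 14 + 320"])
             apply (rule mult_loop[where a = "27" and N = m and Q = "\<lambda>s. \<exists>r'. s = (r', mm, cs) \<and>
               (\<forall>z. z \<notin> {rX, ri} \<longrightarrow> r' z = r3 z) \<and> r' rX = 27 ^ m"])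
          subgoal by simp
          subgoal by simp
          subgoal by simp
          subgoal using cb by simp
          subgoal by simp
          subgoal by simp
          subgoal using bm by simp
          subgoal using r2 by (simp add: r3_def)
          subgoal using r2 bm by (simp add: r3_def)
          subgoal by simp
          subgoal by simp
          subgoal using mw by (simp add: r3_def)
          subgoal by (simp add: r3_def)
           apply (erule exE conjE)+
          subgoal for s' r4
            apply hypsubst
            subgoal premises p4
            proof -
              have r4: "r4 rm = m" "r4 rn = n" "r4 rnn = nn" "r4 rR = Ra" "r4 rP = P" "r4 rnA = nA" "r4 rans = 0"
                using p4(1) r2 p2(2-) by (simp_all add: r3_def)
              define r5 where "r5 = r4(rX := X, rR := R, rkb := n + 1, rIT := R * nn)"
              show ?thesis
                apply (rule runs_le)
                 apply (rule runs_Seq_Assign')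
                subgoal using cb[of 128] cb[of 1] cb[of 4] bR bm b16 bXX mw Xw
                  by (simp add: r4 p4(2-) push_bit_eq_mult XX_def RaX(2))
                 apply (rule runs_Seq_Assign')
                subgoal using cb[of 4] bR by (simp add: r4)
                 apply (rule runs_Seq_Assign')
                subgoal using cb[of 1] nb by (simp add: r4)
                 apply (rule runs_Seq_Assign')
                subgoal using bnn bRn Rw by (simp add: r4 RaX(1))
                 apply (rule runs_eq_state[where s = "(r5, mm, cs)"])
                  apply (rule runs_Seq'[where ?T1.0 = "12 * 16 + 6" and ?T2.0 = "IT * (8 * (P * (56 * n + 39)) + 302 * X + 446) + NB * 14 + 60"])
                   apply (rule mult_loop[where a = "n + 1" and N = 16 and Q = "\<lambda>s. \<exists>r'. s = (r', mm, cs) \<and>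
                     (\<forall>z. z \<notin> {rIT, ri} \<longrightarrow> r' z = r5 z) \<and> r' rIT = IT"])
                subgoal by simp
                subgoal by simp
                subgoal by simp
                subgoal using nb by (simp add: r5_def)
                subgoal by (simp add: r5_def)
                subgoal by simp
                subgoal using cb by simp
                subgoal by simp
                subgoal using cb by simp
                subgoal by simp
                subgoal by simp
                subgoal using ITw by (simp add: r5_def IT)
                subgoal by (simp add: r5_def IT)
                 apply (erule exE conjE)+
                subgoal for s' r6
                  apply hypsubst
                  subgoal premises p6
                  proof -
                    have r6: "r6 rn = n" "r6 rnn = nn" "r6 rR = R" "r6 rP = P" "r6 rnA = nA"
                        "r6 rans = 0" "r6 rX = X"
                      using p6(1) r4 by (simp_all add: r5_def)
                    define r7 where "r7 = r6(rb0 := b0, rNB := NB, rb1 := b1, rb2 := b2, rb3 := b3)"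
                    have r7: "env r7" "r7 rans = 0" "r7 rIT = IT" "r7 rb0 = b0" "r7 rNB = NB"
                      using r6 p6(2-) by (simp_all add: r7_def env_def)
                    show ?thesis
                      apply (rule runs_le)
                       apply (rule runs_Seq_Assign')
                      subgoal using cb[of 3] bnn bP b0 by (simp add: r6)
                       apply (rule runs_Seq_Assign')
                      subgoal using cb[of 8] bP Rw nb by (simp add: r6 NB[symmetric])
                       apply (rule runs_Seq_Assign')
                      subgoal using bP by (simp add: r6 NB[symmetric] b0[symmetric] b1[symmetric])
                       apply (rule runs_Seq_Assign')
                      subgoal using cb[of 8] bP by (simp add: r6 NB[symmetric] b0[symmetric] b1[symmetric] b2[symmetric])
                       apply (rule runs_Seq_Assign')
                      subgoal using cb[of 8] bP by (simp add: r6 NB[symmetric] b0[symmetric] b1[symmetric] b2[symmetric] b3[symmetric])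
                       apply (rule runs_eq_state[where s = "(r7, mm, cs)"])
                        apply (rule runs_Seq'[where ?T1.0 = "NB * 14 + 6" and ?T2.0 = "IT * (8 * (P * (56 * n + 39)) + 302 * X + 446) + 6"])
                         apply (rule coin_loop[OF cs r7(4,5), where Q = "\<lambda>s. \<exists>r' m'. s = (r', m', []) \<and>
                            (\<forall>x. x \<notin> mod_regs (For rit (Reg rNB) coin_step) \<longrightarrow> r' x = r7 x) \<and>
                            (\<forall>x<NB. m' (b0 + x) = of_bool (W x)) \<and> (\<forall>a. a \<notin> {b0..<b1} \<longrightarrow> m' a = mm a)"])
                           apply assumption
                      subgoal by blast
                       apply (erule exE conjE)+
                      subgoal for s' r8 m8
                        apply hypsubst
                        apply (rule main_loop)
                        subgoal using r7(1) by (simp add: env_def coin_step_def)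
                        subgoal unfolding fixed_mem_def using mem(4) b0 by simp
                        subgoal using mem(5) b0 b1 b2 b3 by simp
                        subgoal using r7 by (simp add: coin_step_def)
                        subgoal using r7 by (simp add: coin_step_def)
                        subgoal using p6(2-) by simp
                        done
                      subgoal by (simp add: r7_def r6 NB[symmetric] b0[symmetric] b1[symmetric] b2[symmetric] b3[symmetric])
                      subgoal using p6(2-) by simp
                      done
                  qed
                  done
                subgoal by (simp add: fun_eq_iff r5_def r4 p4(2-) push_bit_eq_mult XX_def[symmetric] RaX)
                apply simp
                done
            qed
            done
          subgoal by (simp add: r3_def)
          apply simp
          done
      qed
      done
    subgoal using mem nA by (simp add: fun_eq_iff r1_def nd md[symmetric] push_bit_eq_mult P2)
    apply simp
    done
qed

end

section \<open>Enumerating separators\<close>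

text \<open>A new top digit changes the number by a multiple of the product of all lower radices,
  which leaves the lower digits alone. Used both for the indices of tuples of words and for the
  existence of the right guess.\<close>

lemma mixed_radix_surj:
  fixes c x :: "nat \<Rightarrow> nat"
  assumes "\<And>i. i < K \<Longrightarrow> x i < c i"
  shows "\<exists>v<\<Prod>i<K. c i. \<forall>i<K. v div (\<Prod>j<i. c j) mod c i = x i"
  using assms
proof (induction K)
  case (Suc K)
  then obtain v where v: "v < (\<Prod>i<K. c i)" "\<And>i. i < K \<Longrightarrow> v div (\<Prod>j<i. c j) mod c i = x i"
    by fastforce
  define u where "u = v + (\<Prod>i<K. c i) * x K"
  have "u < (\<Prod>i<K. c i) * Suc (x K)" using v(1) by (simp add: u_def)
  also have "\<dots> \<le> (\<Prod>i<K. c i) * c K" using Suc.prems[of K] by (intro mult_left_mono) auto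
  finally have "u < (\<Prod>i<Suc K. c i)" by simp
  moreover have "u div (\<Prod>j<i. c j) mod c i = x i" if "i < Suc K" for i
  proof (cases "i = K")
    case True
    have "(\<Prod>i<K. c i) \<noteq> 0" using v(1) by (metis not_less0)
    then have "u div (\<Prod>j<K. c j) = x K"
      unfolding u_def using v(1) by (subst add.commute) (simp add: div_mult_self4)
    then show ?thesis using True Suc.prems[of K] by simp
  next
    case False
    then have i: "i < K" using that by simp
    have "(\<Prod>j<Suc i. c j) dvd (\<Prod>j<K. c j)" by (rule prod_dvd_prod_subset) (use i in auto)
    then obtain t where t: "(\<Prod>j<K. c j) = (\<Prod>j<i. c j) * (c i * t)" by (auto simp: dvd_def ac_simps)
    have "0 < (\<Prod>j<i. c j)" using v(1) t by (cases "(\<Prod>j<i. c j) = 0") auto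
    then have "u div (\<Prod>j<i. c j) = v div (\<Prod>j<i. c j) + c i * (t * x K)"
      by (simp add: u_def t mult.assoc)
    then show ?thesis using v(2)[OF i] by simp
  qed
  ultimately show ?case by blast
qed simp

lemma decode_image:
  "decode n l K ` {..<\<Prod>i<K. length (l i)} =
     {\<Sum>i<K. \<kappa> i * 2 ^ (i * n) |\<kappa>. \<forall>i<K. \<kappa> i \<in> set (l i)}"
proof (intro equalityI subsetI)
  fix S
  assume "S \<in> decode n l K ` {..<\<Prod>i<K. length (l i)}"
  then obtain v where v: "v < (\<Prod>i<K. length (l i))" "S = decode n l K v" by auto
  have "0 < length (l i)" if "i < K" for i
  proof (rule ccontr)
    assume "\<not> 0 < length (l i)"
    then have "(\<Prod>i<K. length (l i)) = 0" using that by (intro prod_zero) auto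
    with v show False by simp
  qed
  then have "\<forall>i<K. l i ! (v div (\<Prod>x<i. length (l x)) mod length (l i)) \<in> set (l i)" by simp
  then show "S \<in> {\<Sum>i<K. \<kappa> i * 2 ^ (i * n) |\<kappa>. \<forall>i<K. \<kappa> i \<in> set (l i)}"
    unfolding v(2) decode_def mem_Collect_eq
    by (intro exI[of _ "\<lambda>i. l i ! (v div (\<Prod>x<i. length (l x)) mod length (l i))"]) simp
next
  fix S
  assume "S \<in> {\<Sum>i<K. \<kappa> i * 2 ^ (i * n) |\<kappa>. \<forall>i<K. \<kappa> i \<in> set (l i)}"
  then obtain \<kappa> where \<kappa>: "\<forall>i<K. \<kappa> i \<in> set (l i)" "S = (\<Sum>i<K. \<kappa> i * 2 ^ (i * n))" by blast
  then have "\<forall>i<K. \<exists>x. x < length (l i) \<and> l i ! x = \<kappa> i" by (simp add: in_set_conv_nth)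
  then obtain x where x: "\<forall>i<K. x i < length (l i) \<and> l i ! x i = \<kappa> i" by metis
  with mixed_radix_surj[of K x "\<lambda>i. length (l i)"] obtain v where
    v: "v < (\<Prod>i<K. length (l i))" "\<forall>i<K. v div (\<Prod>j<i. length (l j)) mod length (l i) = x i"
    by auto
  have "decode n l K v = S" unfolding decode_def \<kappa>(2) using v(2) x by (intro sum.cong) auto
  then show "S \<in> decode n l K ` {..<\<Prod>i<K. length (l i)}" using v(1) by blast
qed

text \<open>The table address of a choice therefore determines its words: a hit is a common choice
  and not a collision.\<close>

lemma concat_digit:
  assumes "\<And>i. i < K \<Longrightarrow> \<kappa> i < (2::nat) ^ n" "i < K"
  shows "(\<Sum>j<K. \<kappa> j * 2 ^ (j * n)) div 2 ^ (i * n) mod 2 ^ n = \<kappa> i"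
  using assms
proof (induction K)
  case (Suc K)
  have less: "(\<Sum>j<K. \<kappa> j * 2 ^ (j * n)) < 2 ^ (K * n)" using Suc.prems by (intro concat_less) auto
  show ?case
  proof (cases "i = K")
    case True
    then show ?thesis using less Suc.prems(1)[of K] by simp
  next
    case False
    then have i: "i < K" using Suc.prems by simp
    have "Suc i * n \<le> K * n" using i by (intro mult_right_mono) auto
    then have "(2::nat) ^ (K * n) = 2 ^ (i * n + n + (K * n - Suc i * n))" by simp
    also have "\<dots> = 2 ^ (i * n) * (2 ^ n * 2 ^ (K * n - Suc i * n))" by (simp only: power_add mult.assoc)
    finally have "(\<Sum>j<Suc K. \<kappa> j * 2 ^ (j * n)) div 2 ^ (i * n) =
        (\<Sum>j<K. \<kappa> j * 2 ^ (j * n)) div 2 ^ (i * n) + 2 ^ n * (2 ^ (K * n - Suc i * n) * \<kappa> K)"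
      by (simp add: mult.assoc mult.left_commute[of "\<kappa> K"])
    then show ?thesis using Suc.IH[OF _ i] Suc.prems by simp
  qed
qed simp

context layout
begin

lemma outs_iff:
  "S \<in> outs it \<longleftrightarrow> (\<Prod>i<8. length (candidates it i)) \<le> X \<and>
     (\<exists>\<kappa>. (\<forall>i<8. \<kappa> i \<in> set (candidates it i)) \<and> S = (\<Sum>i<8. \<kappa> i * 2 ^ (i * n)))"
  by (auto simp: outs_def decode_image)

text \<open>Equal addresses mean equal words, whatever guesses and repetitions they stem from. Block
  by block the common word contains one input set and avoids the other one, so the two share no
  position below \<open>8 * n\<close>, and by \<open>small\<close> there are no further
  positions.\<close>

lemma found_sound:
  assumes "found it" and nn: "nn > 0"
    and small: "\<And>j x. j < nn \<Longrightarrow> bit (inp j) x \<Longrightarrow> x < 8 * n"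
  shows "\<exists>j<nA. \<exists>j'. nA \<le> j' \<and> j' < nn \<and> (\<forall>x. \<not> (bit (inp j) x \<and> bit (inp j') x))"
proof -
  from assms obtain b S a where S: "nA \<le> b mod nn" "S \<in> outs b" "S \<in> outs a" "a mod nn < nA"
    by (auto simp: found_def marked_def)
  from S(2) obtain \<kappa> where \<kappa>: "\<forall>i<8. \<kappa> i \<in> set (candidates b i)" "S = (\<Sum>i<8. \<kappa> i * 2 ^ (i * n))"
    unfolding outs_iff by blast
  from S(3) obtain \<kappa>' where \<kappa>': "\<forall>i<8. \<kappa>' i \<in> set (candidates a i)" "S = (\<Sum>i<8. \<kappa>' i * 2 ^ (i * n))"
    unfolding outs_iff by blast
  have less: "\<kappa> i < 2 ^ n" "\<kappa>' i < 2 ^ n" if "i < 8" for i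
  proof -
    have "\<kappa> i < P" "\<kappa>' i < P"
      using \<kappa>(1) \<kappa>'(1) that unfolding candidates_def by (blast intro: set_cand_less)+
    then show "\<kappa> i < 2 ^ n" "\<kappa>' i < 2 ^ n" by (simp_all add: P)
  qed
  have eq: "\<kappa> i = \<kappa>' i" if "i < 8" for i
    using concat_digit[of 8 \<kappa> n i] concat_digit[of 8 \<kappa>' n i] less that \<kappa>(2) \<kappa>'(2) by simp
  have "\<not> (bit (inp (a mod nn)) x \<and> bit (inp (b mod nn)) x)" for x
  proof
    assume x: "bit (inp (a mod nn)) x \<and> bit (inp (b mod nn)) x"
    then have "x < 8 * n" using small[of "a mod nn" x] nn by simp
    then have i: "x div n < 8" using n by (simp add: less_mult_imp_div_less)
    have q: "x mod n < n" using n by simp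
    have xq: "x div n * n + x mod n = x" by simp
    have "\<not> (bit (inp (b mod nn)) x \<and> bit (\<kappa> (x div n)) (x mod n))"
    proof -
      have "\<kappa> (x div n) \<in> set (candidates b (x div n))" using \<kappa>(1) i by simp
      then have "\<forall>q<n. \<not> (bit (inp (b mod nn)) (x div n * n + q) \<and> bit (\<kappa> (x div n)) q)"
        using S(1) by (auto simp: candidates_def cand_def selected_def)
      with q xq show ?thesis by metis
    qed
    moreover have "\<not> (bit (inp (a mod nn)) x \<and> \<not> bit (\<kappa> (x div n)) (x mod n))"
    proof -
      have "\<kappa> (x div n) \<in> set (candidates a (x div n))" using \<kappa>'(1) i eq by simp
      then have "\<forall>q<n. \<not> (bit (inp (a mod nn)) (x div n * n + q) \<and> \<not> bit (\<kappa> (x div n)) q)"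
        using S(4) by (auto simp: candidates_def cand_def selected_def)
      with q xq show ?thesis by metis
    qed
    ultimately show False using x by blast
  qed
  then show ?thesis using S nn by (intro exI[of _ "a mod nn"] exI[of _ "b mod nn"] conjI) auto
qed

end

text \<open>The success event of one repetition under the guess \<open>g\<close>; the bounds by
  \<open>X\<close> ensure that neither set of the pair is skipped.\<close>

definition good :: "nat \<Rightarrow> nat \<Rightarrow> (nat \<Rightarrow> bool) \<Rightarrow> nat \<Rightarrow> nat \<Rightarrow> nat \<Rightarrow> bool" where
  "good n X V YA YB g \<longleftrightarrow>
     (\<exists>\<kappa>. \<forall>i<8. \<kappa> i \<in> set (cand n V YA False g i) \<inter> set (cand n V YB True g i)) \<and>
     (\<Prod>i<8. length (cand n V YA False g i)) \<le> X \<and> (\<Prod>i<8. length (cand n V YB True g i)) \<le> X"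

context instance_layout
begin

lemma found_complete:
  assumes j: "j < nA" "nA \<le> j'" "j' < nn" and rep: "rep < R" and g: "g < (n + 1) ^ 16"
    and good: "good n X (rep_bits rep) (inp j) (inp j') g"
  shows "found IT"
proof -
  \<comment> \<open>The iterations that treat the two sets under the same guess and repetition. They
    differ only in the lowest digit, so \<open>j < nA \<le> j'\<close> puts the marking before the
    look-up.\<close>
  define a where "a = (g * R + rep) * nn + j"
  define b where "b = (g * R + rep) * nn + j'"
  have jn: "j < nn" using j by simp
  have da: "a mod nn = j" "a div nn mod R = rep" "a div (nn * R) = g"
    using jn rep by (simp_all add: a_def div_mult2_eq)
  have db: "b mod nn = j'" "b div nn mod R = rep" "b div (nn * R) = g"
    using j(3) rep by (simp_all add: b_def div_mult2_eq)
  have ab: "a < b" using j by (simp add: a_def b_def)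
  have "b < Suc (g * R + rep) * nn" using j by (simp add: b_def)
  also have "\<dots> \<le> Suc g * R * nn" using rep by (intro mult_right_mono) auto
  also have "\<dots> \<le> (n + 1) ^ 16 * R * nn" using g by (intro mult_right_mono) auto
  finally have bIT: "b < IT" by (simp add: IT ac_simps)
  have ca: "candidates a = cand n (rep_bits rep) (inp j) False g"
    using j by (simp add: candidates_def da)
  have cb: "candidates b = cand n (rep_bits rep) (inp j') True g"
    using j by (simp add: candidates_def db)
  from good obtain \<kappa> where \<kappa>: "\<forall>i<8. \<kappa> i \<in> set (candidates a i) \<inter> set (candidates b i)"
    unfolding good_def ca cb by blast
  have "(\<Sum>i<8. \<kappa> i * 2 ^ (i * n)) \<in> outs a" "(\<Sum>i<8. \<kappa> i * 2 ^ (i * n)) \<in> outs b"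
    using good \<kappa> unfolding outs_iff good_def ca cb by blast+
  then show ?thesis
    using ab bIT j da db unfolding found_def marked_def by blast
qed

end

lemma bit_set_word:
  assumes "A \<subseteq> {1..d}"
  shows "bit (set_word A) x \<longleftrightarrow> Suc x \<in> A"
proof -
  have fin: "finite A" using assms finite_subset by blast
  have inj: "inj_on (\<lambda>i. i - 1) A" 
  proof (rule inj_onI)
    fix x y assume "x \<in> A" "y \<in> A" and eq: "x - 1 = y - 1"
    then have "1 \<le> x" "1 \<le> y" using assms by auto
    with eq show "x = y" by linarith
  qed
  have "set_word A = (\<Sum>i\<in>(\<lambda>i. i - 1) ` A. 2 ^ i)"
    unfolding set_word_def by (subst sum.reindex[OF inj]) (simp add: o_def)
  then have "set_word A = set_encode ((\<lambda>i. i - 1) ` A)" by (simp add: set_encode_def)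
  then have "bit (set_word A) x \<longleftrightarrow> x \<in> set_decode (set_encode ((\<lambda>i. i - 1) ` A))"
    by (simp add: set_decode_def bit_iff_odd)
  also have "\<dots> \<longleftrightarrow> x \<in> (\<lambda>i. i - 1) ` A" using fin by simp
  also have "\<dots> \<longleftrightarrow> Suc x \<in> A" using assms by (force simp: image_iff)
  finally show ?thesis .
qed

section \<open>Counting coin sequences\<close>

text \<open>Independence in counting form: disjoint chunks are chosen freely, so the numbers
  multiply. It is applied with chunks that hold a single coin, the coins of a word, of a block, and
  of a repetition.\<close>

lemma card_chunks:
  assumes "\<And>x. x < a \<Longrightarrow> D x \<subseteq> {l :: 'a list. length l = b}"
  shows "card {l. length l = a * b \<and> (\<forall>x<a. take b (drop (x * b) l) \<in> D x)} = (\<Prod>x<a. card (D x))"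
  using assms
proof (induction a)
  case 0
  have "{l :: 'a list. length l = 0 * b \<and> (\<forall>x<0. take b (drop (x * b) l) \<in> D x)} = {[]}" by auto
  then show ?case by simp
next
  case (Suc a)
  let ?S = "\<lambda>a. {l. length l = a * b \<and> (\<forall>x<a. take b (drop (x * b) l) \<in> D x)}"
  have Da: "D a \<subseteq> {l. length l = b}" using Suc.prems by simp
  have "?S (Suc a) = (\<lambda>(u, v). u @ v) ` (?S a \<times> D a)"
  proof (intro equalityI subsetI)
    fix l assume l: "l \<in> ?S (Suc a)"
    have "take b (drop (x * b) (take (a * b) l)) = take b (drop (x * b) l)" if "x < a" for x
    proof -
      have "Suc x * b \<le> a * b" using that by (intro mult_right_mono) auto
      then have "b \<le> a * b - x * b" by simp
      then show ?thesis by (simp only: drop_take take_take min_absorb1)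
    qed
    moreover have "take b (drop (a * b) l) = drop (a * b) l" using l by simp
    ultimately have "take (a * b) l \<in> ?S a" "drop (a * b) l \<in> D a"
      using l by (auto simp: All_less_Suc)
    then have "(take (a * b) l, drop (a * b) l) \<in> ?S a \<times> D a" by (rule SigmaI)
    then have "(\<lambda>(u, v). u @ v) (take (a * b) l, drop (a * b) l) \<in> (\<lambda>(u, v). u @ v) ` (?S a \<times> D a)"
      by (rule imageI)
    then show "l \<in> (\<lambda>(u, v). u @ v) ` (?S a \<times> D a)" by simp
  next
    fix l assume "l \<in> (\<lambda>(u, v). u @ v) ` (?S a \<times> D a)"
    then obtain u v where uv: "l = u @ v" "u \<in> ?S a" "v \<in> D a" by auto
    then have len: "length u = a * b" "length v = b" using Da by auto
    have chunk: "take b (drop (x * b) l) = take b (drop (x * b) u)" if "x < a" for x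
    proof -
      have "Suc x * b \<le> a * b" using that by (intro mult_right_mono) auto
      moreover have "Suc x * b = x * b + b" by simp
      ultimately have "x * b \<le> length u" "b \<le> length u - x * b" using len(1) by linarith+
      then show ?thesis by (simp only: uv(1) drop_append take_append) simp
    qed
    have "take b (drop (a * b) l) = v" using len by (simp add: uv(1))
    moreover have "length l = Suc a * b" using len by (simp add: uv(1))
    ultimately show "l \<in> ?S (Suc a)"
      unfolding mem_Collect_eq All_less_Suc using uv(2,3) chunk len(2) by simp
  qed
  moreover have "inj_on (\<lambda>(u, v). u @ v) (?S a \<times> D a)"
    by (auto simp: inj_on_def)
  ultimately have "card (?S (Suc a)) = card (?S a) * card (D a)"
    by (simp add: card_image card_cartesian_product)
  then show ?case using Suc by simp
qed

lemma card_bool_lists: "card {l :: bool list. length l = L} = 2 ^ L"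
  using card_lists_length_eq[of "UNIV :: bool set" L] by simp

lemma finite_bool_lists: "finite {l :: bool list. length l = L \<and> Q l}"
  using finite_lists_length_eq[of "UNIV :: bool set" L] by (auto intro: finite_subset)

lemma card_fixed_bits:
  assumes "F \<subseteq> {..<L}"
  shows "card {l :: bool list. length l = L \<and> (\<forall>y\<in>F. l ! y)} = 2 ^ (L - card F)"
proof -
  define D :: "nat \<Rightarrow> bool list set" where "D = (\<lambda>x. if x \<in> F then {[True]} else {[True], [False]})"
  have "take 1 (drop x l) \<in> D x \<longleftrightarrow> (x \<in> F \<longrightarrow> l ! x)" if "x < length l" for x l
    using that by (cases "l ! x") (auto simp: D_def take_Suc_conv_app_nth hd_drop_conv_nth take_Suc)
  then have "{l :: bool list. length l = L \<and> (\<forall>y\<in>F. l ! y)} =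
      {l. length l = L * 1 \<and> (\<forall>x<L. take 1 (drop (x * 1) l) \<in> D x)}"
    using assms by auto
  also have "card \<dots> = (\<Prod>x<L. card (D x))"
    by (rule card_chunks) (auto simp: D_def)
  also have "\<dots> = (\<Prod>x<L. if x \<in> F then 1 else 2)"
    by (rule prod.cong) (auto simp: D_def)
  also have "\<dots> = 2 ^ card ({..<L} - F)"
    by (simp add: prod.If_cases Diff_eq Collect_neg_eq)
  also have "card ({..<L} - F) = L - card F"
    using assms by (simp add: card_Diff_subset finite_subset)
  finally show ?thesis .
qed

lemma card_words:
  "card {k. k < (2::nat) ^ n \<and> Q {q. q < n \<and> bit k q}} = card {B. B \<subseteq> {..<n} \<and> Q B}"
proof -
  have bit: "bit k q \<longleftrightarrow> q \<in> set_decode k" for k q :: nat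
    by (simp add: set_decode_def bit_iff_odd)
  have sub: "set_decode k \<subseteq> {..<n}" if "k < 2 ^ n" for k
  proof -
    show ?thesis
    proof
      fix q assume "q \<in> set_decode k"
      then have "odd (k div 2 ^ q)" by (simp add: set_decode_def)
      then have "k div 2 ^ q \<noteq> 0" by (metis even_zero)
      then have "2 ^ q \<le> k" by (simp add: div_eq_0_iff not_less)
      with that have "(2::nat) ^ q < 2 ^ n" by linarith
      then show "q \<in> {..<n}" by simp
    qed
  qed
  have eq: "{q. q < n \<and> bit k q} = set_decode k" if "k < 2 ^ n" for k
    using sub[OF that] bit by auto
  have less: "set_encode B < 2 ^ n" if "B \<subseteq> {..<n}" for B
  proof -
    have "set_encode B \<le> (\<Sum>q<n. 2 ^ q)"
      unfolding set_encode_def using that by (intro sum_mono2) auto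
    also have "\<dots> < 2 ^ n" by (simp add: lessThan_atLeast0 sum_power2)
    finally show ?thesis .
  qed
  have "bij_betw set_decode {k. k < 2 ^ n \<and> Q {q. q < n \<and> bit k q}} {B. B \<subseteq> {..<n} \<and> Q B}"
  proof (rule bij_betwI[where g = set_encode])
    show "set_decode \<in> {k. k < 2 ^ n \<and> Q {q. q < n \<and> bit k q}} \<rightarrow> {B. B \<subseteq> {..<n} \<and> Q B}"
      using eq sub by auto
    show "set_encode \<in> {B. B \<subseteq> {..<n} \<and> Q B} \<rightarrow> {k. k < 2 ^ n \<and> Q {q. q < n \<and> bit k q}}"
      using less eq by (auto simp: finite_subset)
  qed (auto simp: finite_subset)
  then show ?thesis by (rule bij_betw_same_card)
qed

text \<open>Only the positions outside both sets are free; removing \<open>A\<close> from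
  \<open>S\<close> is the bijection.\<close>

lemma card_between:
  assumes "A \<subseteq> {..<n}" "B \<subseteq> {..<n}" "A \<inter> B = {}" "card A \<le> s"
  shows "card {S. S \<subseteq> {..<n} \<and> card S = s \<and> A \<subseteq> S \<and> S \<inter> B = {}} = (n - card A - card B) choose (s - card A)"
proof -
  have fin: "finite A" "finite B" using assms finite_subset by blast+
  let ?U = "{..<n} - A - B"
  have "bij_betw (\<lambda>S. S - A) {S. S \<subseteq> {..<n} \<and> card S = s \<and> A \<subseteq> S \<and> S \<inter> B = {}}
      {S. S \<subseteq> ?U \<and> card S = s - card A}"
  proof (rule bij_betwI[where g = "\<lambda>S. S \<union> A"])
    show "(\<lambda>S. S - A) \<in> {S. S \<subseteq> {..<n} \<and> card S = s \<and> A \<subseteq> S \<and> S \<inter> B = {}} \<rightarrow>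
      {S. S \<subseteq> ?U \<and> card S = s - card A}"
      using fin by (auto simp: card_Diff_subset)
    show "(\<lambda>S. S \<union> A) \<in> {S. S \<subseteq> ?U \<and> card S = s - card A} \<rightarrow>
      {S. S \<subseteq> {..<n} \<and> card S = s \<and> A \<subseteq> S \<and> S \<inter> B = {}}"
    proof
      fix S assume S: "S \<in> {S. S \<subseteq> ?U \<and> card S = s - card A}"
      then have "finite S" "S \<inter> A = {}" by (auto intro: finite_subset)
      then have "card (S \<union> A) = s" using S fin assms(4) by (simp add: card_Un_disjoint)
      then show "S \<union> A \<in> {S. S \<subseteq> {..<n} \<and> card S = s \<and> A \<subseteq> S \<and> S \<inter> B = {}}"
        using S assms by auto
    qed
  qed auto
  then have "card {S. S \<subseteq> {..<n} \<and> card S = s \<and> A \<subseteq> S \<and> S \<inter> B = {}} = card ?U choose (s - card A)"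
    by (simp add: bij_betw_same_card n_subsets)
  moreover have "card ?U = n - card A - card B"
  proof -
    have "card ({..<n} - A) = n - card A" using assms fin by (simp add: card_Diff_subset)
    moreover have "B \<subseteq> {..<n} - A" using assms by auto
    ultimately show ?thesis using fin by (simp add: card_Diff_subset)
  qed
  ultimately show ?thesis by simp
qed

text \<open>A single term of (1/2 + 1)^N. The weight 1/2 makes the terms around k = N/3 dominate. Up
  to bounded terms this is the ratio of the totals over the blocks, m to 3m, so no exponential
  factor is lost.\<close>

lemma binomial_le_power: "real (N choose k) \<le> 2 ^ k * (3 / 2) ^ N"
proof (cases "k \<le> N")
  case True
  have "(3 / 2) ^ N = (1 / 2 + 1 :: real) ^ N" by simp
  also have "\<dots> = (\<Sum>j\<le>N. of_nat (N choose j) * (1 / 2) ^ j * 1 ^ (N - j))"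
    by (rule binomial_ring)
  also have "\<dots> \<ge> real (N choose k) * (1 / 2) ^ k * 1 ^ (N - k)"
    using True by (intro member_le_sum[where f = "\<lambda>j. of_nat (N choose j) * (1 / 2) ^ j * 1 ^ (N - j)"]) auto
  finally show ?thesis by (simp add: power_divide field_simps)
qed (simp add: binomial_eq_0)

text \<open>The central coefficient is the largest of the h + 1 coefficients, whose sum is
  2^h.\<close>

lemma central_binomial_ge: "2 ^ h \<le> (h + 1) * (h choose (h div 2))"
proof -
  have "2 ^ h = (\<Sum>k\<le>h. h choose k)" by (simp add: choose_row_sum)
  also have "\<dots> \<le> (\<Sum>k\<le>h. h choose (h div 2))" by (intro sum_mono binomial_maximum)
  finally show ?thesis by simp
qed

text \<open>Multiplied by (1 + y)^K, the left side becomes (1 - y^2)^K, which is at most 1, while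
  Bernoulli's inequality bounds (1 + y)^K from below. It is needed for the words within a block and
  again for the repetitions.\<close>

lemma one_minus_power_le:
  assumes "0 \<le> y" "y \<le> (1::real)"
  shows "(1 - y) ^ K \<le> 1 / (1 + K * y)"
proof -
  have "(1 - y) ^ K * (1 + y) ^ K = (1 - y * y) ^ K"
    by (simp add: power_mult_distrib[symmetric] algebra_simps)
  also have "\<dots> \<le> 1" using assms by (intro power_le_one) (auto simp: mult_le_one)
  finally have "(1 - y) ^ K * (1 + y) ^ K \<le> 1" .
  moreover have "1 + K * y \<le> (1 + y) ^ K" using Bernoulli_inequality[of y K] assms by simp
  ultimately have "(1 - y) ^ K * (1 + K * y) \<le> 1"
    using assms mult_left_mono[of "1 + K * y" "(1 + y) ^ K" "(1 - y) ^ K"] by fastforce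
  moreover have "0 < 1 + K * y" using assms by (simp add: add_pos_nonneg)
  ultimately show ?thesis by (simp add: field_simps)
qed

section \<open>Random families: expected number of choices and survival of a separator\<close>

definition all_set :: "nat \<Rightarrow> (nat \<Rightarrow> bool) \<Rightarrow> nat \<Rightarrow> nat \<Rightarrow> nat \<Rightarrow> bool" where
  "all_set n V t i k \<longleftrightarrow> (\<forall>q<t. V ((i * 2 ^ n + k) * n + q))"

lemma block_index_less:
  assumes "i < 8" "k < (2::nat) ^ n" "q < n"
  shows "(i * 2 ^ n + k) * n + q < 8 * (2 ^ n * n)"
proof -
  have "(i + 1) * 2 ^ n \<le> 8 * 2 ^ n" using assms by (intro mult_right_mono) auto
  moreover have "(i + 1) * 2 ^ n = i * 2 ^ n + (2::nat) ^ n" by simp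
  ultimately have "i * 2 ^ n + k + 1 \<le> 8 * 2 ^ n" using assms(2) by linarith
  then have "(i * 2 ^ n + k + 1) * n \<le> 8 * 2 ^ n * n" by (rule mult_right_mono) simp
  then show ?thesis using assms(3) by (simp add: mult.assoc)
qed

lemma block_index_inj:
  assumes "(i * 2 ^ n + k) * n + q = (i' * 2 ^ n + k') * n + q'"
    "k < (2::nat) ^ n" "k' < 2 ^ n" "q < n" "q' < n"
  shows "i = i' \<and> k = k' \<and> q = q'"
proof -
  have "i * 2 ^ n + k = i' * 2 ^ n + k' \<and> q = q'"
    using arg_cong[OF assms(1), of "\<lambda>x. x div n"] arg_cong[OF assms(1), of "\<lambda>x. x mod n"] assms(4,5)
    by simp
  then have e: "i * 2 ^ n + k = i' * 2 ^ n + k'" and "q = q'" by auto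
  moreover have "i = i'" using arg_cong[OF e, of "\<lambda>x. x div 2 ^ n"] assms(2,3) by simp
  ultimately show ?thesis by simp
qed

text \<open>Linearity of expectation, with the sum over all coin lists in place of the mean. The
  product counts the surviving tuples \<open>\<kappa>\<close>. A given tuple survives iff the coins
  at \<open>F \<kappa>\<close> are all set, and these are \<open>sum t {..<8}\<close> distinct
  positions because the index is injective.\<close>

lemma sum_candidate_tuples:
  assumes T: "\<And>i. T i \<subseteq> {..<2 ^ n}" and t: "\<And>i. t i \<le> n"
  defines "L \<equiv> 8 * (2 ^ n * n)"
  shows "(\<Sum>l | length l = L. real (\<Prod>i<8. card {k \<in> T i. all_set n ((!) l) (t i) i k})) =
    2 ^ L * (\<Prod>i<8. card (T i) / 2 ^ t i)"
proof -
  let ?I = "{..<8 :: nat}"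
  have finT: "finite (T i)" for i using T finite_subset by blast
  define F where "F = (\<lambda>\<kappa>. (\<lambda>(i, q). (i * 2 ^ n + \<kappa> i) * n + q) ` (SIGMA i:?I. {..<t i}))"
  have F: "F \<kappa> \<subseteq> {..<L}" "card (F \<kappa>) = sum t ?I" if "\<kappa> \<in> PiE ?I T" for \<kappa>
  proof -
    have \<kappa>: "\<kappa> i < 2 ^ n" if "i < 8" for i using \<open>\<kappa> \<in> PiE ?I T\<close> that T[of i] by (auto dest!: PiE_mem)
    show "F \<kappa> \<subseteq> {..<L}"
    proof
      fix y assume "y \<in> F \<kappa>"
      then obtain i q where iq: "i < 8" "q < t i" "y = (i * 2 ^ n + \<kappa> i) * n + q" by (auto simp: F_def)
      then show "y \<in> {..<L}" using block_index_less[of i "\<kappa> i" n q] \<kappa>[of i] t[of i] by (simp add: L_def)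
    qed
    have "inj_on (\<lambda>(i, q). (i * 2 ^ n + \<kappa> i) * n + q) (SIGMA i:?I. {..<t i})"
    proof (rule inj_onI, clarify)
      fix i q i' q'
      assume "(i * 2 ^ n + \<kappa> i) * n + q = (i' * 2 ^ n + \<kappa> i') * n + q'"
        and "i < 8" "q < t i" "i' < 8" "q' < t i'"
      then show "i = i' \<and> q = q'"
        using block_index_inj[of i n "\<kappa> i" q i' "\<kappa> i'" q'] \<kappa> t[of i] t[of i'] by simp
    qed
    then show "card (F \<kappa>) = sum t ?I" by (simp add: F_def card_image)
  qed
  have "(\<Prod>i<8. card {k \<in> T i. all_set n ((!) l) (t i) i k}) = (\<Sum>\<kappa>\<in>PiE ?I T. of_bool (\<forall>y\<in>F \<kappa>. l ! y))"
    (is "?lhs = _") for l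
  proof -
    have "?lhs = card (PiE ?I (\<lambda>i. {k \<in> T i. all_set n ((!) l) (t i) i k}))"
      by (simp add: card_PiE)
    also have "PiE ?I (\<lambda>i. {k \<in> T i. all_set n ((!) l) (t i) i k}) = {\<kappa> \<in> PiE ?I T. \<forall>y\<in>F \<kappa>. l ! y}"
      by (auto simp: PiE_iff F_def all_set_def extensional_def)
    also have "card \<dots> = (\<Sum>\<kappa>\<in>PiE ?I T. of_bool (\<forall>y\<in>F \<kappa>. l ! y))"
      using finT by (subst sum_of_bool_eq) (auto simp: finite_PiE Int_def)
    finally show ?thesis .
  qed
  then have "(\<Sum>l | length l = L. (\<Prod>i<8. card {k \<in> T i. all_set n ((!) l) (t i) i k})) =
      (\<Sum>\<kappa>\<in>PiE ?I T. \<Sum>l | length l = L. of_bool (\<forall>y\<in>F \<kappa>. l ! y))"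
    by (simp add: sum.swap[of _ "PiE ?I T"])
  also have "\<dots> = (\<Sum>\<kappa>\<in>PiE ?I T. 2 ^ (L - sum t ?I))"
  proof (rule sum.cong[OF refl])
    fix \<kappa> assume \<kappa>: "\<kappa> \<in> PiE ?I T"
    have "(\<Sum>l | length l = L. of_bool (\<forall>y\<in>F \<kappa>. l ! y)) = card {l. length l = L \<and> (\<forall>y\<in>F \<kappa>. l ! y)}"
      using finite_bool_lists[of L "\<lambda>_. True"] by (subst sum_of_bool_eq) (auto simp: Int_def)
    then show "(\<Sum>l | length l = L. of_bool (\<forall>y\<in>F \<kappa>. l ! y)) = (2::nat) ^ (L - sum t ?I)"
      using card_fixed_bits[OF F(1)[OF \<kappa>]] F(2)[OF \<kappa>] by simp
  qed
  also have "\<dots> = (\<Prod>i<8. card (T i)) * 2 ^ (L - sum t ?I)" by (simp add: card_PiE)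
  finally have *: "(\<Sum>l | length l = L. (\<Prod>i<8. card {k \<in> T i. all_set n ((!) l) (t i) i k})) =
     (\<Prod>i<8. card (T i)) * 2 ^ (L - sum t ?I)" .
  \<comment> \<open>Turns the truncated difference in the exponent into a quotient of
    powers.\<close>
  have "sum t ?I \<le> (\<Sum>i\<in>?I. n)" by (rule sum_mono) (rule t)
  also have "\<dots> = 8 * (1 * n)" by simp
  also have "\<dots> \<le> L" unfolding L_def by (intro mult_left_mono mult_right_mono) auto
  finally have "(2::real) ^ (L - sum t ?I) = 2 ^ L / 2 ^ sum t ?I" by (simp add: power_diff)
  with arg_cong[OF *, of real] show ?thesis
    by (simp add: prod_dividef power_sum)
qed

text \<open>Every word owns \<open>n\<close> consecutive coins, so words survive independently. The
  count goes through the complement, where all words of \<open>K\<close> fail at once and the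
  condition factorises.\<close>

lemma card_exists_marked:
  assumes K: "K \<subseteq> {..<2 ^ n}" and t: "t \<le> n"
  shows "real (card {l. length l = 2 ^ n * n \<and> (\<exists>k\<in>K. \<forall>q<t. l ! (k * n + q))}) =
    2 ^ (2 ^ n * n) * (1 - (1 - 1 / 2 ^ t) ^ card K)"
proof -
  let ?U = "{l :: bool list. length l = n}"
  let ?B = "{l :: bool list. length l = n \<and> (\<forall>q<t. l ! q)}"
  let ?N = "2 ^ n * n"
  define D where "D = (\<lambda>k. if k \<in> K then ?U - ?B else ?U)"
  have finU: "finite ?U" using finite_bool_lists[of n "\<lambda>_. True"] by simp
  have cB: "card ?B = 2 ^ (n - t)" using card_fixed_bits[of "{..<t}" n] t by (simp add: Ball_def)
  have cUB: "real (card (?U - ?B)) = 2 ^ n * (1 - 1 / 2 ^ t)"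
  proof -
    have "card (?U - ?B) = card ?U - card ?B" using finU by (intro card_Diff_subset) (auto intro: finite_subset)
    then have "real (card (?U - ?B)) = 2 ^ n - 2 ^ (n - t)" by (simp add: card_bool_lists cB of_nat_diff)
    also have "\<dots> = 2 ^ n * (1 - 1 / 2 ^ t)" using t by (simp add: power_diff right_diff_distrib)
    finally show ?thesis .
  qed
  let ?S = "{l :: bool list. length l = ?N \<and> (\<forall>k<2 ^ n. take n (drop (k * n) l) \<in> D k)}"
  have eq: "{l. length l = ?N \<and> (\<exists>k\<in>K. \<forall>q<t. l ! (k * n + q))} = {l. length l = ?N} - ?S"
  proof -
    have "take n (drop (k * n) l) \<in> D k \<longleftrightarrow> (k \<in> K \<longrightarrow> \<not> (\<forall>q<t. l ! (k * n + q)))"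
      if "length l = ?N" "k < 2 ^ n" for l k
    proof -
      have "(k + 1) * n \<le> 2 ^ n * n" using that by (intro mult_right_mono) auto
      moreover have "(k + 1) * n = k * n + n" by simp
      ultimately have "k * n + n \<le> length l" using that(1) by linarith
      then have "length (take n (drop (k * n) l)) = n" "k * n \<le> length l" by auto
      then show ?thesis using t by (auto simp: D_def)
    qed
    then show ?thesis using K by blast
  qed
  have "real (card ?S) = (\<Prod>k<2 ^ n. real (card (D k)))"
    by (subst card_chunks) (auto simp: D_def)
  also have "\<dots> = (\<Prod>k<2 ^ n. 2 ^ n * (if k \<in> K then 1 - 1 / 2 ^ t else 1))"
    by (rule prod.cong) (auto simp: D_def cUB card_bool_lists)
  also have "\<dots> = (2 ^ n) ^ (2 ^ n) * (\<Prod>k<2 ^ n. if k \<in> K then 1 - 1 / 2 ^ t else 1)"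
    by (simp add: prod.distrib)
  also have "(\<Prod>k<(2::nat) ^ n. if k \<in> K then 1 - 1 / (2::real) ^ t else 1) = (1 - 1 / 2 ^ t) ^ card K"
    using K by (simp add: prod.If_cases Int_absorb1)
  finally have S: "real (card ?S) = 2 ^ ?N * (1 - 1 / 2 ^ t) ^ card K"
    by (simp add: power_mult[symmetric] mult.commute)
  have "card ({l :: bool list. length l = ?N} - ?S) = card {l :: bool list. length l = ?N} - card ?S"
    using finite_bool_lists by (intro card_Diff_subset) auto
  moreover have "card ?S \<le> card {l :: bool list. length l = ?N}"
    using finite_bool_lists[of ?N "\<lambda>_. True"] by (intro card_mono) auto
  ultimately show ?thesis
    unfolding eq by (simp add: of_nat_diff card_bool_lists S right_diff_distrib)
qed

text \<open>The blocks read disjoint chunks of coins, so \<open>card_exists_marked\<close>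
  multiplies over them.\<close>

lemma card_exists_tuple:
  assumes K: "\<And>i. K i \<subseteq> {..<2 ^ n}" and t: "\<And>i. t i \<le> n"
  defines "L \<equiv> 8 * (2 ^ n * n)"
  shows "real (card {l. length l = L \<and> (\<forall>i<8. \<exists>k\<in>K i. all_set n ((!) l) (t i) i k)}) =
    2 ^ L * (\<Prod>i<8. 1 - (1 - 1 / 2 ^ t i) ^ card (K i))"
proof -
  let ?N = "2 ^ n * n"
  define D where "D = (\<lambda>i. {l. length l = ?N \<and> (\<exists>k\<in>K i. \<forall>q<t i. l ! (k * n + q))})"
  have "take ?N (drop (i * ?N) l) \<in> D i \<longleftrightarrow> (\<exists>k\<in>K i. all_set n ((!) l) (t i) i k)"
    if l: "length l = L" "i < 8" for l i
  proof -
    have "(i + 1) * ?N \<le> 8 * ?N" using l by (intro mult_right_mono) auto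
    moreover have "(i + 1) * ?N = i * ?N + ?N" by simp
    ultimately have iN: "i * ?N + ?N \<le> length l" using l(1) L_def by linarith
    have "take ?N (drop (i * ?N) l) ! (k * n + q) = l ! ((i * 2 ^ n + k) * n + q)"
      if "k \<in> K i" "q < t i" for k q
    proof -
      have k: "k < 2 ^ n" using that K by auto
      have "(k + 1) * n \<le> 2 ^ n * n" using k by (intro mult_right_mono) auto
      moreover have "(k + 1) * n = k * n + n" by simp
      ultimately have "k * n + q < ?N" using that(2) t[of i] by linarith
      then have "take ?N (drop (i * ?N) l) ! (k * n + q) = l ! (i * ?N + (k * n + q))" using iN by simp
      also have "i * ?N + (k * n + q) = (i * 2 ^ n + k) * n + q" by (simp add: algebra_simps)
      finally show ?thesis .
    qed
    then show ?thesis using iN by (auto simp: D_def all_set_def)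
  qed
  then have "{l. length l = L \<and> (\<forall>i<8. \<exists>k\<in>K i. all_set n ((!) l) (t i) i k)} =
     {l. length l = 8 * ?N \<and> (\<forall>i<8. take ?N (drop (i * ?N) l) \<in> D i)}"
    unfolding L_def by blast
  also have "card \<dots> = (\<Prod>i<8. card (D i))" by (rule card_chunks) (auto simp: D_def)
  also have "real \<dots> = (\<Prod>i<8. 2 ^ ?N * (1 - (1 - 1 / 2 ^ t i) ^ card (K i)))"
    unfolding of_nat_prod D_def by (intro prod.cong refl card_exists_marked K t)
  also have "\<dots> = (2 ^ ?N) ^ 8 * (\<Prod>i<8. 1 - (1 - 1 / 2 ^ t i) ^ card (K i))"
    by (simp add: prod.distrib)
  also have "((2::real) ^ ?N) ^ 8 = 2 ^ L" by (simp add: L_def power_mult[symmetric] mult.commute)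
  finally show ?thesis .
qed

lemma sum_block_cards: "(\<Sum>i<(K::nat). card {q. q < n \<and> Q (i * n + q)}) = card {x. x < K * n \<and> Q x}"
proof (induction K)
  case (Suc K)
  have eq: "{x. x < Suc K * n \<and> Q x} = {x. x < K * n \<and> Q x} \<union> (\<lambda>q. K * n + q) ` {q. q < n \<and> Q (K * n + q)}"
  proof (intro equalityI subsetI)
    fix x assume x: "x \<in> {x. x < Suc K * n \<and> Q x}"
    show "x \<in> {x. x < K * n \<and> Q x} \<union> (\<lambda>q. K * n + q) ` {q. q < n \<and> Q (K * n + q)}"
    proof (cases "x < K * n")
      case False
      then have "x = K * n + (x - K * n)" "x - K * n < n" using x by auto
      then show ?thesis using x by (intro UnI2 image_eqI[of _ _ "x - K * n"]) auto
    qed (use x in simp)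
  qed auto
  have "card {x. x < Suc K * n \<and> Q x} =
      card {x. x < K * n \<and> Q x} + card ((\<lambda>q. K * n + q) ` {q. q < n \<and> Q (K * n + q)})"
    unfolding eq by (intro card_Un_disjoint) auto
  moreover have "card ((\<lambda>q. K * n + q) ` {q. q < n \<and> Q (K * n + q)}) = card {q. q < n \<and> Q (K * n + q)}"
    by (intro card_image) auto
  ultimately show ?case using Suc by simp
qed simp

text \<open>The word 0 codes the empty set. Putting it for \<open>YA\<close> or \<open>YB\<close>
  drops the corresponding condition, so the words that suit a single input set are separators as
  well, and one count serves all three cases.\<close>

definition separators :: "nat \<Rightarrow> nat \<Rightarrow> nat \<Rightarrow> nat \<Rightarrow> nat \<Rightarrow> nat set" where
  "separators n YA YB s i = {k. k < 2 ^ n \<and> card {q. q < n \<and> bit k q} = s \<and>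
     (\<forall>q<n. \<not> (bit YA (i * n + q) \<and> \<not> bit k q) \<and> \<not> (bit YB (i * n + q) \<and> bit k q))}"

lemma set_cand:
  assumes "digit (n + 1) g (2 * i) = s" "digit (n + 1) g (2 * i + 1) = t"
  shows "set (cand n V Y False g i) = {k \<in> separators n Y 0 s i. all_set n V t i k}"
    "set (cand n V Y True g i) = {k \<in> separators n 0 Y s i. all_set n V t i k}"
proof -
  have "t \<le> n" using assms(2) by (auto simp: digit_def less_Suc_eq_le[symmetric])
  then have "(\<forall>q<n. (q < t \<longrightarrow> V ((i * 2 ^ n + k) * n + q)) \<and> Q q) \<longleftrightarrow> all_set n V t i k \<and> (\<forall>q<n. Q q)" for k Q
    by (auto simp: all_set_def)
  then show "set (cand n V Y False g i) = {k \<in> separators n Y 0 s i. all_set n V t i k}"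
    "set (cand n V Y True g i) = {k \<in> separators n 0 Y s i. all_set n V t i k}"
    unfolding cand_def selected_def separators_def assms by auto
qed

lemma length_cand_eq: "length (cand n V Y fl g i) = card (set (cand n V Y fl g i))"
  by (rule distinct_card[symmetric]) (simp add: cand_def)

lemma card_separators:
  assumes "\<And>q. q < n \<Longrightarrow> \<not> (bit YA (i * n + q) \<and> bit YB (i * n + q))"
    "card {q. q < n \<and> bit YA (i * n + q)} \<le> s"
  shows "card (separators n YA YB s i) =
    (n - card {q. q < n \<and> bit YA (i * n + q)} - card {q. q < n \<and> bit YB (i * n + q)})
      choose (s - card {q. q < n \<and> bit YA (i * n + q)})"
proof -
  let ?A = "{q. q < n \<and> bit YA (i * n + q)}" and ?B = "{q. q < n \<and> bit YB (i * n + q)}"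
  have eq: "separators n YA YB s i = {k. k < 2 ^ n \<and>
    (\<lambda>S. card S = s \<and> ?A \<subseteq> S \<and> S \<inter> ?B = {}) {q. q < n \<and> bit k q}}"
    by (auto simp: separators_def)
  have "card (separators n YA YB s i) = card {S. S \<subseteq> {..<n} \<and> card S = s \<and> ?A \<subseteq> S \<and> S \<inter> ?B = {}}"
    unfolding eq by (rule card_words)
  also have "\<dots> = (n - card ?A - card ?B) choose (s - card ?A)"
    by (rule card_between) (use assms in auto)
  finally show ?thesis .
qed

text \<open>The bounds of \<open>binomial_le_power\<close> multiply to powers of the totals.
  Rounding the halves of \<open>h i\<close> in eight blocks costs at most 2^4, and the padding of
  the universe, of size 2f, costs at most (9/8)^4; 16 (9/8)^4 = 25.6 explains the constant
  26.\<close>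

lemma expected_bound:
  fixes N k h :: "nat \<Rightarrow> nat"
  assumes "\<And>i. i < 8 \<Longrightarrow> 2 * k i \<le> h i + 1" "sum N {..<8} = 3 * m + 2 * f" "sum h {..<8} = 2 * m + 2 * f" "f \<le> 4"
  shows "(\<Prod>i<8. real (N i choose k i) / 2 ^ h i) \<le> 26 * (27 / 16) ^ m"
proof -
  have "(\<Prod>i<8. real (N i choose k i) / 2 ^ h i) \<le> (\<Prod>i<8. 2 ^ k i * (3 / 2) ^ N i / 2 ^ h i)"
    by (intro prod_mono conjI divide_right_mono binomial_le_power) auto
  also have "\<dots> = 2 ^ sum k {..<8} * (3 / 2) ^ sum N {..<8} / 2 ^ sum h {..<8}"
    by (simp add: prod.distrib prod_dividef power_sum)
  also have "\<dots> \<le> 2 ^ (m + f + 4) * (3 / 2) ^ sum N {..<8} / 2 ^ sum h {..<8}"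
  proof -
    have "2 * sum k {..<8} = (\<Sum>i<8. 2 * k i)" by (rule sum_distrib_left)
    also have "\<dots> \<le> (\<Sum>i<8. h i + 1)" by (rule sum_mono) (use assms in auto)
    also have "\<dots> = 2 * m + 2 * f + 8" by (simp add: sum.distrib assms(3) del: One_nat_def)
    finally have "sum k {..<8} \<le> m + f + 4" by simp
    then show ?thesis by (intro divide_right_mono mult_right_mono power_increasing) auto
  qed
  also have "\<dots> = 2 ^ (m + f + 4) * (3 / 2) ^ (3 * m + 2 * f) / 2 ^ (2 * m + 2 * f)"
    by (simp only: assms)
  also have "\<dots> = 16 * (9 / 8) ^ f * (27 / 16) ^ m"
  proof -
    have e: "(2::real) ^ (m + f + 4) = 2 ^ m * 2 ^ f * 16" "(3 / 2 :: real) ^ (3 * m + 2 * f) = (27 / 8) ^ m * (9 / 4) ^ f"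
      "(2::real) ^ (2 * m + 2 * f) = 4 ^ m * 4 ^ f"
      by (simp_all add: power_add power_mult power_divide)
    have q: "(2::real) ^ m * (27 / 8) ^ m = (27 / 16) ^ m * 4 ^ m" "(2::real) ^ f * (9 / 4) ^ f = (9 / 8) ^ f * 4 ^ f"
      by (simp_all add: power_mult_distrib[symmetric])
    have "2 ^ (m + f + 4) * (3 / 2 :: real) ^ (3 * m + 2 * f) = 16 * (2 ^ m * (27 / 8) ^ m) * (2 ^ f * (9 / 4) ^ f)"
      unfolding e by (simp only: ac_simps)
    also have "\<dots> = (16 * (9 / 8) ^ f * (27 / 16) ^ m) * (4 ^ m * 4 ^ f)"
      unfolding q by (simp only: ac_simps)
    finally show ?thesis unfolding e(3) by simp
  qed
  also have "\<dots> \<le> 16 * (9 / 8) ^ 4 * (27 / 16) ^ m"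
    using assms(4) by (intro mult_right_mono mult_left_mono power_increasing) auto
  also have "\<dots> \<le> 26 * (27 / 16) ^ m"
    by (intro mult_right_mono) (auto simp: power_divide)
  finally show ?thesis .
qed

lemma markov_count:
  fixes f :: "'a \<Rightarrow> nat" and x :: nat and c :: real
  assumes "finite B" "(\<Sum>l\<in>B. real (f l)) \<le> E" "x > 0" "E \<le> x * c"
  shows "real (card {l \<in> B. x < f l}) \<le> c"
proof -
  have "real (card {l \<in> B. x < f l}) * x = (\<Sum>l\<in>{l \<in> B. x < f l}. real x)" by simp
  also have "\<dots> \<le> (\<Sum>l\<in>{l \<in> B. x < f l}. real (f l))" by (rule sum_mono) auto
  also have "\<dots> \<le> (\<Sum>l\<in>B. real (f l))" using assms(1) by (intro sum_mono2) auto
  also have "\<dots> \<le> c * x" using assms(2,4) by (simp add: mult.commute)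
  finally show ?thesis using assms(3) by simp
qed

text \<open>With y = 2^-h and K words, \<open>central_binomial_ge\<close> gives K y >= 1 / (n + 1),
  and then \<open>one_minus_power_le\<close> gives 1 - 1 / (1 + 1 / (n + 1)) = 1 / (n + 2).\<close>

lemma marked_prob_ge:
  assumes "h \<le> n"
  shows "1 - (1 - 1 / 2 ^ h) ^ (h choose (h div 2)) \<ge> 1 / (real n + 2)"
proof -
  let ?K = "h choose (h div 2)" and ?y = "1 / (2::real) ^ h"
  have "real (2 ^ h) \<le> real ((h + 1) * ?K)" using central_binomial_ge by (intro of_nat_mono)
  then have "1 / (real h + 1) \<le> ?K * ?y" by (simp add: field_simps)
  moreover have "1 / (real n + 1) \<le> 1 / (real h + 1)" using assms by (intro divide_left_mono) auto
  ultimately have Ky: "1 / (real n + 1) \<le> ?K * ?y" by linarith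
  have "(1 - ?y) ^ ?K \<le> 1 / (1 + ?K * ?y)" by (rule one_minus_power_le) auto
  also have "\<dots> \<le> 1 / (1 + 1 / (real n + 1))"
    using Ky by (intro divide_left_mono add_left_mono mult_pos_pos add_pos_nonneg) auto
  also have "\<dots> = 1 - 1 / (real n + 2)" by (simp add: field_simps)
  finally show ?thesis by simp
qed

text \<open>Let c = (n + 2)^8. Under the right guess a separator survives for a fraction of at least
  1/c of the coin lists. Each set exceeds its limit \<open>X\<close> for a fraction of at most
  1/(4c), by Markov's inequality. The events share coins, but a union bound is enough and leaves
  1/(2c).\<close>

lemma good_fraction:
  fixes YA YB n m X :: nat
  assumes n: "n = m div 2 + 1"
    and disj: "\<And>x. \<not> (bit YA x \<and> bit YB x)"
    and YA: "card {x. x < 8 * n \<and> bit YA x} = m" and YB: "card {x. x < 8 * n \<and> bit YB x} = m"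
    and X: "real X \<ge> 128 * (real n + 2) ^ 8 * (27 / 16) ^ m"
  defines "L \<equiv> 8 * (2 ^ n * n)"
  shows "\<exists>g<(n + 1) ^ 16. real (card {l. length l = L \<and> good n X ((!) l) YA YB g}) \<ge> 2 ^ L / (2 * (real n + 2) ^ 8)"
proof -
  define a where "a = (\<lambda>i. card {q. q < n \<and> bit YA (i * n + q)})"
  define b where "b = (\<lambda>i. card {q. q < n \<and> bit YB (i * n + q)})"
  define h where "h = (\<lambda>i. n - a i - b i)"
  \<comment> \<open>Splitting the \<open>h i\<close> free positions evenly makes the number of
    separators a central binomial coefficient.\<close>
  define s where "s = (\<lambda>i. a i + h i div 2)"
  have ab_fold: "card {q. q < n \<and> bit YA (i * n + q)} = a i" "card {q. q < n \<and> bit YB (i * n + q)} = b i" for i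
    by (simp_all add: a_def b_def)
  have ab: "a i + b i \<le> n" for i
  proof -
    have "a i + b i = card ({q. q < n \<and> bit YA (i * n + q)} \<union> {q. q < n \<and> bit YB (i * n + q)})"
      unfolding a_def b_def using disj by (intro card_Un_disjoint[symmetric]) auto
    also have "\<dots> \<le> card {..<n}" by (rule card_mono) auto
    finally show ?thesis by simp
  qed
  have hn: "h i + a i + b i = n" "h i \<le> n" "s i \<le> n" for i
    using ab[of i] unfolding s_def h_def by linarith+
  have suma: "sum a {..<8} = m" "sum b {..<8} = m"
    using sum_block_cards[of n "bit YA" 8] sum_block_cards[of n "bit YB" 8] YA YB by (simp_all add: a_def b_def)
  have sumh: "sum h {..<8} + 2 * m = 8 * n"
  proof -
    have "sum h {..<8} + sum a {..<8} + sum b {..<8} = (\<Sum>i<8. h i + a i + b i)" by (simp add: sum.distrib)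
    also have "\<dots> = 8 * n" using hn by simp
    finally show ?thesis using suma by simp
  qed
  \<comment> \<open>Half of the padding \<open>8 * n - 4 * m\<close>: it is 4 for even
    \<open>m\<close> and 2 for odd \<open>m\<close>.\<close>
  define f where "f = 4 * n - 2 * m"
  have f: "f \<le> 4" "4 * n = 2 * m + f" using n by (auto simp: f_def)
  have sumh': "sum h {..<8} = 2 * m + 2 * f" using sumh f(2) by simp
  have "(\<Sum>i<8. n - a i) + sum a {..<8} = 8 * n"
  proof -
    have "(\<Sum>i<8. n - a i) + sum a {..<8} = (\<Sum>i<8. n - a i + a i)" by (simp add: sum.distrib)
    also have "\<dots> = (\<Sum>i<8::nat. n)" using ab by (intro sum.cong) (auto intro: add_leD1 le_add_diff_inverse2)
    finally show ?thesis by simp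
  qed
  then have sumA: "(\<Sum>i<8. n - a i) = 3 * m + 2 * f" using suma f(2) by simp
  have "(\<Sum>i<8. n - b i) + sum b {..<8} = 8 * n"
  proof -
    have "(\<Sum>i<8. n - b i) + sum b {..<8} = (\<Sum>i<8. n - b i + b i)" by (simp add: sum.distrib)
    also have "\<dots> = (\<Sum>i<8::nat. n)" using ab by (intro sum.cong) (auto intro: add_leD2 le_add_diff_inverse2)
    finally show ?thesis by simp
  qed
  then have sumB: "(\<Sum>i<8. n - b i) = 3 * m + 2 * f" using suma f(2) by simp
  have "(if even e then s (e div 2) else h (e div 2)) < n + 1" for e using hn(2,3) by (simp add: less_Suc_eq_le)
  \<comment> \<open>The right guess carries the weights in its even digits and the numbers of coins
    in its odd ones.\<close>
  from mixed_radix_surj[of 16 "\<lambda>e. if even e then s (e div 2) else h (e div 2)" "\<lambda>_. n + 1", OF this]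
  obtain g where "g < (\<Prod>i<16::nat. n + 1)"
    "\<forall>e<16. g div (\<Prod>j<e. n + 1) mod (n + 1) = (if even e then s (e div 2) else h (e div 2))"
    by blast
  then have g: "g < (n + 1) ^ 16"
    "\<And>e. e < 16 \<Longrightarrow> digit (n + 1) g e = (if even e then s (e div 2) else h (e div 2))"
    unfolding digit_def prod_constant card_lessThan by blast+
  have dg: "digit (n + 1) g (2 * i) = s i" "digit (n + 1) g (2 * i + 1) = h i" if "i < 8" for i
    using g(2)[of "2 * i"] g(2)[of "2 * i + 1"] that by simp_all
  let ?TA = "\<lambda>i. separators n YA 0 (s i) i" and ?TB = "\<lambda>i. separators n 0 YB (s i) i"
    and ?K = "\<lambda>i. separators n YA YB (s i) i"
  have sub: "separators n U V z i \<subseteq> {..<2 ^ n}" for U V z i by (auto simp: separators_def)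
  have cTA: "card (?TA i) = (n - a i) choose (h i div 2)" for i
    using card_separators[of n YA i 0 "s i"] by (simp add: ab_fold s_def)
  have cTB: "card (?TB i) = (n - b i) choose (h i - h i div 2)" for i
  proof -
    have "card (?TB i) = (n - b i) choose s i"
      using card_separators[of n 0 i YB "s i"] by (simp add: ab_fold)
    \<comment> \<open>Passing to complements makes the lower index the rounded-up half of
      \<open>h i\<close>, as \<open>expected_bound\<close> requires; with \<open>s i\<close> itself,
      \<open>binomial_le_power\<close> would lose an exponential factor.\<close>
    also have "\<dots> = (n - b i) choose (n - b i - s i)"
      using hn(1)[of i] by (intro binomial_symmetric) (auto simp: s_def)
    also have "n - b i - s i = h i - h i div 2" using hn(1)[of i] by (auto simp: s_def)
    finally show ?thesis .
  qed
  have cK: "card (?K i) = h i choose (h i div 2)" for i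
    using card_separators[of n YA i YB "s i"] disj by (simp add: ab_fold h_def s_def)
  let ?BL = "{l :: bool list. length l = L}"
  have finBL: "finite ?BL" using finite_bool_lists[of L "\<lambda>_. True"] by simp
  let ?totA = "\<lambda>l. \<Prod>i<8. length (cand n ((!) l) YA False g i)"
  let ?totB = "\<lambda>l. \<Prod>i<8. length (cand n ((!) l) YB True g i)"
  have totA: "?totA l = (\<Prod>i<8. card {k \<in> ?TA i. all_set n ((!) l) (h i) i k})" for l
    by (rule prod.cong) (simp_all only: length_cand_eq set_cand[OF dg] lessThan_iff)
  have totB: "?totB l = (\<Prod>i<8. card {k \<in> ?TB i. all_set n ((!) l) (h i) i k})" for l
    by (rule prod.cong) (simp_all only: length_cand_eq set_cand[OF dg] lessThan_iff)
  define c where "c = (real n + 2) ^ 8"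
  have c: "c > 0" by (simp add: c_def)
  have X0: "X > 0"
  proof -
    have "0 < 128 * c * (27 / 16) ^ m" using c by simp
    with X show ?thesis unfolding c_def by linarith
  qed
  have bnd: "2 ^ L * (26 * (27 / 16) ^ m) \<le> real X * (2 ^ L / (4 * c))"
  proof -
    have "2 ^ L * (26 * (27 / 16) ^ m) \<le> 2 ^ L * (32 * (27 / 16 :: real) ^ m)" by (intro mult_left_mono mult_right_mono) auto
    also have "\<dots> = (128 * c * (27 / 16) ^ m) * (2 ^ L / (4 * c))" using c by simp
    also have "\<dots> \<le> real X * (2 ^ L / (4 * c))" using X c by (intro mult_right_mono) (auto simp: c_def)
    finally show ?thesis .
  qed
  have EA: "(\<Sum>l\<in>?BL. real (?totA l)) \<le> 2 ^ L * (26 * (27 / 16) ^ m)"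
    unfolding totA L_def sum_candidate_tuples[of ?TA n h, OF sub hn(2)] cTA
    by (intro mult_left_mono expected_bound[of _ _ _ _ f]) (use sumA sumh' f in auto)
  have EB: "(\<Sum>l\<in>?BL. real (?totB l)) \<le> 2 ^ L * (26 * (27 / 16) ^ m)"
    unfolding totB L_def sum_candidate_tuples[of ?TB n h, OF sub hn(2)] cTB
    by (intro mult_left_mono expected_bound[of _ _ _ _ f]) (use sumB sumh' f in auto)
  have bA: "real (card {l \<in> ?BL. X < ?totA l}) \<le> 2 ^ L / (4 * c)"
    by (rule markov_count[OF finBL EA X0 bnd])
  have bB: "real (card {l \<in> ?BL. X < ?totB l}) \<le> 2 ^ L / (4 * c)"
    by (rule markov_count[OF finBL EB X0 bnd])
  let ?Ex = "{l. length l = L \<and> (\<forall>i<8. \<exists>k\<in>?K i. all_set n ((!) l) (h i) i k)}"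
  have "2 ^ L / c = 2 ^ L * (\<Prod>i<8::nat. 1 / (real n + 2))" by (simp add: c_def power_inverse divide_inverse)
  also have "\<dots> \<le> 2 ^ L * (\<Prod>i<8. 1 - (1 - 1 / 2 ^ h i) ^ card (?K i))"
    unfolding cK using hn(2) by (intro mult_left_mono prod_mono conjI marked_prob_ge) auto
  also have "\<dots> = real (card ?Ex)"
    unfolding L_def by (rule card_exists_tuple[of ?K n h, OF sub hn(2), symmetric])
  finally have Ex: "2 ^ L / c \<le> real (card ?Ex)" .
  let ?G = "{l. length l = L \<and> good n X ((!) l) YA YB g}"
  have "?Ex \<subseteq> ?G \<union> ({l \<in> ?BL. X < ?totA l} \<union> {l \<in> ?BL. X < ?totB l})"
  proof
    fix l assume l: "l \<in> ?Ex"
    then obtain \<kappa> where \<kappa>: "\<forall>i<8. \<kappa> i \<in> ?K i \<and> all_set n ((!) l) (h i) i (\<kappa> i)" by simp metis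
    have "\<kappa> i \<in> set (cand n ((!) l) YA False g i) \<inter> set (cand n ((!) l) YB True g i)" if "i < 8" for i
      using \<kappa> that unfolding set_cand[OF dg[OF that]] by (auto simp: separators_def)
    then have "\<exists>\<kappa>. \<forall>i<8. \<kappa> i \<in> set (cand n ((!) l) YA False g i) \<inter> set (cand n ((!) l) YB True g i)" by blast
    then show "l \<in> ?G \<union> ({l \<in> ?BL. X < ?totA l} \<union> {l \<in> ?BL. X < ?totB l})"
      using l by (auto simp: good_def not_less)
  qed
  then have "card ?Ex \<le> card (?G \<union> ({l \<in> ?BL. X < ?totA l} \<union> {l \<in> ?BL. X < ?totB l}))"
    by (intro card_mono) (auto simp: finite_bool_lists)
  also have "\<dots> \<le> card ?G + (card {l \<in> ?BL. X < ?totA l} + card {l \<in> ?BL. X < ?totB l})"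
    by (meson add_left_mono card_Un_le order_trans)
  finally have "2 ^ L / c \<le> real (card ?G) + (2 ^ L / (4 * c) + 2 ^ L / (4 * c))"
    using Ex bA bB by linarith
  moreover have "2 ^ L / c = 4 * (2 ^ L / (4 * c))" "2 ^ L / (2 * c) = 2 * (2 ^ L / (4 * c))" by simp_all
  ultimately have "2 ^ L / (2 * c) \<le> real (card ?G)" by linarith
  then show ?thesis using g(1) unfolding c_def by blast
qed

text \<open>Every coin list of length \<open>n\<close> has mass 2^-n, and all other lists have mass
  0. This links \<open>monte_carlo\<close> to the counting lemmas.\<close>

lemma prob_coins:
  "measure_pmf.prob (replicate_pmf n (bernoulli_pmf (1/2))) A = card {cs \<in> A. length cs = n} / 2 ^ n"
proof -
  have pmf: "pmf (replicate_pmf n (bernoulli_pmf (1/2))) cs = (if length cs = n then 1 / 2 ^ n else 0)" for cs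
  proof (induction n arbitrary: cs)
    case (Suc n)
    show ?case
    proof (cases cs)
      case Nil
      have "pmf (replicate_pmf (Suc n) (bernoulli_pmf (1/2))) [] = 0"
        by (simp only: pmf_eq_0_set_pmf set_replicate_pmf) simp
      then show ?thesis using Nil by (simp del: replicate_pmf.simps)
    next
      case (Cons c cs')
      have "replicate_pmf (Suc n) (bernoulli_pmf (1/2)) =
          map_pmf (\<lambda>(x, xs). x # xs) (pair_pmf (bernoulli_pmf (1/2)) (replicate_pmf n (bernoulli_pmf (1/2))))"
        by (simp add: map_pmf_def pair_pmf_def bind_assoc_pmf bind_return_pmf)
      moreover have "inj (\<lambda>(x, xs). x # xs :: bool list)" by (auto simp: inj_on_def)
      ultimately have "pmf (replicate_pmf (Suc n) (bernoulli_pmf (1/2))) cs =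
          pmf (pair_pmf (bernoulli_pmf (1/2)) (replicate_pmf n (bernoulli_pmf (1/2)))) (c, cs')"
        using pmf_map_inj'[of "\<lambda>(x, xs). x # xs" _ "(c, cs')"] Cons by simp
      also have "\<dots> = 1 / 2 * pmf (replicate_pmf n (bernoulli_pmf (1/2))) cs'"
        unfolding pmf_pair by (cases c) simp_all
      finally show ?thesis using Cons by (auto simp: Suc field_simps simp del: replicate_pmf.simps split: if_splits)
    qed
  qed (simp add: pmf_return indicator_def)
  have "measure_pmf.prob (replicate_pmf n (bernoulli_pmf (1/2))) A =
      measure_pmf.prob (replicate_pmf n (bernoulli_pmf (1/2))) {cs \<in> A. length cs = n}"
    by (subst (1 2) measure_Int_set_pmf[symmetric], rule arg_cong[where f = "measure_pmf.prob _"])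
      (auto simp: set_replicate_pmf)
  also have "\<dots> = (\<Sum>cs\<in>{cs \<in> A. length cs = n}. pmf (replicate_pmf n (bernoulli_pmf (1/2))) cs)"
    using finite_bool_lists[of n "\<lambda>cs. cs \<in> A"] by (intro measure_measure_pmf_finite) (simp add: conj_commute)
  also have "\<dots> = card {cs \<in> A. length cs = n} / 2 ^ n" by (simp add: pmf)
  finally show ?thesis .
qed

section \<open>Resource bounds\<close>

lemma cand_cong:
  assumes "\<And>x. x < 8 * (2 ^ n * n) \<Longrightarrow> V x = V' x" "i < 8"
  shows "cand n V Y fl g i = cand n V' Y fl g i"
  unfolding cand_def selected_def
proof (rule filter_cong[OF refl])
  fix k assume "k \<in> set [0..<2 ^ n]"
  then have "V ((i * 2 ^ n + k) * n + q) = V' ((i * 2 ^ n + k) * n + q)" if "q < n" for q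
    using assms(1) block_index_less[OF assms(2)] that by simp
  then show "(card {q. q < n \<and> bit k q} = digit (n + 1) g (2 * i) \<and>
      (\<forall>q<n. (q < digit (n + 1) g (2 * i + 1) \<longrightarrow> V ((i * 2 ^ n + k) * n + q)) \<and>
        \<not> (bit Y (i * n + q) \<and> bit k q = fl))) =
    (card {q. q < n \<and> bit k q} = digit (n + 1) g (2 * i) \<and>
      (\<forall>q<n. (q < digit (n + 1) g (2 * i + 1) \<longrightarrow> V' ((i * 2 ^ n + k) * n + q)) \<and>
        \<not> (bit Y (i * n + q) \<and> bit k q = fl)))"
    by auto
qed

text \<open>Allows a coin list of one repetition to be replaced by \<open>rep_bits\<close>, which
  agrees with it only within the chunk.\<close>

lemma good_cong:
  assumes "\<And>x. x < 8 * (2 ^ n * n) \<Longrightarrow> V x = V' x"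
  shows "good n X V YA YB g = good n X V' YA YB g"
proof -
  have "cand n V Y fl g i = cand n V' Y fl g i" if "i < 8" for Y fl i
    using cand_cong[of n V V', OF assms that] .
  then show ?thesis by (simp add: good_def)
qed

text \<open>By independence all \<open>R\<close> chunks fail for a fraction of at most (1 - y)^R,
  and this is at most 1 / (1 + R y) = 1/3.\<close>

lemma card_some_chunk:
  assumes "\<And>l. l \<in> G \<Longrightarrow> length l = L" "real (card G) \<ge> 2 ^ L * y" "0 \<le> y" "y \<le> 1" "real R * y = 2"
  shows "real (card {cs :: bool list. length cs = R * L \<and> (\<exists>r<R. take L (drop (r * L) cs) \<in> G)}) \<ge> 2 / 3 * 2 ^ (R * L)"
proof -
  let ?U = "{l :: bool list. length l = L}" and ?C = "{l :: bool list. length l = R * L}"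
  let ?N = "{cs :: bool list. length cs = R * L \<and> (\<forall>r<R. take L (drop (r * L) cs) \<in> ?U - G)}"
  have finU: "finite ?U" "finite ?C" using finite_bool_lists[of _ "\<lambda>_. True"] by simp_all
  have GU: "G \<subseteq> ?U" using assms(1) by auto
  have "card (?U - G) = card ?U - card G" using GU finU by (meson card_Diff_subset finite_subset)
  moreover have "card G \<le> card ?U" using GU finU by (intro card_mono)
  ultimately have UG: "real (card (?U - G)) \<le> 2 ^ L * (1 - y)"
    using assms(2) by (simp add: card_bool_lists of_nat_diff right_diff_distrib)
  have "card ?N = card (?U - G) ^ R" by (subst card_chunks) auto
  then have "real (card ?N) \<le> (2 ^ L * (1 - y)) ^ R"
    using UG by (simp add: power_mono)
  also have "\<dots> = 2 ^ (R * L) * (1 - y) ^ R" by (simp add: power_mult_distrib power_mult[symmetric] mult.commute)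
  also have "\<dots> \<le> 2 ^ (R * L) * (1 / (1 + real R * y))"
    using assms by (intro mult_left_mono one_minus_power_le) auto
  also have "\<dots> = 2 ^ (R * L) / 3" using assms by simp
  finally have N: "real (card ?N) \<le> 2 ^ (R * L) / 3" .
  have "take L (drop (r * L) cs) \<in> ?U" if "length cs = R * L" "r < R" for cs :: "bool list" and r
  proof -
    have "Suc r * L \<le> R * L" using that by (intro mult_right_mono) auto
    then show ?thesis using that by simp
  qed
  then have "{cs. length cs = R * L \<and> (\<exists>r<R. take L (drop (r * L) cs) \<in> G)} = ?C - ?N" by blast
  moreover have "card (?C - ?N) = card ?C - card ?N"
    using finU by (intro card_Diff_subset) (auto intro: finite_subset)
  moreover have "card ?N \<le> card ?C" using finU by (intro card_mono) auto
  ultimately show ?thesis using N by (simp add: card_bool_lists of_nat_diff)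
qed

text \<open>The term k = m of (1/4 + 3/4)^(4m) = 1 gives C(4m, m) <= (256/27)^m, and 2^d =
  16^m.\<close>

lemma binomial_quarter_le:
  assumes "d = 4 * m"
  shows "(27 / 16) ^ m \<le> 2 ^ d / real (d choose m)"
proof -
  have "(\<Sum>k\<le>4 * m. of_nat (4 * m choose k) * (1 / 4) ^ k * (3 / 4 :: real) ^ (4 * m - k)) = (1 / 4 + 3 / 4) ^ (4 * m)"
    by (rule binomial_ring[symmetric])
  moreover have "of_nat (4 * m choose m) * (1 / 4) ^ m * (3 / 4 :: real) ^ (4 * m - m) \<le>
      (\<Sum>k\<le>4 * m. of_nat (4 * m choose k) * (1 / 4) ^ k * (3 / 4 :: real) ^ (4 * m - k))"
    by (intro member_le_sum[where f = "\<lambda>k. of_nat (4 * m choose k) * (1 / 4) ^ k * (3 / 4 :: real) ^ (4 * m - k)"]) auto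
  ultimately have "real (4 * m choose m) * ((1 / 4) ^ m * (3 / 4) ^ (3 * m)) \<le> 1" by simp
  moreover have "(1 / 4 :: real) ^ m * (3 / 4) ^ (3 * m) = (27 / 256) ^ m"
    by (simp add: power_mult power_mult_distrib[symmetric] power3_eq_cube)
  ultimately have "real (4 * m choose m) * (27 / 256) ^ m \<le> 1" by simp
  then have "16 ^ m * (real (4 * m choose m) * (27 / 256) ^ m) \<le> 16 ^ m * 1" by (intro mult_left_mono) auto
  moreover have "(27 / 16 :: real) ^ m = 16 ^ m * (27 / 256) ^ m" by (simp add: power_mult_distrib[symmetric])
  then have "(27 / 16) ^ m * real (4 * m choose m) = 16 ^ m * (real (4 * m choose m) * (27 / 256) ^ m)"
    by (simp only: ac_simps)
  ultimately have "(27 / 16) ^ m * real (4 * m choose m) \<le> 16 ^ m" by linarith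
  moreover have "0 < real (4 * m choose m)" by simp
  ultimately have "(27 / 16) ^ m \<le> 16 ^ m / real (4 * m choose m)" by (simp only: pos_le_divide_eq)
  moreover have "(2::real) ^ d = 16 ^ m" by (simp add: assms power_mult)
  ultimately show ?thesis using assms by simp
qed

lemma set_word_less:
  assumes "A \<subseteq> {1..d}"
  shows "set_word A < 2 ^ d"
proof -
  have "take_bit d (set_word A) = set_word A"
    by (rule bit_eqI) (use assms in \<open>auto simp: bit_take_bit_iff bit_set_word\<close>)
  then show ?thesis using take_bit_nat_less_exp[of d "set_word A"] by simp
qed

lemma card_bits_set_word:
  assumes "A \<in> nsets {1..d} m" "d \<le> D"
  shows "card {x. x < D \<and> bit (set_word A) x} = m"
proof -
  have A: "A \<subseteq> {1..d}" "card A = m" using assms(1) by (auto simp: nsets_def)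
  have "bij_betw Suc {x. x < D \<and> bit (set_word A) x} A"
    unfolding bij_betw_def
  proof
    show "Suc ` {x. x < D \<and> bit (set_word A) x} = A"
    proof (intro equalityI subsetI)
      fix a assume a: "a \<in> A"
      then have "a = Suc (a - 1)" "a - 1 < D" using A assms(2) by force+
      then show "a \<in> Suc ` {x. x < D \<and> bit (set_word A) x}"
        using a by (intro image_eqI[of _ _ "a - 1"]) (auto simp: bit_set_word[OF A(1)])
    qed (auto simp: bit_set_word[OF A(1)])
  qed simp
  then show ?thesis using A(2) bij_betw_same_card by blast
qed

section \<open>Word size, time and space\<close>

lemma pow_mult_le: "x \<le> (2::nat) ^ (a * e) \<Longrightarrow> y \<le> 2 ^ (b * e) \<Longrightarrow> x * y \<le> 2 ^ ((a + b) * e)"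
  using mult_le_mono[of x "2 ^ (a * e)" y "2 ^ (b * e)"] by (simp add: power_add distrib_right)

lemma pow_weaken: "x \<le> (2::nat) ^ (a * e) \<Longrightarrow> a \<le> b \<Longrightarrow> x \<le> 2 ^ (b * e)"
  using power_increasing[of "a * e" "b * e" "2::nat"] by (meson mult_right_mono le0 order_trans one_le_numeral)

text \<open>Each quantity is bounded by some 2^(c e) with e = d + 1, and \<open>pow_mult_le\<close>
  adds up the numbers c. The largest one is 51, for the number of iterations; 60 in place of 59
  makes the inequalities strict. Since \<open>floorlog 2 N\<close> is at least 1, the word size is
  at least 60 e, also for d = 0.\<close>

lemma word_size_bounds:
  fixes d m n nn N :: nat
  assumes n: "n = d div 8 + 1" and m: "m = d div 4" and N: "N \<ge> 1" and nn: "nn \<le> 2 * 2 ^ d"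
  defines "w \<equiv> 60 * (d + floorlog 2 N)"
    and "R \<equiv> 4 * (n + 2) ^ 8"
    and "X \<equiv> 128 * (n + 2) ^ 8 * (27 ^ m div 2 ^ (4 * m) + 1)"
  shows "3 + nn + R * (8 * 2 ^ n * n) + 8 * 2 ^ n + 8 + 2 ^ (8 * n) < 2 ^ w" "X < 2 ^ w"
    "R * nn * (n + 1) ^ 16 < 2 ^ w" "27 ^ m < (2::nat) ^ w" "2 ^ d < (2::nat) ^ w" "128 < (2::nat) ^ w"
proof -
  define e where "e = d + 1"
  have e1: "e \<ge> 1" by (simp add: e_def)
  have "floorlog 2 N \<noteq> 0" using N by (simp add: floorlog_def)
  then have "60 * e \<le> w" unfolding w_def e_def by simp
  then have w: "(2::nat) ^ (60 * e) \<le> 2 ^ w" by (intro power_increasing) auto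
  have lt: "x < 2 ^ w" if "x \<le> 2 ^ (59 * e)" for x :: nat
  proof -
    have "(2::nat) ^ (59 * e) < 2 ^ (60 * e)" using e1 by (intro power_strict_increasing) auto
    with that w show ?thesis by linarith
  qed
  have lt': "x < 2 ^ w" if "x \<le> 2 ^ (a * e)" "a \<le> 59" for x a :: nat
    using lt[OF pow_weaken[OF that]] .
  have ne: "n \<le> e" using n by (simp add: e_def)
  have pe: "(2::nat) ^ a \<le> 2 ^ (a * e)" for a using e1 by (intro power_increasing) auto
  have P: "(2::nat) ^ n \<le> 2 ^ (1 * e)" using ne by (intro power_increasing) auto
  have nP: "n \<le> 2 ^ (1 * e)" using P less_exp[of n] by linarith
  have n2: "n + 2 \<le> 2 ^ (2 * e)"
  proof -
    have "n + 2 \<le> 2 * 2 ^ n" using less_exp[of n] n by (cases n) auto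
    also have "\<dots> \<le> 2 ^ ((1 + 1) * e)" using pow_mult_le[OF pe[of 1] P] by simp
    finally show ?thesis by (simp add: mult_2)
  qed
  have pw: "x ^ k \<le> 2 ^ ((a * k) * e)" if "x \<le> 2 ^ (a * e)" for x a k :: nat
    using power_mono[OF that, of k] by (simp add: power_mult[symmetric] ac_simps)
  have z8: "(n + 2) ^ 8 \<le> 2 ^ (16 * e)" using pw[OF n2, of 8] by simp
  have R: "R \<le> 2 ^ (18 * e)" unfolding R_def using pow_mult_le[OF pe[of 2] z8] by simp
  have P8: "8 * 2 ^ n \<le> (2::nat) ^ (4 * e)" using pow_mult_le[OF pe[of 3] P] by simp
  have NB: "R * (8 * 2 ^ n * n) \<le> 2 ^ (23 * e)"
    using pow_mult_le[OF R pow_mult_le[OF P8 nP]] by simp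
  have nn': "nn \<le> 2 ^ (1 * e)" using nn by (simp add: e_def)
  have n8: "(2::nat) ^ (8 * n) \<le> 2 ^ (8 * e)" using n ne by (intro power_increasing) auto
  have "3 \<le> (2::nat) ^ (23 * e)" using pow_weaken[OF pe[of 2], of 23] by simp
  moreover have "8 \<le> (2::nat) ^ (23 * e)" using pow_weaken[OF pe[of 3], of 23] by simp
  moreover have "nn \<le> 2 ^ (23 * e)" "8 * 2 ^ n \<le> (2::nat) ^ (23 * e)" "(2::nat) ^ (8 * n) \<le> 2 ^ (23 * e)"
    using pow_weaken[OF nn'] pow_weaken[OF P8] pow_weaken[OF n8] by simp_all
  ultimately have "3 + nn + R * (8 * 2 ^ n * n) + 8 * 2 ^ n + 8 + 2 ^ (8 * n) \<le> 8 * 2 ^ (23 * e)"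
    using NB by linarith
  also have "\<dots> \<le> 2 ^ (26 * e)" using pow_mult_le[OF pe[of 3], of "2 ^ (23 * e)" 23] by simp
  finally show "3 + nn + R * (8 * 2 ^ n * n) + 8 * 2 ^ n + 8 + 2 ^ (8 * n) < 2 ^ w" by (rule lt') simp
  have m27: "(27::nat) ^ m \<le> 2 ^ (5 * e)"
  proof -
    have "(27::nat) ^ m \<le> (2 ^ 5) ^ m" by (intro power_mono) auto
    also have "\<dots> \<le> 2 ^ (5 * e)" unfolding power_mult[symmetric] by (intro power_increasing) (auto simp: m e_def)
    finally show ?thesis .
  qed
  then show "27 ^ m < (2::nat) ^ w" by (rule lt') simp
  have "27 ^ m div 2 ^ (4 * m) \<le> (27::nat) ^ m" by (rule div_le_dividend)
  moreover have "1 \<le> (27::nat) ^ m" by simp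
  ultimately have "27 ^ m div 2 ^ (4 * m) + 1 \<le> 2 * (27::nat) ^ m" by linarith
  also have "\<dots> \<le> 2 ^ (6 * e)" using pow_mult_le[OF pe[of 1] m27] by simp
  finally have XX: "27 ^ m div 2 ^ (4 * m) + 1 \<le> (2::nat) ^ (6 * e)" .
  have "X \<le> 2 ^ ((7 + 16 + 6) * e)"
    unfolding X_def by (rule pow_mult_le[OF pow_mult_le[OF _ z8] XX]) (use pe[of 7] in simp)
  then show "X < 2 ^ w" by (rule lt') simp
  have n1: "n + 1 \<le> 2 ^ (2 * e)" using n2 by linarith
  have "R * nn * (n + 1) ^ 16 \<le> 2 ^ (51 * e)"
    using pow_mult_le[OF pow_mult_le[OF R nn'] pw[OF n1, of 16]] by simp
  then show "R * nn * (n + 1) ^ 16 < 2 ^ w" by (rule lt') simp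
  have "(2::nat) ^ d \<le> 2 ^ (1 * e)" by (intro power_increasing) (auto simp: e_def)
  then show "2 ^ d < (2::nat) ^ w" by (rule lt') simp
  show "128 < (2::nat) ^ w" using pe[of 7] by (intro lt'[of _ 7]) auto
qed

text \<open>Everything is measured in z = n + 2 and in the power of 27/16 called
  \<open>\<rho>\<close>. The exponent 32 = 8 + 16 + 8 collects the repetitions, the guesses and the
  polynomial factor of \<open>X\<close>; z <= 2 Z accounts for 2^32.\<close>

lemma time_space_bounds:
  fixes d m n nn N :: nat
  assumes d: "d = 4 * m" and n: "n = d div 8 + 1" and N: "N \<ge> 1" and nn: "nn \<le> 2 * N"
  defines "R \<equiv> 4 * (n + 2) ^ 8"
    and "X \<equiv> 128 * (n + 2) ^ 8 * (27 ^ m div 2 ^ (4 * m) + 1)"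
    and "Z \<equiv> real d + log 2 (real N) + 2"
  shows "real (R * nn * (n + 1) ^ 16 * (8 * (2 ^ n * (56 * n + 39)) + 302 * X + 446) + R * (8 * 2 ^ n * n) * 14 + 12 * m + 500)
      \<le> 10 ^ 6 * 2 ^ 32 * Z ^ 32 * (real N * 2 ^ d / real (d choose m))" (is "?T \<le> _")
    "real (3 + nn + R * (8 * 2 ^ n * n) + 8 * 2 ^ n + 8 + 2 ^ (8 * n)) \<le> 10 ^ 6 * 2 ^ 32 * Z ^ 32 * (real N + 2 ^ d)" (is "?M \<le> _")
proof -
  define z where "z = real n + 2"
  define \<rho> where "\<rho> = (27 / 16 :: real) ^ m"
  have z1: "z \<ge> 1" by (simp add: z_def)
  have \<rho>1: "\<rho> \<ge> 1" by (simp add: \<rho>_def one_le_power)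
  have zz: "z ^ i \<le> z ^ 32" if "i \<le> 32" for i using z1 that by (intro power_increasing) auto
  have zZ: "z \<le> 2 * Z"
  proof -
    have "0 \<le> log 2 (real N)" using N by (simp add: zero_le_log_cancel_iff)
    moreover have "real n \<le> real d + 1" using n by simp
    ultimately show ?thesis by (simp add: z_def Z_def)
  qed
  have z32: "z ^ 32 \<le> 2 ^ 32 * Z ^ 32"
    using power_mono[OF zZ, of 32] z1 by (simp add: power_mult_distrib)
  have rR: "real R = 4 * z ^ 8" by (simp add: R_def z_def add.commute)
  have "real (27 ^ m div 2 ^ (4 * m)) \<le> real (27 ^ m) / real (2 ^ (4 * m))" by (rule of_nat_div_le_of_nat)
  also have "\<dots> = \<rho>" by (simp add: \<rho>_def power_divide power_mult)
  finally have dv: "real (27 ^ m div 2 ^ (4 * m) + 1) \<le> 2 * \<rho>" using \<rho>1 by simp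
  have "real X = 128 * z ^ 8 * real (27 ^ m div 2 ^ (4 * m) + 1)" by (simp add: X_def z_def add.commute distrib_left)
  also have "\<dots> \<le> 128 * z ^ 8 * (2 * \<rho>)" using z1 dv by (intro mult_left_mono) auto
  finally have rX: "real X \<le> 256 * (z ^ 8 * \<rho>)" by simp
  \<comment> \<open>Squaring avoids a square root of 2: the comparison becomes 2 <=
    (27/16)^2.\<close>
  have P: "(2::real) ^ n \<le> 2 * \<rho>"
  proof -
    have "((2::real) ^ (m div 2)) ^ 2 \<le> 2 ^ m" unfolding power_mult[symmetric] by (intro power_increasing) auto
    also have "\<dots> \<le> ((27 / 16) ^ 2) ^ m" by (intro power_mono) (auto simp: power2_eq_square)
    also have "\<dots> = \<rho> ^ 2" by (simp add: \<rho>_def power_mult[symmetric] mult.commute)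
    finally have "(2::real) ^ (m div 2) \<le> \<rho>" by (rule power2_le_imp_le) (use \<rho>1 in simp)
    moreover have "n = m div 2 + 1" using n d by simp
    ultimately show ?thesis by simp
  qed
  have z8: "1 \<le> z ^ 8" "z \<le> z ^ 8" using z1 by (auto intro: one_le_power self_le_power)
  have "2 ^ n * (56 * real n + 39) \<le> (2 * \<rho>) * (56 * z ^ 8)"
    using P z8 \<rho>1 by (intro mult_mono) (auto simp: z_def)
  moreover have "1 * 1 \<le> z ^ 8 * \<rho>" using z8 \<rho>1 by (intro mult_mono) auto
  \<comment> \<open>The coefficients add up to 8 * 112 + 302 * 256 + 446 = 78654.\<close>
  ultimately have inner: "8 * (2 ^ n * (56 * real n + 39)) + 302 * real X + 446 \<le> 80000 * (z ^ 8 * \<rho>)"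
    using rX by (simp add: ac_simps)
  have IT: "real R * real nn * (real n + 1) ^ 16 \<le> 8 * real N * z ^ 24"
  proof -
    have "real R * real nn * (real n + 1) ^ 16 \<le> (4 * z ^ 8) * (2 * real N) * z ^ 16"
      unfolding rR using nn z1 by (intro mult_mono power_mono) (auto simp: z_def)
    also have "\<dots> = 8 * real N * (z ^ 8 * z ^ 16)" by simp
    finally show ?thesis by (simp only: power_add[symmetric]) simp
  qed
  have "real R * real nn * (real n + 1) ^ 16 * (8 * (2 ^ n * (56 * real n + 39)) + 302 * real X + 446) \<le>
      (8 * real N * z ^ 24) * (80000 * (z ^ 8 * \<rho>))"
    by (rule mult_mono[OF IT inner]) (use z1 in auto)
  also have "\<dots> = 640000 * (z ^ 24 * z ^ 8 * (real N * \<rho>))" by simp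
  finally have t1: "real R * real nn * (real n + 1) ^ 16 * (8 * (2 ^ n * (56 * real n + 39)) + 302 * real X + 446) \<le>
      640000 * (z ^ 32 * (real N * \<rho>))" by (simp only: power_add[symmetric]) simp
  have NB: "real R * (8 * 2 ^ n * real n) \<le> 32 * z ^ 32 * 2 ^ n"
  proof -
    have "real R * (8 * 2 ^ n * real n) \<le> 4 * z ^ 8 * (8 * 2 ^ n * z)"
      unfolding rR using z1 by (intro mult_left_mono) (auto simp: z_def)
    also have "\<dots> = 32 * z ^ 9 * 2 ^ n" by (simp add: eval_nat_numeral)
    also have "\<dots> \<le> 32 * z ^ 32 * 2 ^ n" using zz[of 9] by simp
    finally show ?thesis .
  qed
  also have "\<dots> \<le> 32 * z ^ 32 * (2 * (real N * \<rho>))"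
  proof -
    have "1 * \<rho> \<le> real N * \<rho>" using N \<rho>1 by (intro mult_right_mono) auto
    then show ?thesis using P z1 by (intro mult_left_mono) auto
  qed
  finally have t2: "real R * (8 * 2 ^ n * real n) * 14 \<le> 896 * (z ^ 32 * (real N * \<rho>))" by simp
  have "m \<le> 2 * n" using n d by simp
  then have "12 * real m + 500 \<le> 524 * z" by (simp add: z_def)
  also have "\<dots> \<le> 524 * (z ^ 32 * (real N * \<rho>))"
  proof -
    have "z * (1 * 1) \<le> z ^ 32 * (real N * \<rho>)"
      using zz[of 1] z1 \<rho>1 N by (intro mult_mono) auto
    then show ?thesis by simp
  qed
  finally have t3: "12 * real m + 500 \<le> 524 * (z ^ 32 * (real N * \<rho>))" .
  have "?T = real R * real nn * (real n + 1) ^ 16 * (8 * (2 ^ n * (56 * real n + 39)) + 302 * real X + 446) +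
      real R * (8 * 2 ^ n * real n) * 14 + (12 * real m + 500)"
    by (simp add: add.commute)
  also have "\<dots> \<le> 640000 * (z ^ 32 * (real N * \<rho>)) + 896 * (z ^ 32 * (real N * \<rho>)) + 524 * (z ^ 32 * (real N * \<rho>))"
    by (intro add_mono t1 t2 t3)
  also have "\<dots> \<le> 10 ^ 6 * (z ^ 32 * (real N * \<rho>))" using z1 \<rho>1 by simp
  also have "\<dots> \<le> 10 ^ 6 * ((2 ^ 32 * Z ^ 32) * (real N * (2 ^ d / real (d choose m))))"
    using z32 z1 \<rho>1 binomial_quarter_le[OF d] unfolding \<rho>_def[symmetric]
    by (intro mult_left_mono mult_mono) auto
  finally show "?T \<le> 10 ^ 6 * 2 ^ 32 * Z ^ 32 * (real N * 2 ^ d / real (d choose m))" by simp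
  have Pd: "(2::real) ^ n \<le> 2 ^ (d + 1)" "(2::real) ^ (8 * n) \<le> 2 ^ (d + 8)"
    using n by (intro power_increasing; simp)+
  define S where "S = z ^ 32 * (real N + 2 ^ d)"
  have "1 * (real N + 2 ^ d) \<le> S" unfolding S_def using zz[of 0] by (intro mult_right_mono) auto
  then have zS: "real N + 2 ^ d \<le> S" by simp
  have zS2: "z ^ 32 * 2 ^ d \<le> S" unfolding S_def using z1 by (intro mult_left_mono) auto
  have "32 * z ^ 32 * 2 ^ n \<le> 32 * z ^ 32 * 2 ^ (d + 1)" using Pd z1 by (intro mult_left_mono) auto
  have NB': "real R * (8 * 2 ^ n * real n) \<le> 64 * S" 
  proof -
    have "32 * z ^ 32 * 2 ^ (d + 1) = 64 * (z ^ 32 * 2 ^ d)" by simp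
    with NB \<open>32 * z ^ 32 * 2 ^ n \<le> 32 * z ^ 32 * 2 ^ (d + 1)\<close> zS2 show ?thesis by linarith
  qed
  have "?M = 11 + real nn + real R * (8 * 2 ^ n * real n) + 8 * 2 ^ n + 2 ^ (8 * n)" by simp
  also have "\<dots> \<le> 11 * S + 2 * S + 64 * S + 16 * S + 256 * S"
  proof (intro add_mono NB')
    have "(1::real) \<le> 2 ^ d" by simp
    moreover have "0 \<le> real N" by simp
    ultimately show "11 \<le> 11 * S" using zS by linarith
    show "real nn \<le> 2 * S" using nn zS \<open>(1::real) \<le> 2 ^ d\<close> by linarith
    have "(2::real) ^ (d + 1) = 2 * 2 ^ d" "(2::real) ^ (d + 8) = 256 * 2 ^ d" by (simp_all add: power_add)
    then show "8 * 2 ^ n \<le> 16 * S" "2 ^ (8 * n) \<le> 256 * S"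
      using Pd zS of_nat_0_le_iff[of N, where 'a = real] by linarith+
  qed
  also have "\<dots> \<le> 10 ^ 6 * S" using z1 by (simp add: S_def)
  also have "\<dots> \<le> 10 ^ 6 * ((2 ^ 32 * Z ^ 32) * (real N + 2 ^ d))"
    unfolding S_def using z32 by (intro mult_left_mono mult_right_mono) auto
  finally show "?M \<le> 10 ^ 6 * 2 ^ 32 * Z ^ 32 * (real N + 2 ^ d)" by simp
qed

section \<open>Assembling the Monte Carlo guarantee\<close>

theorem theorem2:
  shows "\<exists>(P :: com) (b :: nat) (C :: real) (k :: nat). b \<ge> 1 \<and>
    (\<forall>(d :: nat) (N :: nat) (\<A> :: nat set set) (\<B> :: nat set set) As Bs.
       4 dvd d \<longrightarrow> N \<ge> 1 \<longrightarrow>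
       \<A> \<subseteq> nsets {1..d} (d div 4) \<longrightarrow> \<B> \<subseteq> nsets {1..d} (d div 4) \<longrightarrow>
       card \<A> \<le> N \<longrightarrow> card \<B> \<le> N \<longrightarrow>
       distinct As \<longrightarrow> set As = \<A> \<longrightarrow> distinct Bs \<longrightarrow> set Bs = \<B> \<longrightarrow>
       (\<exists>T M. real T \<le> C * (real d + log 2 (real N) + 2) ^ k * (real N * 2 ^ d / real (d choose (d div 4))) \<and>
              real M \<le> C * (real d + log 2 (real N) + 2) ^ k * (real N + 2 ^ d) \<and>
              monte_carlo (2/3) (b * (d + floorlog 2 N)) M T P (instance_words d As Bs)
                (\<exists>A\<in>\<A>. \<exists>B\<in>\<B>. A \<inter> B = {})))"
proof (rule exI[of _ prog], rule exI[of _ 60], rule exI[of _ "10 ^ 6 * 2 ^ 32"], rule exI[of _ 32],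
    intro conjI allI impI)
  show "(1::nat) \<le> 60" by simp
  fix d N :: nat and \<A> \<B> :: "nat set set" and As Bs
  assume d4: "4 dvd d" and N: "N \<ge> 1"
    and \<A>: "\<A> \<subseteq> nsets {1..d} (d div 4)" and \<B>: "\<B> \<subseteq> nsets {1..d} (d div 4)"
    and cards: "card \<A> \<le> N" "card \<B> \<le> N"
    and As: "distinct As" "set As = \<A>" and Bs: "distinct Bs" "set Bs = \<B>"
  let ?q = "\<exists>A\<in>\<A>. \<exists>B\<in>\<B>. A \<inter> B = {}"
  define m where "m = d div 4"
  define n where "n = d div 8 + 1"
  have d: "d = 4 * m" using d4 by (simp add: m_def)
  have nm: "n = m div 2 + 1" by (simp add: n_def d)
  define nA where "nA = length As"
  define nn where "nn = nA + length Bs"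
  define R where "R = 4 * (n + 2) ^ 8"
  define X where "X = 128 * (n + 2) ^ 8 * (27 ^ m div 2 ^ (4 * m) + 1)"
  define IT where "IT = R * nn * (n + 1) ^ 16"
  define L where "L = 8 * (2 ^ n * n)"
  define NB where "NB = R * (8 * 2 ^ n * n)"
  define w where "w = 60 * (d + floorlog 2 N)"
  define M where "M = 3 + nn + NB + 8 * 2 ^ n + 8 + 2 ^ (8 * n)"
  define T where "T = IT * (8 * (2 ^ n * (56 * n + 39)) + 302 * X + 446) + NB * 14 + 12 * m + 500"
  define S where "S = As @ Bs"
  define inp where "inp = (\<lambda>j. set_word (S ! j))"
  have S: "length S = nn" "\<And>j. j < nn \<Longrightarrow> S ! j \<in> nsets {1..d} m"
    "\<And>j. j < nA \<Longrightarrow> S ! j \<in> \<A>" "\<And>j. nA \<le> j \<Longrightarrow> j < nn \<Longrightarrow> S ! j \<in> \<B>"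
  proof -
    show "length S = nn" by (simp add: S_def nn_def nA_def)
    show A: "S ! j \<in> \<A>" if "j < nA" for j using that As(2) by (auto simp: S_def nn_def nA_def nth_append)
    show B: "S ! j \<in> \<B>" if "nA \<le> j" "j < nn" for j
      using that Bs(2) nth_mem[of "j - nA" Bs] by (auto simp: S_def nn_def nA_def nth_append)
    show "S ! j \<in> nsets {1..d} m" if "j < nn" for j
      using A[of j] B[of j] that \<A> \<B> unfolding m_def by (cases "j < nA") auto
  qed
  have sub: "S ! j \<subseteq> {1..d}" if "j < nn" for j using S(2)[OF that] by (simp add: nsets_def)
  have bit_inp: "bit (inp j) x \<longleftrightarrow> Suc x \<in> S ! j" if "j < nn" for j x
    using bit_set_word[OF sub[OF that]] by (simp add: inp_def)
  have len: "length As = card \<A>" "length Bs = card \<B>" 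
    using distinct_card[OF As(1)] distinct_card[OF Bs(1)] by (simp_all add: As(2) Bs(2))
  have "card \<A> \<le> 2 ^ d" "card \<B> \<le> 2 ^ d"
  proof -
    have le: "card \<C> \<le> 2 ^ d" if "\<C> \<subseteq> nsets {1..d} (d div 4)" for \<C>
    proof -
      have "\<C> \<subseteq> Pow {1..d}" using that by (auto simp: nsets_def)
      then have "card \<C> \<le> card (Pow {1..d})" by (intro card_mono) auto
      then show ?thesis by (simp add: card_Pow)
    qed
    show "card \<A> \<le> 2 ^ d" "card \<B> \<le> 2 ^ d" using le[OF \<A>] le[OF \<B>] by simp_all
  qed
  \<comment> \<open>Two bounds on the number of input sets: \<open>nnd\<close>, in terms of
    \<open>d\<close> alone, serves the word size, and \<open>nnN\<close> the time, which has to be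
    linear in \<open>N\<close>.\<close>
  then have nnd: "nn \<le> 2 * 2 ^ d" by (simp add: nn_def nA_def len)
  have nnN: "nn \<le> 2 * N" using cards by (simp add: nn_def nA_def len)
  note wb = word_size_bounds[OF n_def m_def N nnd, folded w_def R_def, folded NB_def X_def, folded M_def IT_def]
  note ts = time_space_bounds[OF d n_def N nnN, folded R_def, folded NB_def X_def, folded M_def IT_def]
  \<comment> \<open>Guess and pair are quantified inside, since the program knows neither; for the
    probability, one disjoint pair and one guess are enough.\<close>
  define good_coins where "good_coins = (\<lambda>cs. \<exists>rep<R. \<exists>g<(n + 1) ^ 16. \<exists>j<nA. \<exists>j'. nA \<le> j' \<and> j' < nn \<and>
     good n X ((!) (take L (drop (rep * L) cs))) (inp j) (inp j') g)"
  have ans: "(\<exists>a. answers w M T prog (instance_words d As Bs) a cs) \<and>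
      (\<not> ?q \<longrightarrow> answers w M T prog (instance_words d As Bs) False cs) \<and>
      (good_coins cs \<longrightarrow> answers w M T prog (instance_words d As Bs) True cs)"
    if cs: "length cs = NB" for cs
  proof -
    \<comment> \<open>The locale mentions the stored coins, so it is instantiated anew for every
      coin list.\<close>
    interpret instance_layout w M n "2 ^ n" nA nn X R NB "3 + nn" "3 + nn + NB" "3 + nn + NB + 8 * 2 ^ n"
      "3 + nn + NB + 8 * 2 ^ n + 8" inp "(!) cs" d m IT
    proof
      show "inp j < 2 ^ w" if "j < nn" for j
        unfolding inp_def by (rule less_trans[OF set_word_less[OF sub[OF that]] wb(5)])
      show "d < 2 ^ w" using wb(5) less_exp[of d] by linarith
    qed (use wb n_def m_def in \<open>auto simp: NB_def M_def nn_def R_def X_def IT_def\<close>)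
    define ws where "ws = instance_words d As Bs"
    define mm where "mm = (\<lambda>i. if i < length ws then ws ! i else 0)"
    have ws: "ws = [d, nA, nn - nA] @ map set_word S"
      by (simp add: ws_def instance_words_def nA_def nn_def S_def)
    have "runs w M prog ((\<lambda>_. 0), mm, cs) T (\<lambda>(r, m, cs'). r rans = of_bool (found IT))"
      unfolding T_def
    proof (rule prog_runs)
      show "mm 0 = d" "mm 1 = nA" "mm 2 = nn - nA" by (simp_all add: mm_def ws)
      show "mm (3 + j) = inp j" if "j < nn" for j
        using that S(1) by (simp add: mm_def ws inp_def nth_append)
      show "mm a = 0" if "3 + nn \<le> a" for a
        using that S(1) by (simp add: mm_def ws)
    qed (use cs in auto)
    then obtain t r mm' cs' where "exec w M prog ((\<lambda>_. 0), mm, cs) t (r, mm', cs')" "t \<le> T" "r 0 = of_bool (found IT)"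
      unfolding runs_def by auto
    then have a: "answers w M T prog ws (found IT) cs"
      unfolding answers_def init_state_def mm_def by blast
    have "?q" if "found IT"
    proof -
      \<comment> \<open>Without any input set there are no iterations, so nothing could have been
        found; this provides \<open>nn > 0\<close> for \<open>found_sound\<close>.\<close>
      have "IT \<noteq> 0" using that unfolding found_def by (metis not_less0)
      then have "nn > 0" by (auto simp: IT_def intro: gr0I)
      have small: "x < 8 * n" if "j < nn" "bit (inp j) x" for j x
      proof -
        have "Suc x \<le> d" using that sub[of j] bit_inp by auto
        then show ?thesis using n_def by linarith
      qed
      have "\<exists>j<nA. \<exists>j'\<ge>nA. j' < nn \<and> (\<forall>x. \<not> (bit (inp j) x \<and> bit (inp j') x))"
        by (rule found_sound[OF \<open>found IT\<close> \<open>nn > 0\<close>]) (use small in blast)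
      then obtain j j' where j: "j < nA" "nA \<le> j'" "j' < nn" "\<And>x. \<not> (bit (inp j) x \<and> bit (inp j') x)"
        by blast
      have "S ! j \<inter> S ! j' = {}"
      proof (rule ccontr)
        assume "S ! j \<inter> S ! j' \<noteq> {}"
        then obtain y where y: "y \<in> S ! j" "y \<in> S ! j'" by blast
        moreover have "1 \<le> y" using y(1) sub[of j] j by auto
        then obtain x where "y = Suc x" by (cases y) auto
        ultimately show False using j bit_inp[of j x] bit_inp[of j' x] by simp
      qed
      then show ?q using S(3)[OF j(1)] S(4)[OF j(2,3)] by blast
    qed
    moreover have "found IT" if "good_coins cs"
    proof -
      from that obtain rep g j j' where *: "rep < R" "g < (n + 1) ^ 16" "j < nA" "nA \<le> j'" "j' < nn"
        "good n X ((!) (take L (drop (rep * L) cs))) (inp j) (inp j') g"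
        unfolding good_coins_def by blast
      have "Suc rep * L \<le> R * L" using *(1) by (intro mult_right_mono) auto
      moreover have "Suc rep * L = rep * L + L" by simp
      ultimately have len: "rep * L + L \<le> length cs" using cs by (simp add: NB_def L_def mult.assoc)
      have "good n X (rep_bits rep) (inp j) (inp j') g"
      proof (rule iffD1[OF good_cong *(6)])
        fix x assume "x < 8 * (2 ^ n * n)"
        then show "take L (drop (rep * L) cs) ! x = rep_bits rep x"
          using len by (simp add: rep_bits_def L_def mult.assoc)
      qed
      then show ?thesis using found_complete * by blast
    qed
    ultimately show ?thesis using a unfolding ws_def by (cases "found IT") auto
  qed
  have NBL: "NB = R * L" by (simp add: NB_def L_def)
  have prob: "measure_pmf.prob (replicate_pmf NB (bernoulli_pmf (1/2)))
     {cs. answers w M T prog (instance_words d As Bs) ?q cs} \<ge> 2 / 3"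
  proof (cases ?q)
    case False
    \<comment> \<open>The error is one-sided: without a disjoint pair every coin list leads to the
      right answer.\<close>
    then have "{cs. answers w M T prog (instance_words d As Bs) ?q cs \<and> length cs = NB} = {cs. length cs = NB}"
      using ans by auto
    then show ?thesis unfolding prob_coins by (simp add: card_bool_lists)
  next
    case True
    then obtain A B where AB: "A \<in> \<A>" "B \<in> \<B>" "A \<inter> B = {}" by blast
    obtain j where j: "j < nA" "S ! j = A"
      using AB(1) As(2) by (auto simp: in_set_conv_nth S_def nA_def nth_append)
    obtain j0 where "j0 < length Bs" "Bs ! j0 = B" using AB(2) Bs(2) by (auto simp: in_set_conv_nth)
    then have j': "nA \<le> nA + j0" "nA + j0 < nn" "S ! (nA + j0) = B" by (auto simp: S_def nA_def nn_def nth_append)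
    have jn: "j < nn" using j by (simp add: nn_def)
    have "\<exists>g<(n + 1) ^ 16. 2 ^ L / (2 * (real n + 2) ^ 8) \<le>
        real (card {l. length l = L \<and> good n X ((!) l) (inp j) (inp (nA + j0)) g})"
      unfolding L_def
    proof (rule good_fraction[OF nm])
      show "\<not> (bit (inp j) x \<and> bit (inp (nA + j0)) x)" for x
        using AB(3) j j' jn by (auto simp: bit_inp)
      have "d \<le> 8 * n" using n_def by linarith
      then show "card {x. x < 8 * n \<and> bit (inp j) x} = m" "card {x. x < 8 * n \<and> bit (inp (nA + j0)) x} = m"
        unfolding inp_def using card_bits_set_word S(2) jn j'(2) by blast+
      \<comment> \<open>The integer quotient plus 1 exceeds the real quotient, so \<open>X\<close>
        meets the requirement of \<open>good_fraction\<close>.\<close>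
      have "(27 / 16 :: real) ^ m = real (27 ^ m) / real (2 ^ (4 * m))" by (simp add: power_divide power_mult)
      also have "\<dots> = real (27 ^ m div 2 ^ (4 * m)) + real (27 ^ m mod 2 ^ (4 * m)) / real (2 ^ (4 * m))"
        by (rule of_nat_of_nat_div_aux)
      also have "\<dots> \<le> real (27 ^ m div 2 ^ (4 * m) + 1)"
        using mod_less_divisor[of "2 ^ (4 * m)" "27 ^ m"] by (simp add: divide_le_eq less_imp_le)
      finally have "128 * (real n + 2) ^ 8 * (27 / 16) ^ m \<le> 128 * (real n + 2) ^ 8 * real (27 ^ m div 2 ^ (4 * m) + 1)"
        by (rule mult_left_mono) simp
      also have "\<dots> = real X" by (simp add: X_def add.commute distrib_left)
      finally show "128 * (real n + 2) ^ 8 * (27 / 16) ^ m \<le> real X" .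
    qed
    then obtain g where g: "g < (n + 1) ^ 16" "2 ^ L / (2 * (real n + 2) ^ 8) \<le>
        real (card {l. length l = L \<and> good n X ((!) l) (inp j) (inp (nA + j0)) g})" by blast
    let ?G = "{l. length l = L \<and> good n X ((!) l) (inp j) (inp (nA + j0)) g}"
    have c1: "(real n + 2) ^ 8 \<ge> 1" by (simp add: one_le_power)
    then have c2: "1 \<le> 2 * (real n + 2) ^ 8" by linarith
    have "2 / 3 * 2 ^ (R * L) \<le> real (card {cs. length cs = R * L \<and> (\<exists>r<R. take L (drop (r * L) cs) \<in> ?G)})"
    proof (rule card_some_chunk[where y = "1 / (2 * (real n + 2) ^ 8)"])
      show "real R * (1 / (2 * (real n + 2) ^ 8)) = 2"
        using c1 by (simp add: R_def add.commute)
    qed (use g c2 in auto)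
    also have "{cs. length cs = R * L \<and> (\<exists>r<R. take L (drop (r * L) cs) \<in> ?G)} \<subseteq>
        {cs \<in> {cs. answers w M T prog (instance_words d As Bs) ?q cs}. length cs = NB}"
    proof
      fix cs assume cs: "cs \<in> {cs. length cs = R * L \<and> (\<exists>r<R. take L (drop (r * L) cs) \<in> ?G)}"
      then have "good_coins cs"
        unfolding good_coins_def using g(1) j(1) j'(1,2) by blast
      then show "cs \<in> {cs \<in> {cs. answers w M T prog (instance_words d As Bs) ?q cs}. length cs = NB}"
        using ans[of cs] cs True NBL by simp
    qed
    then have "real (card {cs. length cs = R * L \<and> (\<exists>r<R. take L (drop (r * L) cs) \<in> ?G)}) \<le>
        real (card {cs \<in> {cs. answers w M T prog (instance_words d As Bs) ?q cs}. length cs = NB})"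
      using finite_bool_lists[of NB "\<lambda>cs. answers w M T prog (instance_words d As Bs) ?q cs"]
      by (intro of_nat_mono card_mono) (auto simp: conj_commute)
    finally show ?thesis unfolding prob_coins NBL by (simp add: field_simps)
  qed
  show "\<exists>T M. real T \<le> 10 ^ 6 * 2 ^ 32 * (real d + log 2 (real N) + 2) ^ 32 * (real N * 2 ^ d / real (d choose (d div 4))) \<and>
      real M \<le> 10 ^ 6 * 2 ^ 32 * (real d + log 2 (real N) + 2) ^ 32 * (real N + 2 ^ d) \<and>
      monte_carlo (2/3) (60 * (d + floorlog 2 N)) M T prog (instance_words d As Bs) ?q"
  proof (rule exI[of _ T], rule exI[of _ M], intro conjI)
    show "real T \<le> 10 ^ 6 * 2 ^ 32 * (real d + log 2 (real N) + 2) ^ 32 * (real N * 2 ^ d / real (d choose (d div 4)))"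
      using ts(1) unfolding T_def m_def[symmetric] .
    show "real M \<le> 10 ^ 6 * 2 ^ 32 * (real d + log 2 (real N) + 2) ^ 32 * (real N + 2 ^ d)"
      by (rule ts(2))
    show "monte_carlo (2/3) (60 * (d + floorlog 2 N)) M T prog (instance_words d As Bs) ?q"
      unfolding monte_carlo_def w_def[symmetric]
    proof (intro exI[of _ NB] conjI allI impI)
      fix cs :: "bool list"
      assume "length cs = NB"
      from ans[OF this] show "\<exists>a. answers w M T prog (instance_words d As Bs) a cs" by blast
    qed (rule prob)
  qed
qed

end
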